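(* Let $\mathcal E$ be a regular Dirichlet form on $L^2(X,m)$ and $h=\mathcal E+\nu=\mathcal E+\nu^+-\nu^-$ with $\nu^+\in\mathcal M_0$ and $\nu^-\in\mathcal M_1$. Let $u\ge0$ be a generalized eigenfunction of $h$ to the generalized eigenvalue $\lambda\in\mathbb R$ with $u^{-1}\in\mathcal D_{loc}^*\cap L^\infty_{loc}$. Then $h\ge\lambda$, i.e. $h(\phi,\phi)\ge\lambda\|\phi\|^2$ for all $\phi\in\mathcal D(h)$.
   Context: Setting. $X$ is a locally compact separable metric space, $m$ a positive Radon measure on $X$ with $\operatorname{supp} m=X$; all functions are real valued; $(\cdot,\cdot)$ and $\|\cdot\|$ are the inner product and norm of $L^2(X,m)$; $C_c(X)$ is the set of continuous compactly supported functions. $\mathcal E:\mathcal D\times\mathcal D\to\mathbb R$, with $\mathcal D$ dense in $L^2(X,m)$, is a regular (symmetric) Dirichlet form: it is closed, non-negative, $\mathcal E(T\circ u,T\circ u)\le\mathcal E(u,u)$ for all normal contractions $T$, and $\mathcal D\cap C_c(X)$ is dense in $\mathcal D$ with respect to $\sqrt{\mathcal E_1}$, where $\mathcal E_1(u,u)=\mathcal E(u,u)+\|u\|^2$, and dense in $C_c(X)$ with respect to $\|\cdot\|_\infty$. For bilinear $q$ write $q(u):=q(u,u)$. Capacity: $\operatorname{cap}(U)=\inf\{\mathcal E_1(v): v\in\mathcal D,\ 1_U\le v\}$ for $U$ open, $\operatorname{cap}(A)=\inf\{\operatorname{cap}(U):A\subset U,\ U\text{ open}\}$. $\tilde u$ denotes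 a quasi-continuous representative of $u$ (existing for $u\in\mathcal D$ and $u\in\mathcal D_{loc}$). Beurling–Deny formula: with $d=\{(x,x):x\in X\}$, there are a non-negative Radon measure $k$ on $X$, a non-negative symmetric Radon measure $J$ on $X\times X\setminus d$, and a positive semidefinite strongly local bilinear form $\mu^{(c)}$ on $\mathcal D$ with values in the signed Radon measures on $X$ ($\mu^{(c)}(u,v)=0$ if $u$ is constant on $\operatorname{supp}v$), such that for $u\in\mathcal D$ $$\mathcal E(u)=\int_{X\times X\setminus d}(\tilde u(x)-\tilde u(y))^2\,J(dx,dy)+\int_X d\mu^{(c)}(u)+\int_X\tilde u^2\,dk.$$ Local spaces: $\mathcal D_{loc}$ is the set of $u\in L^2_{loc}$ such that for every open relatively compact $G\subset X$ there is $v\in\mathcal D$ with $u=v$ on $G$. $\mathcal D_{loc}^*$ is the set of $u\in\mathcal D_{loc}$ with $\int_{K\times X\setminus d}(\tilde u(x)-\tilde u(y))^2J(dx,dy)<\infty$ for all compact $K\subset X$. $\mu^{(c)}$ is extended to $\mathcal D_{loc}$ by locality; for $u\in\mathcal D_{loc}^*$, $\mu^{(b)}(u)(E)=\int_{E\times X\setminus d}(\tilde u(x)-\tilde u(y))^2J(dx,dy)$; $\mu^{(d)}=\mu^{(b)}+\mu^{(c)}$; $\mu^{( * )}(u,v)$ by polarization. For $u\in\mathcal D_{loc}^*$ and $\varphi\in\mathcal D$ with compact support, $\mathcal E(u,\varphi):=\int_X d\mu^{(d)}(u,\varphi)+\int_X\tilde u\tilde\varphi\,dk$. Perturbation: $\mathcal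 M_0$ is the set of $\sigma$-additive $\nu:\mathcal B\to[0,\infty]$ ($\mathcal B$ the Borel sets of $X$) charging no set of capacity zero; $\nu(u,v)=\int_X\tilde u\tilde v\,d\nu$; $\mathcal D(\nu)=\{u\in\mathcal D:\tilde u\in L^2(X,\nu)\}$. $\mathcal M_1$ is the set of $\nu\in\mathcal M_0$ for which there are $q<1$, $C_q\ge0$ with $\nu(u)\le q\,\mathcal E(u)+C_q\|u\|^2$ for all $u\in\mathcal D$. The form $h=\mathcal E+\nu^+-\nu^-$ has domain $\mathcal D(h)=\mathcal D\cap\mathcal D(\nu^+)$ and is closed. $\mathcal D_{loc}^*(h)$ is defined like $\mathcal D_{loc}^*$ with $\mathcal D(h)$ in place of $\mathcal D$ (locally agreeing with elements of $\mathcal D(h)$, same finiteness condition on $J$). For $u\in\mathcal D_{loc}^*(h)$ and $\varphi\in\mathcal D(h)$ with compact support, $h(u,\varphi):=\mathcal E(u,\varphi)+\int\tilde u\tilde\varphi\,d\nu^+-\int\tilde u\tilde\varphi\,d\nu^-$. A function $u\in\mathcal D_{loc}^*(h)\setminus\{0\}$ is a generalized eigenfunction to the generalized eigenvalue $\lambda\in\mathbb R$ if $h(u,\varphi)=\lambda(u,\varphi)$ for all $\varphi\in\mathcal D(h)$ with compact support. *)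

theory Defs
  imports "HOL-Analysis.Analysis"
begin

(* Elements of L^2(X,m) and its local variants are represented by Borel functions on X;
   two functions that agree m-almost everywhere represent the same element, and all
   notions below are invariant under this identification. The space X is a whole type of
   class {metric_space, second_countable_topology}, i.e. a separable metric space. *)

(* On a locally compact separable metric space every Borel measure that is finite on
   compact sets is regular, so local finiteness is the only condition. *)
definition radon_measure :: "'a::topological_space measure \<Rightarrow> bool" where
  "radon_measure M \<longleftrightarrow> sets M = sets borel \<and> (\<forall>K. compact K \<longrightarrow> emeasure M K < \<infinity>)"

definition full_support :: "'a::topological_space measure \<Rightarrow> bool" where
  "full_support M \<longleftrightarrow> (\<forall>U. open U \<and> U \<noteq> {} \<longrightarrow> emeasure M U > 0)"

definition L2 :: "'a measure \<Rightarrow> ('a \<Rightarrow> real) set" where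
  "L2 m = {u. u \<in> borel_measurable m \<and> integrable m (\<lambda>x. (u x)\<^sup>2)}"

definition L2_inner :: "'a measure \<Rightarrow> ('a \<Rightarrow> real) \<Rightarrow> ('a \<Rightarrow> real) \<Rightarrow> real" where
  "L2_inner m u v = (\<integral>x. u x * v x \<partial>m)"

definition L2_loc :: "'a::topological_space measure \<Rightarrow> ('a \<Rightarrow> real) set" where
  "L2_loc m = {u. u \<in> borel_measurable m \<and>
     (\<forall>K. compact K \<longrightarrow> set_integrable m K (\<lambda>x. (u x)\<^sup>2))}"

definition Linf_loc :: "'a::topological_space measure \<Rightarrow> ('a \<Rightarrow> real) set" where
  "Linf_loc m = {u. u \<in> borel_measurable m \<and>
     (\<forall>K. compact K \<longrightarrow> (\<exists>C. AE x in m. x \<in> K \<longrightarrow> \<bar>u x\<bar> \<le> C))}"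

definition Cc :: "('a::topological_space \<Rightarrow> real) set" where
  "Cc = {f. continuous_on UNIV f \<and> compact (closure {x. f x \<noteq> 0})}"

(* Support of the class of u, i.e. of the measure |u| m: the complement of the largest open
   set on which u vanishes almost everywhere. *)
definition supp :: "'a::topological_space measure \<Rightarrow> ('a \<Rightarrow> real) \<Rightarrow> 'a set" where
  "supp m u = {x. \<forall>G. open G \<and> x \<in> G \<longrightarrow> \<not> (AE y in m. y \<in> G \<longrightarrow> u y = 0)}"

definition E1 ::
  "'a measure \<Rightarrow> (('a \<Rightarrow> real) \<Rightarrow> ('a \<Rightarrow> real) \<Rightarrow> real) \<Rightarrow> ('a \<Rightarrow> real) \<Rightarrow> ('a \<Rightarrow> real) \<Rightarrow> real" where
  "E1 m E u v = E u v + L2_inner m u v"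

definition normal_contraction :: "(real \<Rightarrow> real) \<Rightarrow> bool" where
  "normal_contraction T \<longleftrightarrow> T 0 = 0 \<and> (\<forall>x y. \<bar>T x - T y\<bar> \<le> \<bar>x - y\<bar>)"

(* A densely defined, non-negative symmetric bilinear form on L^2(m). The last two
   conditions express that domain and form live on m-almost-everywhere classes. *)
definition symmetric_form ::
  "'a measure \<Rightarrow> ('a \<Rightarrow> real) set \<Rightarrow> (('a \<Rightarrow> real) \<Rightarrow> ('a \<Rightarrow> real) \<Rightarrow> real) \<Rightarrow> bool" where
  "symmetric_form m D E \<longleftrightarrow>
     D \<subseteq> L2 m \<and> (\<lambda>x. 0) \<in> D \<and>
     (\<forall>u\<in>D. \<forall>v\<in>D. (\<lambda>x. u x + v x) \<in> D) \<and>
     (\<forall>u\<in>D. \<forall>c. (\<lambda>x. c * u x) \<in> D) \<and>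
     (\<forall>f\<in>L2 m. \<forall>\<epsilon>>0. \<exists>u\<in>D. L2_inner m (\<lambda>x. f x - u x) (\<lambda>x. f x - u x) < \<epsilon>) \<and>
     (\<forall>u\<in>D. \<forall>v\<in>D. E u v = E v u) \<and>
     (\<forall>u\<in>D. \<forall>v\<in>D. \<forall>w\<in>D. E (\<lambda>x. u x + v x) w = E u w + E v w) \<and>
     (\<forall>u\<in>D. \<forall>w\<in>D. \<forall>c. E (\<lambda>x. c * u x) w = c * E u w) \<and>
     (\<forall>u\<in>D. 0 \<le> E u u) \<and>
     (\<forall>u\<in>D. \<forall>v\<in>borel_measurable m. (AE x in m. u x = v x) \<longrightarrow> v \<in> D) \<and>
     (\<forall>u\<in>D. \<forall>v\<in>D. \<forall>w\<in>D. (AE x in m. u x = v x) \<longrightarrow> E u w = E v w)"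

definition closed_form ::
  "'a measure \<Rightarrow> ('a \<Rightarrow> real) set \<Rightarrow> (('a \<Rightarrow> real) \<Rightarrow> ('a \<Rightarrow> real) \<Rightarrow> real) \<Rightarrow> bool" where
  "closed_form m D E \<longleftrightarrow>
     (\<forall>u :: nat \<Rightarrow> 'a \<Rightarrow> real. (\<forall>n. u n \<in> D) \<longrightarrow>
        (\<forall>\<epsilon>>0. \<exists>N. \<forall>i\<ge>N. \<forall>j\<ge>N. E1 m E (\<lambda>x. u i x - u j x) (\<lambda>x. u i x - u j x) < \<epsilon>) \<longrightarrow>
        (\<exists>v\<in>D. (\<lambda>n. E1 m E (\<lambda>x. u n x - v x) (\<lambda>x. u n x - v x)) \<longlonglongrightarrow> 0))"

definition dirichlet_form ::
  "'a measure \<Rightarrow> ('a \<Rightarrow> real) set \<Rightarrow> (('a \<Rightarrow> real) \<Rightarrow> ('a \<Rightarrow> real) \<Rightarrow> real) \<Rightarrow> bool" where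
  "dirichlet_form m D E \<longleftrightarrow>
     symmetric_form m D E \<and> closed_form m D E \<and>
     (\<forall>T u. normal_contraction T \<and> u \<in> D \<longrightarrow> T \<circ> u \<in> D \<and> E (T \<circ> u) (T \<circ> u) \<le> E u u)"

definition regular_dirichlet_form ::
  "'a::topological_space measure \<Rightarrow> ('a \<Rightarrow> real) set \<Rightarrow>
   (('a \<Rightarrow> real) \<Rightarrow> ('a \<Rightarrow> real) \<Rightarrow> real) \<Rightarrow> bool" where
  "regular_dirichlet_form m D E \<longleftrightarrow>
     dirichlet_form m D E \<and>
     (\<forall>u\<in>D. \<forall>\<epsilon>>0. \<exists>w\<in>D \<inter> Cc. E1 m E (\<lambda>x. u x - w x) (\<lambda>x. u x - w x) < \<epsilon>) \<and>
     (\<forall>f\<in>Cc. \<forall>\<epsilon>>0. \<exists>w\<in>D \<inter> Cc. \<forall>x. \<bar>f x - w x\<bar> < \<epsilon>)"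

(* The infimum over the empty set is infinity. *)
definition cap_open ::
  "'a::topological_space measure \<Rightarrow> ('a \<Rightarrow> real) set \<Rightarrow>
   (('a \<Rightarrow> real) \<Rightarrow> ('a \<Rightarrow> real) \<Rightarrow> real) \<Rightarrow> 'a set \<Rightarrow> ennreal" where
  "cap_open m D E U = (INF v\<in>{v\<in>D. AE x in m. indicator U x \<le> v x}. ennreal (E1 m E v v))"

definition cap ::
  "'a::topological_space measure \<Rightarrow> ('a \<Rightarrow> real) set \<Rightarrow>
   (('a \<Rightarrow> real) \<Rightarrow> ('a \<Rightarrow> real) \<Rightarrow> real) \<Rightarrow> 'a set \<Rightarrow> ennreal" where
  "cap m D E A = (INF U\<in>{U. open U \<and> A \<subseteq> U}. cap_open m D E U)"

definition quasi_continuous ::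
  "'a::topological_space measure \<Rightarrow> ('a \<Rightarrow> real) set \<Rightarrow>
   (('a \<Rightarrow> real) \<Rightarrow> ('a \<Rightarrow> real) \<Rightarrow> real) \<Rightarrow> ('a \<Rightarrow> real) \<Rightarrow> bool" where
  "quasi_continuous m D E w \<longleftrightarrow>
     (\<forall>\<epsilon>>0. \<exists>U. open U \<and> cap m D E U < ennreal \<epsilon> \<and> continuous_on (- U) w)"

(* A quasi-continuous function is Borel off a set of capacity zero, so Borel measurability
   is no restriction on the representative; it makes the integrals below meaningful. *)
definition qc_version ::
  "'a::topological_space measure \<Rightarrow> ('a \<Rightarrow> real) set \<Rightarrow>
   (('a \<Rightarrow> real) \<Rightarrow> ('a \<Rightarrow> real) \<Rightarrow> real) \<Rightarrow> ('a \<Rightarrow> real) \<Rightarrow> ('a \<Rightarrow> real) \<Rightarrow> bool" where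
  "qc_version m D E u w \<longleftrightarrow>
     w \<in> borel_measurable borel \<and> quasi_continuous m D E w \<and> (AE x in m. w x = u x)"

(* Unique up to sets of capacity zero; these are null sets for all measures involved. *)
definition qc ::
  "'a::topological_space measure \<Rightarrow> ('a \<Rightarrow> real) set \<Rightarrow>
   (('a \<Rightarrow> real) \<Rightarrow> ('a \<Rightarrow> real) \<Rightarrow> real) \<Rightarrow> ('a \<Rightarrow> real) \<Rightarrow> 'a \<Rightarrow> real" where
  "qc m D E u = (SOME w. qc_version m D E u w)"

definition diag :: "('a \<times> 'a) set" where
  "diag = {(x, y). x = y}"

(* A Radon measure on X x X minus the diagonal, encoded as a Borel measure on X x X that
   does not charge the diagonal. *)
definition jump_measure :: "('a::{metric_space,second_countable_topology} \<times> 'a) measure \<Rightarrow> bool" where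
  "jump_measure J \<longleftrightarrow>
     sets J = sets borel \<and> emeasure J diag = 0 \<and>
     (\<forall>K. compact K \<and> K \<inter> diag = {} \<longrightarrow> emeasure J K < \<infinity>) \<and>
     (\<forall>A\<in>sets borel. emeasure J (prod.swap -` A) = emeasure J A)"

(* A finite signed Borel measure, given by its values on Borel sets. *)
definition signed_borel_measure :: "('a::topological_space set \<Rightarrow> real) \<Rightarrow> bool" where
  "signed_borel_measure \<mu> \<longleftrightarrow>
     \<mu> {} = 0 \<and>
     (\<forall>A :: nat \<Rightarrow> 'a set. range A \<subseteq> sets borel \<and> disjoint_family A \<longrightarrow>
        (\<lambda>i. \<mu> (A i)) sums \<mu> (\<Union>i. A i))"

(* The values mu(u,v) for u, v in D are finite since mu(u)(X) <= E(u). The last but one clause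
   is the defining property of strong locality. The last clause is the same locality on the
   level of the measures: mu(u,v) restricted to an open set G only sees u up to constants on
   G. It is what makes the extension of mu by locality meaningful: without it, the values of
   mu(u,v) could still be transported to a different part of X. *)
definition strongly_local_measure_form ::
  "'a::topological_space measure \<Rightarrow> ('a \<Rightarrow> real) set \<Rightarrow>
   (('a \<Rightarrow> real) \<Rightarrow> ('a \<Rightarrow> real) \<Rightarrow> 'a set \<Rightarrow> real) \<Rightarrow> bool" where
  "strongly_local_measure_form m D \<mu> \<longleftrightarrow>
     (\<forall>u\<in>D. \<forall>v\<in>D. signed_borel_measure (\<mu> u v)) \<and>
     (\<forall>u\<in>D. \<forall>v\<in>D. \<forall>A\<in>sets borel. \<mu> u v A = \<mu> v u A) \<and>
     (\<forall>u\<in>D. \<forall>v\<in>D. \<forall>w\<in>D. \<forall>A\<in>sets borel. \<mu> (\<lambda>x. u x + v x) w A = \<mu> u w A + \<mu> v w A) \<and>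
     (\<forall>u\<in>D. \<forall>w\<in>D. \<forall>c. \<forall>A\<in>sets borel. \<mu> (\<lambda>x. c * u x) w A = c * \<mu> u w A) \<and>
     (\<forall>u\<in>D. \<forall>A\<in>sets borel. 0 \<le> \<mu> u u A) \<and>
     (\<forall>u\<in>D. \<forall>v\<in>D. (\<exists>c. AE x in m. x \<in> supp m v \<longrightarrow> u x = c) \<longrightarrow>
        (\<forall>A\<in>sets borel. \<mu> u v A = 0)) \<and>
     (\<forall>u\<in>D. \<forall>v\<in>D. \<forall>G. open G \<and> (\<exists>c. AE x in m. x \<in> G \<longrightarrow> u x = c) \<longrightarrow>
        (\<forall>A\<in>sets borel. A \<subseteq> G \<longrightarrow> \<mu> u v A = 0))"

(* (J, mu, k) are the jump, strongly local and killing part of E. The formula is required for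
   every choice w of the quasi-continuous version of u; in particular J and k do not see the
   choice. The three parts are uniquely determined by E. *)
definition beurling_deny ::
  "'a::{metric_space,second_countable_topology} measure \<Rightarrow> ('a \<Rightarrow> real) set \<Rightarrow>
   (('a \<Rightarrow> real) \<Rightarrow> ('a \<Rightarrow> real) \<Rightarrow> real) \<Rightarrow> ('a \<times> 'a) measure \<Rightarrow>
   (('a \<Rightarrow> real) \<Rightarrow> ('a \<Rightarrow> real) \<Rightarrow> 'a set \<Rightarrow> real) \<Rightarrow> 'a measure \<Rightarrow> bool" where
  "beurling_deny m D E J \<mu> k \<longleftrightarrow>
     jump_measure J \<and> strongly_local_measure_form m D \<mu> \<and> radon_measure k \<and>
     (\<forall>u\<in>D. \<forall>w. qc_version m D E u w \<longrightarrow>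
        ennreal (E u u) =
          (\<integral>\<^sup>+z. ennreal ((w (fst z) - w (snd z))\<^sup>2) \<partial>J) + ennreal (\<mu> u u UNIV) +
          (\<integral>\<^sup>+x. ennreal ((w x)\<^sup>2) \<partial>k))"

(* The local space of a domain D0, which will be D or D(h). *)
definition D_loc :: "'a::topological_space measure \<Rightarrow> ('a \<Rightarrow> real) set \<Rightarrow> ('a \<Rightarrow> real) set" where
  "D_loc m D0 = {u\<in>L2_loc m. \<forall>G. open G \<and> compact (closure G) \<longrightarrow>
     (\<exists>v\<in>D0. AE x in m. x \<in> G \<longrightarrow> u x = v x)}"

(* D and E determine the capacity and thereby the quasi-continuous versions; D0 is the
   domain (D or D(h)) that is localized. *)
definition D_loc_star ::
  "'a::{metric_space,second_countable_topology} measure \<Rightarrow> ('a \<Rightarrow> real) set \<Rightarrow>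
   (('a \<Rightarrow> real) \<Rightarrow> ('a \<Rightarrow> real) \<Rightarrow> real) \<Rightarrow> ('a \<times> 'a) measure \<Rightarrow> ('a \<Rightarrow> real) set \<Rightarrow>
   ('a \<Rightarrow> real) set" where
  "D_loc_star m D E J D0 = {u\<in>D_loc m D0. \<forall>K. compact K \<longrightarrow>
     (\<integral>\<^sup>+z\<in>K \<times> UNIV. ennreal ((qc m D E u (fst z) - qc m D E u (snd z))\<^sup>2) \<partial>J) < \<infinity>}"

(* The polarized form of mu^(b)(u)(A). *)
definition mu_b ::
  "'a::{metric_space,second_countable_topology} measure \<Rightarrow> ('a \<Rightarrow> real) set \<Rightarrow>
   (('a \<Rightarrow> real) \<Rightarrow> ('a \<Rightarrow> real) \<Rightarrow> real) \<Rightarrow> ('a \<times> 'a) measure \<Rightarrow>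
   ('a \<Rightarrow> real) \<Rightarrow> ('a \<Rightarrow> real) \<Rightarrow> 'a set \<Rightarrow> real" where
  "mu_b m D E J u v A = set_lebesgue_integral J (A \<times> UNIV)
     (\<lambda>z. (qc m D E u (fst z) - qc m D E u (snd z)) * (qc m D E v (fst z) - qc m D E v (snd z)))"

(* The extension of mu^(c)(u,phi) to u in D_loc, for phi in D with compact support: u is
   replaced by an element of D that agrees with u on a relatively compact neighbourhood of
   the support of phi. By strong locality the result does not depend on the choice. *)
definition mu_c_ext ::
  "'a::topological_space measure \<Rightarrow> ('a \<Rightarrow> real) set \<Rightarrow>
   (('a \<Rightarrow> real) \<Rightarrow> ('a \<Rightarrow> real) \<Rightarrow> 'a set \<Rightarrow> real) \<Rightarrow>
   ('a \<Rightarrow> real) \<Rightarrow> ('a \<Rightarrow> real) \<Rightarrow> 'a set \<Rightarrow> real" where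
  "mu_c_ext m D \<mu> u \<phi> =
     \<mu> (SOME v. v \<in> D \<and> (\<exists>G. open G \<and> compact (closure G) \<and> supp m \<phi> \<subseteq> G \<and>
            (AE x in m. x \<in> G \<longrightarrow> u x = v x))) \<phi>"

definition mu_d ::
  "'a::{metric_space,second_countable_topology} measure \<Rightarrow> ('a \<Rightarrow> real) set \<Rightarrow>
   (('a \<Rightarrow> real) \<Rightarrow> ('a \<Rightarrow> real) \<Rightarrow> real) \<Rightarrow> ('a \<times> 'a) measure \<Rightarrow>
   (('a \<Rightarrow> real) \<Rightarrow> ('a \<Rightarrow> real) \<Rightarrow> 'a set \<Rightarrow> real) \<Rightarrow>
   ('a \<Rightarrow> real) \<Rightarrow> ('a \<Rightarrow> real) \<Rightarrow> 'a set \<Rightarrow> real" where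
  "mu_d m D E J \<mu> u \<phi> A = mu_b m D E J u \<phi> A + mu_c_ext m D \<mu> u \<phi> A"

(* nu(u,v) for a measure nu. *)
definition meas_form ::
  "'a::topological_space measure \<Rightarrow> ('a \<Rightarrow> real) set \<Rightarrow>
   (('a \<Rightarrow> real) \<Rightarrow> ('a \<Rightarrow> real) \<Rightarrow> real) \<Rightarrow> 'a measure \<Rightarrow>
   ('a \<Rightarrow> real) \<Rightarrow> ('a \<Rightarrow> real) \<Rightarrow> real" where
  "meas_form m D E \<nu> u v = (\<integral>x. qc m D E u x * qc m D E v x \<partial>\<nu>)"

(* E(u,phi) for u in D_loc_star and phi in D with compact support. *)
definition E_ext ::
  "'a::{metric_space,second_countable_topology} measure \<Rightarrow> ('a \<Rightarrow> real) set \<Rightarrow>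
   (('a \<Rightarrow> real) \<Rightarrow> ('a \<Rightarrow> real) \<Rightarrow> real) \<Rightarrow> ('a \<times> 'a) measure \<Rightarrow>
   (('a \<Rightarrow> real) \<Rightarrow> ('a \<Rightarrow> real) \<Rightarrow> 'a set \<Rightarrow> real) \<Rightarrow> 'a measure \<Rightarrow>
   ('a \<Rightarrow> real) \<Rightarrow> ('a \<Rightarrow> real) \<Rightarrow> real" where
  "E_ext m D E J \<mu> k u \<phi> = mu_d m D E J \<mu> u \<phi> UNIV + meas_form m D E k u \<phi>"

definition M0 ::
  "'a::topological_space measure \<Rightarrow> ('a \<Rightarrow> real) set \<Rightarrow>
   (('a \<Rightarrow> real) \<Rightarrow> ('a \<Rightarrow> real) \<Rightarrow> real) \<Rightarrow> 'a measure set" where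
  "M0 m D E = {\<nu>. sets \<nu> = sets borel \<and>
     (\<forall>A\<in>sets borel. cap m D E A = 0 \<longrightarrow> emeasure \<nu> A = 0)}"

definition dom_meas ::
  "'a::topological_space measure \<Rightarrow> ('a \<Rightarrow> real) set \<Rightarrow>
   (('a \<Rightarrow> real) \<Rightarrow> ('a \<Rightarrow> real) \<Rightarrow> real) \<Rightarrow> 'a measure \<Rightarrow> ('a \<Rightarrow> real) set" where
  "dom_meas m D E \<nu> = {u\<in>D. qc m D E u \<in> L2 \<nu>}"

definition M1 ::
  "'a::topological_space measure \<Rightarrow> ('a \<Rightarrow> real) set \<Rightarrow>
   (('a \<Rightarrow> real) \<Rightarrow> ('a \<Rightarrow> real) \<Rightarrow> real) \<Rightarrow> 'a measure set" where
  "M1 m D E = {\<nu>\<in>M0 m D E. \<exists>q<1. \<exists>C\<ge>0. \<forall>u\<in>D.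
     u \<in> dom_meas m D E \<nu> \<and> meas_form m D E \<nu> u u \<le> q * E u u + C * L2_inner m u u}"

(* The domain of h = E + nu^+ - nu^-. *)
definition h_dom ::
  "'a::topological_space measure \<Rightarrow> ('a \<Rightarrow> real) set \<Rightarrow>
   (('a \<Rightarrow> real) \<Rightarrow> ('a \<Rightarrow> real) \<Rightarrow> real) \<Rightarrow> 'a measure \<Rightarrow> ('a \<Rightarrow> real) set" where
  "h_dom m D E \<nu>p = D \<inter> dom_meas m D E \<nu>p"

definition h_form ::
  "'a::topological_space measure \<Rightarrow> ('a \<Rightarrow> real) set \<Rightarrow>
   (('a \<Rightarrow> real) \<Rightarrow> ('a \<Rightarrow> real) \<Rightarrow> real) \<Rightarrow> 'a measure \<Rightarrow> 'a measure \<Rightarrow>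
   ('a \<Rightarrow> real) \<Rightarrow> ('a \<Rightarrow> real) \<Rightarrow> real" where
  "h_form m D E \<nu>p \<nu>m u v = E u v + meas_form m D E \<nu>p u v - meas_form m D E \<nu>m u v"

definition h_ext ::
  "'a::{metric_space,second_countable_topology} measure \<Rightarrow> ('a \<Rightarrow> real) set \<Rightarrow>
   (('a \<Rightarrow> real) \<Rightarrow> ('a \<Rightarrow> real) \<Rightarrow> real) \<Rightarrow> ('a \<times> 'a) measure \<Rightarrow>
   (('a \<Rightarrow> real) \<Rightarrow> ('a \<Rightarrow> real) \<Rightarrow> 'a set \<Rightarrow> real) \<Rightarrow> 'a measure \<Rightarrow> 'a measure \<Rightarrow> 'a measure \<Rightarrow>
   ('a \<Rightarrow> real) \<Rightarrow> ('a \<Rightarrow> real) \<Rightarrow> real" where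
  "h_ext m D E J \<mu> k \<nu>p \<nu>m u \<phi> =
     E_ext m D E J \<mu> k u \<phi> + meas_form m D E \<nu>p u \<phi> - meas_form m D E \<nu>m u \<phi>"

definition generalized_eigenfunction ::
  "'a::{metric_space,second_countable_topology} measure \<Rightarrow> ('a \<Rightarrow> real) set \<Rightarrow>
   (('a \<Rightarrow> real) \<Rightarrow> ('a \<Rightarrow> real) \<Rightarrow> real) \<Rightarrow> ('a \<times> 'a) measure \<Rightarrow>
   (('a \<Rightarrow> real) \<Rightarrow> ('a \<Rightarrow> real) \<Rightarrow> 'a set \<Rightarrow> real) \<Rightarrow> 'a measure \<Rightarrow> 'a measure \<Rightarrow> 'a measure \<Rightarrow>
   real \<Rightarrow> ('a \<Rightarrow> real) \<Rightarrow> bool" where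
  "generalized_eigenfunction m D E J \<mu> k \<nu>p \<nu>m lam u \<longleftrightarrow>
     u \<in> D_loc_star m D E J (h_dom m D E \<nu>p) \<and> \<not> (AE x in m. u x = 0) \<and>
     (\<forall>\<phi>\<in>h_dom m D E \<nu>p. compact (supp m \<phi>) \<longrightarrow>
        h_ext m D E J \<mu> k \<nu>p \<nu>m u \<phi> = lam * L2_inner m u \<phi>)"

end

theory Submission
  imports Defs
begin

text \<open>
  The proof is a ground state argument. For a function \<open>\<phi>\<close> in the domain of \<open>h\<close> with compact
  support and \<open>s > 0\<close>, the eigenvalue equation is tested with
  \<open>W = sqrt (u\<^sup>2 + (s \<phi>)\<^sup>2) - u\<close>, which behaves like \<open>s\<^sup>2 \<phi>\<^sup>2 / (2 u)\<close> for small \<open>s\<close>. The usual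
  test function \<open>\<phi>\<^sup>2 / u\<close> would require products and a chain rule for the local part of the
  form. For \<open>W\<close> only one fact about the form is needed: the map
  \<open>(a, b) \<mapsto> sqrt (a\<^sup>2 + b\<^sup>2)\<close> is a contraction of the plane, so each part of the form
  satisfies \<open>q (sqrt (f\<^sup>2 + g\<^sup>2)) \<le> q f + q g\<close>. With \<open>sqrt (u\<^sup>2 + (s \<phi>)\<^sup>2) = u + W\<close> and
  \<open>q (u + W) = q u + 2 q (u, W) + q W\<close> this gives \<open>2 q (u, W) \<le> s\<^sup>2 q \<phi>\<close>, a Picone inequality in which
  \<open>q u\<close> has cancelled; it therefore makes sense for \<open>u\<close> that is only locally in the domain.

  For the jump part and the killing part the inequality holds pointwise (\<open>picone_diff\<close>,
  \<open>picone_mult\<close>). For the strongly local part (\<open>mu_sqrt_sum_le\<close>) the function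
  \<open>sqrt (f\<^sup>2 + g\<^sup>2)\<close> is written as the supremum of the functions \<open>\<alpha> f + \<beta> g\<close> with
  \<open>\<alpha>\<^sup>2 + \<beta>\<^sup>2 \<le> 1\<close>. The energy measure of each of them is at most \<open>\<mu> f f + \<mu> g g\<close>, and
  by locality the energy measure of a maximum of two continuous functions coincides, piece by
  piece, with that of one of the two (\<open>mu_max_le\<close>). Limits are taken with a lower
  semicontinuity principle for closed forms (\<open>quad_lower_semicontinuous\<close>), which rests on the
  observation that almost minimizers of \<open>E1\<close> in a decreasing sequence of convex sets form a
  Cauchy sequence (\<open>approx_in_convex_set\<close>).

  The integrals against \<open>J\<close>, \<open>k\<close>, \<open>\<nu>p\<close> and \<open>\<nu>m\<close> involve quasi-continuous versions. These exist
  for elements of the local domain (\<open>qc_version_exists_loc\<close>), and an inequality between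
  functions that holds almost everywhere for \<open>m\<close> passes to their quasi-continuous versions almost
  everywhere for every measure that charges no set of capacity zero (\<open>qc_version_le\<close>). The killing
  measure and both marginals of \<open>J\<close> are such measures. Dividing the tested equation by \<open>s\<^sup>2\<close> and
  letting \<open>s\<close> tend to zero replaces \<open>2 u W / s\<^sup>2\<close> by \<open>\<phi>\<^sup>2\<close> wherever \<open>u > 0\<close>
  (\<open>ground_state_limit\<close>). The hypothesis on \<open>1 / u\<close> enters here: its quasi-continuous version is
  finite, so \<open>u > 0\<close> holds off a set of capacity zero, hence almost everywhere for \<open>\<nu>m\<close>. Finally
  every \<open>\<phi>\<close> in the domain of \<open>h\<close> is a limit in \<open>E1\<close> of compactly supported functions that it
  dominates (\<open>compact_supp_approx\<close>).
\<close>

section \<open>Positive semidefinite bilinear forms on function spaces\<close>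

text \<open>
  The inner product of \<open>L\<^sup>2\<close>, the form, \<open>E1\<close>, the energy measures evaluated on a fixed set and the
  forms given by measures are all instances, so the Hilbert space algebra is done once.
\<close>

locale psd_form =
  fixes D :: "('a \<Rightarrow> real) set" and B :: "('a \<Rightarrow> real) \<Rightarrow> ('a \<Rightarrow> real) \<Rightarrow> real"
  assumes add_mem: "u \<in> D \<Longrightarrow> v \<in> D \<Longrightarrow> (\<lambda>x. u x + v x) \<in> D"
    and scale_mem: "u \<in> D \<Longrightarrow> (\<lambda>x. c * u x) \<in> D"
    and sym: "u \<in> D \<Longrightarrow> v \<in> D \<Longrightarrow> B u v = B v u"
    and add_left: "u \<in> D \<Longrightarrow> v \<in> D \<Longrightarrow> w \<in> D \<Longrightarrow> B (\<lambda>x. u x + v x) w = B u w + B v w"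
    and scale_left: "u \<in> D \<Longrightarrow> w \<in> D \<Longrightarrow> B (\<lambda>x. c * u x) w = c * B u w"
    and nonneg: "u \<in> D \<Longrightarrow> 0 \<le> B u u"
begin

lemma comb_mem: "u \<in> D \<Longrightarrow> v \<in> D \<Longrightarrow> (\<lambda>x. a * u x + b * v x) \<in> D"
  by (intro add_mem scale_mem)

lemma comb_left:
  "u \<in> D \<Longrightarrow> v \<in> D \<Longrightarrow> w \<in> D \<Longrightarrow> B (\<lambda>x. a * u x + b * v x) w = a * B u w + b * B v w"
  by (simp add: add_left scale_left scale_mem)

lemma quad_comb:
  assumes "u \<in> D" "v \<in> D"
  shows "B (\<lambda>x. a * u x + b * v x) (\<lambda>x. a * u x + b * v x) =
    a\<^sup>2 * B u u + 2 * a * b * B u v + b\<^sup>2 * B v v"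
proof -
  have c: "(\<lambda>x. a * u x + b * v x) \<in> D" using assms by (rule comb_mem)
  have "B u (\<lambda>x. a * u x + b * v x) = a * B u u + b * B u v"
    using comb_left[of u v u a b] assms c by (simp add: sym)
  moreover have "B v (\<lambda>x. a * u x + b * v x) = a * B u v + b * B v v"
    using comb_left[of u v v a b] assms c by (simp add: sym)
  ultimately show ?thesis
    using assms c by (simp add: comb_left power2_eq_square algebra_simps)
qed

lemma quad_scale: "u \<in> D \<Longrightarrow> B (\<lambda>x. a * u x) (\<lambda>x. a * u x) = a\<^sup>2 * B u u"
  using quad_comb[of u u a 0] by simp

lemma quad_add: "u \<in> D \<Longrightarrow> v \<in> D \<Longrightarrow>
    B (\<lambda>x. u x + v x) (\<lambda>x. u x + v x) = B u u + 2 * B u v + B v v"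
  using quad_comb[of u v 1 1] by simp

lemma diff_mem: "u \<in> D \<Longrightarrow> v \<in> D \<Longrightarrow> (\<lambda>x. u x - v x) \<in> D"
  using comb_mem[of u v 1 "-1"] by simp

lemma diff_left: "u \<in> D \<Longrightarrow> v \<in> D \<Longrightarrow> w \<in> D \<Longrightarrow> B (\<lambda>x. u x - v x) w = B u w - B v w"
  using comb_left[of u v w 1 "-1"] by simp

lemma quad_diff: "u \<in> D \<Longrightarrow> v \<in> D \<Longrightarrow>
    B (\<lambda>x. u x - v x) (\<lambda>x. u x - v x) = B u u - 2 * B u v + B v v"
  using quad_comb[of u v 1 "-1"] by simp

lemma quad_diff_commute: "u \<in> D \<Longrightarrow> v \<in> D \<Longrightarrow>
    B (\<lambda>x. u x - v x) (\<lambda>x. u x - v x) = B (\<lambda>x. v x - u x) (\<lambda>x. v x - u x)"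
  by (simp add: quad_diff sym)

lemma quad_add_le:
  assumes "u \<in> D" "v \<in> D"
  shows "B (\<lambda>x. u x + v x) (\<lambda>x. u x + v x) \<le> 2 * B u u + 2 * B v v"
  using nonneg[OF diff_mem[OF assms]] quad_add[OF assms] quad_diff[OF assms] by simp

lemma quad_diff_le:
  assumes "u \<in> D" "v \<in> D"
  shows "B (\<lambda>x. u x - v x) (\<lambda>x. u x - v x) \<le> 2 * B u u + 2 * B v v"
  using nonneg[OF add_mem[OF assms]] quad_add[OF assms] quad_diff[OF assms] by simp

lemma quad_midpoint_le:
  assumes "u \<in> D" "v \<in> D"
  shows "B (\<lambda>x. (u x + v x) / 2) (\<lambda>x. (u x + v x) / 2) \<le> (B u u + B v v) / 2"
  using nonneg[OF diff_mem[OF assms]] quad_diff[OF assms] quad_comb[OF assms, of "1/2" "1/2"]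
  by (simp add: field_simps power2_eq_square)

lemma parallelogram:
  assumes "u \<in> D" "v \<in> D"
  shows "B (\<lambda>x. u x - v x) (\<lambda>x. u x - v x) =
    2 * B u u + 2 * B v v - 4 * B (\<lambda>x. (u x + v x) / 2) (\<lambda>x. (u x + v x) / 2)"
  using quad_diff[OF assms] quad_comb[OF assms, of "1/2" "1/2"]
  by (simp add: field_simps power2_eq_square)

lemma midpoint_mem: "u \<in> D \<Longrightarrow> v \<in> D \<Longrightarrow> (\<lambda>x. (u x + v x) / 2) \<in> D"
  using comb_mem[of u v "1/2" "1/2"] by (simp add: field_simps)

lemma cauchy_schwarz:
  assumes u: "u \<in> D" and v: "v \<in> D"
  shows "\<bar>B u v\<bar> \<le> sqrt (B u u) * sqrt (B v v)"
proof -
  have pos: "0 \<le> a\<^sup>2 * B u u + 2 * a * b * B u v + b\<^sup>2 * B v v" for a b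
    using nonneg[OF comb_mem[OF u v, of a b]] quad_comb[OF u v] by simp
  have "(B u v)\<^sup>2 \<le> B u u * B v v"
  proof (cases "B v v = 0")
    case True
    have "B u v = 0"
    proof (rule ccontr)
      assume n: "B u v \<noteq> 0"
      have "0 \<le> 1\<^sup>2 * B u u + 2 * 1 * (- (B u u + 1) / (2 * B u v)) * B u v + 0"
        using pos[of 1 "- (B u u + 1) / (2 * B u v)"] True by simp
      also have "\<dots> = -1" using n by (simp add: field_simps)
      finally show False by simp
    qed
    then show ?thesis using True by simp
  next
    case False
    with nonneg[OF v] have p: "B v v > 0" by simp
    have "0 \<le> (B v v)\<^sup>2 * B u u + 2 * B v v * (- B u v) * B u v + (- B u v)\<^sup>2 * B v v"
      by (rule pos)
    also have "\<dots> = B v v * (B u u * B v v - (B u v)\<^sup>2)"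
      by (simp add: power2_eq_square algebra_simps)
    finally show ?thesis using p by (simp add: zero_le_mult_iff)
  qed
  then have "sqrt ((B u v)\<^sup>2) \<le> sqrt (B u u * B v v)" by (rule real_sqrt_le_mono)
  then show ?thesis by (simp add: real_sqrt_mult)
qed

lemma sqrt_triangle:
  assumes "u \<in> D" "v \<in> D"
  shows "sqrt (B (\<lambda>x. u x + v x) (\<lambda>x. u x + v x)) \<le> sqrt (B u u) + sqrt (B v v)"
proof (rule real_le_lsqrt)
  have "B (\<lambda>x. u x + v x) (\<lambda>x. u x + v x) \<le> B u u + 2 * (sqrt (B u u) * sqrt (B v v)) + B v v"
    using cauchy_schwarz[OF assms] quad_add[OF assms] by simp
  also have "\<dots> = (sqrt (B u u) + sqrt (B v v))\<^sup>2"
    using assms nonneg by (simp add: power2_sum)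
  finally show "B (\<lambda>x. u x + v x) (\<lambda>x. u x + v x) \<le> (sqrt (B u u) + sqrt (B v v))\<^sup>2" .
qed (use assms nonneg in simp)

text \<open>
  The square root of \<open>B u u\<close> is a seminorm, hence it is continuous for the convergence that it defines.
\<close>

lemma tendsto_quad:
  assumes u: "\<And>n. u n \<in> D" and v: "v \<in> D"
    and lim: "(\<lambda>n::nat. B (\<lambda>x. u n x - v x) (\<lambda>x. u n x - v x)) \<longlonglongrightarrow> 0"
  shows "(\<lambda>n. B (u n) (u n)) \<longlonglongrightarrow> B v v"
proof -
  let ?d = "\<lambda>n. B (\<lambda>x. u n x - v x) (\<lambda>x. u n x - v x)"
  have d0: "(\<lambda>n. sqrt (?d n)) \<longlonglongrightarrow> 0"
    using tendsto_real_sqrt[OF lim] by simp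
  have "\<bar>sqrt (B (u n) (u n)) - sqrt (B v v)\<bar> \<le> sqrt (?d n)" for n
  proof -
    have "sqrt (B (u n) (u n)) \<le> sqrt (?d n) + sqrt (B v v)"
      using sqrt_triangle[OF diff_mem[OF u[of n] v] v] by simp
    moreover have "sqrt (B v v) \<le> sqrt (?d n) + sqrt (B (u n) (u n))"
      using sqrt_triangle[OF diff_mem[OF v u[of n]] u[of n]] quad_diff_commute[OF u[of n] v] by simp
    ultimately show ?thesis by linarith
  qed
  then have "(\<lambda>n. sqrt (B (u n) (u n)) - sqrt (B v v)) \<longlonglongrightarrow> 0"
    by (intro Lim_null_comparison[OF _ d0]) (auto intro: always_eventually)
  then have "(\<lambda>n. sqrt (B (u n) (u n))) \<longlonglongrightarrow> sqrt (B v v)"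
    by (simp add: LIM_zero_iff)
  from tendsto_power[OF this, of 2] show ?thesis using u v nonneg by simp
qed

end

section \<open>Regular Dirichlet forms and lower semicontinuity\<close>

lemma L2_integrable_mult:
  assumes "u \<in> L2 M" "v \<in> L2 M"
  shows "integrable M (\<lambda>x. u x * v x)"
proof (rule Bochner_Integration.integrable_bound)
  show "integrable M (\<lambda>x. (u x)\<^sup>2 + (v x)\<^sup>2)" using assms by (auto simp: L2_def)
  show "(\<lambda>x. u x * v x) \<in> borel_measurable M" using assms by (auto simp: L2_def)
  have "\<bar>u x * v x\<bar> \<le> (u x)\<^sup>2 + (v x)\<^sup>2" for x
    using sum_squares_bound[of "u x" "v x"] sum_squares_bound[of "- u x" "v x"]
      sum_power2_ge_zero[of "u x" "v x"] by (simp add: abs_if)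
  then show "AE x in M. norm (u x * v x) \<le> norm ((u x)\<^sup>2 + (v x)\<^sup>2)" by simp
qed

lemma L2_dominated:
  assumes "g \<in> L2 M" "f \<in> borel_measurable M" "AE x in M. \<bar>f x\<bar> \<le> \<bar>g x\<bar>"
  shows "f \<in> L2 M"
proof -
  have "integrable M (\<lambda>x. (f x)\<^sup>2)"
    using assms by (intro Bochner_Integration.integrable_bound[of M "\<lambda>x. (g x)\<^sup>2" "\<lambda>x. (f x)\<^sup>2"])
      (auto simp: L2_def abs_le_square_iff)
  then show ?thesis using assms by (simp add: L2_def)
qed

lemma L2_psd_form: "psd_form (L2 M) (L2_inner M)"
proof
  fix u v w assume u: "u \<in> L2 M" and v: "v \<in> L2 M"
  have "integrable M (\<lambda>x. (u x)\<^sup>2 + 2 * (u x * v x) + (v x)\<^sup>2)"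
    using u v L2_integrable_mult[OF u v] by (auto simp: L2_def)
  then show "(\<lambda>x. u x + v x) \<in> L2 M"
    using u v by (auto simp: L2_def power2_sum algebra_simps)
  show "L2_inner M u v = L2_inner M v u" by (simp add: L2_inner_def mult.commute)
  show "w \<in> L2 M \<Longrightarrow> L2_inner M (\<lambda>x. u x + v x) w = L2_inner M u w + L2_inner M v w"
    using L2_integrable_mult[OF u, of w] L2_integrable_mult[OF v, of w]
    by (simp add: L2_inner_def distrib_right)
next
  fix u w and c :: real assume u: "u \<in> L2 M"
  then show "(\<lambda>x. c * u x) \<in> L2 M" by (auto simp: L2_def power_mult_distrib)
  show "w \<in> L2 M \<Longrightarrow> L2_inner M (\<lambda>x. c * u x) w = c * L2_inner M u w"
    by (simp add: L2_inner_def mult.assoc)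
  show "0 \<le> L2_inner M u u" by (simp add: L2_inner_def)
qed

lemma L2_inner_mono:
  assumes "g \<in> L2 M" "AE x in M. \<bar>f x\<bar> \<le> \<bar>g x\<bar>"
  shows "L2_inner M f f \<le> L2_inner M g g"
  unfolding L2_inner_def
  using assms(1,2) by (intro integral_mono_AE') (auto simp: L2_def power2_eq_square[symmetric] abs_le_square_iff)

lemma L2_inner_eq_0:
  assumes "f \<in> L2 M" "L2_inner M f f = 0"
  shows "AE x in M. f x = 0"
  using assms integral_nonneg_eq_0_iff_AE[of M "\<lambda>x. (f x)\<^sup>2"]
  by (auto simp: L2_def L2_inner_def power2_eq_square)

locale regular_dirichlet_space =
  fixes m :: "'a::{metric_space,second_countable_topology} measure" and D E
  assumes radon: "radon_measure m" and regular: "regular_dirichlet_form m D E"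
begin

lemma sets_m [measurable_cong, simp]: "sets m = sets borel"
  using radon by (simp add: radon_measure_def)

lemma form_symmetric: "symmetric_form m D E" and form_closed: "closed_form m D E"
  and contraction: "normal_contraction T \<Longrightarrow> u \<in> D \<Longrightarrow> T \<circ> u \<in> D"
    "normal_contraction T \<Longrightarrow> u \<in> D \<Longrightarrow> E (T \<circ> u) (T \<circ> u) \<le> E u u"
  using regular unfolding regular_dirichlet_form_def dirichlet_form_def by blast+

sublocale E: psd_form D E
  using form_symmetric unfolding symmetric_form_def by unfold_locales meson+

sublocale L: psd_form "L2 m" "L2_inner m" by (rule L2_psd_form)

lemma D_L2: "u \<in> D \<Longrightarrow> u \<in> L2 m"
  using form_symmetric unfolding symmetric_form_def by (elim conjE) (erule subsetD)

lemma zero_mem: "(\<lambda>x. 0) \<in> D"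
  using form_symmetric unfolding symmetric_form_def by (elim conjE)

lemma D_cong_AE: "u \<in> D \<Longrightarrow> v \<in> borel_measurable m \<Longrightarrow> AE x in m. u x = v x \<Longrightarrow> v \<in> D"
  using form_symmetric unfolding symmetric_form_def by meson

lemma E_cong_AE: "u \<in> D \<Longrightarrow> v \<in> D \<Longrightarrow> w \<in> D \<Longrightarrow> AE x in m. u x = v x \<Longrightarrow> E u w = E v w"
  using form_symmetric unfolding symmetric_form_def by meson

lemma D_measurable [measurable_dest]: "u \<in> D \<Longrightarrow> u \<in> borel_measurable m"
  using D_L2 by (auto simp: L2_def)

sublocale Q: psd_form D "E1 m E"
proof
  show "\<And>u v. u \<in> D \<Longrightarrow> v \<in> D \<Longrightarrow> E1 m E u v = E1 m E v u"
    by (simp add: E1_def E.sym L.sym D_L2)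
  show "\<And>u v w. u \<in> D \<Longrightarrow> v \<in> D \<Longrightarrow> w \<in> D \<Longrightarrow>
      E1 m E (\<lambda>x. u x + v x) w = E1 m E u w + E1 m E v w"
    by (simp add: E1_def E.add_left L.add_left D_L2)
  show "\<And>u w c. u \<in> D \<Longrightarrow> w \<in> D \<Longrightarrow> E1 m E (\<lambda>x. c * u x) w = c * E1 m E u w"
    by (simp add: E1_def E.scale_left L.scale_left D_L2 distrib_left)
  show "\<And>u. u \<in> D \<Longrightarrow> 0 \<le> E1 m E u u"
    by (simp add: E1_def E.nonneg L.nonneg D_L2)
qed (fact E.add_mem E.scale_mem)+

lemma closedD:
  assumes "\<And>n::nat. u n \<in> D"
    and "\<And>\<epsilon>. \<epsilon> > 0 \<Longrightarrow> \<exists>N. \<forall>i\<ge>N. \<forall>j\<ge>N. E1 m E (\<lambda>x. u i x - u j x) (\<lambda>x. u i x - u j x) < \<epsilon>"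
  shows "\<exists>v\<in>D. (\<lambda>n. E1 m E (\<lambda>x. u n x - v x) (\<lambda>x. u n x - v x)) \<longlonglongrightarrow> 0"
  by (rule form_closed[unfolded closed_form_def, rule_format]) (use assms in blast)+

lemma E_le_E1: "u \<in> D \<Longrightarrow> E u u \<le> E1 m E u u"
  and L_le_E1: "u \<in> D \<Longrightarrow> L2_inner m u u \<le> E1 m E u u"
  by (simp_all add: E1_def L.nonneg D_L2 E.nonneg)

lemma E_tendsto:
  assumes "\<And>n. u n \<in> D" "v \<in> D"
    and "(\<lambda>n::nat. E1 m E (\<lambda>x. u n x - v x) (\<lambda>x. u n x - v x)) \<longlonglongrightarrow> 0"
  shows "(\<lambda>n. E (\<lambda>x. u n x - v x) (\<lambda>x. u n x - v x)) \<longlonglongrightarrow> 0"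
    "(\<lambda>n. L2_inner m (\<lambda>x. u n x - v x) (\<lambda>x. u n x - v x)) \<longlonglongrightarrow> 0"
  using assms E.diff_mem by (auto intro!: tendsto_sandwich[OF _ _ tendsto_const assms(3)]
      always_eventually E_le_E1 L_le_E1 E.nonneg L.nonneg D_L2)

text \<open>
  A limit in \<open>E1\<close> is found by closedness and then has to be identified with a function that is
  known as a limit in \<open>L\<^sup>2\<close>.
\<close>

lemma L2_limit_unique:
  assumes "\<And>n. u n \<in> L2 m" "v \<in> L2 m" "w \<in> L2 m"
    and "(\<lambda>n::nat. L2_inner m (\<lambda>x. u n x - v x) (\<lambda>x. u n x - v x)) \<longlonglongrightarrow> 0"
    and "(\<lambda>n::nat. L2_inner m (\<lambda>x. u n x - w x) (\<lambda>x. u n x - w x)) \<longlonglongrightarrow> 0"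
  shows "AE x in m. v x = w x"
proof -
  have "L2_inner m (\<lambda>x. v x - w x) (\<lambda>x. v x - w x) \<le>
     2 * L2_inner m (\<lambda>x. u n x - w x) (\<lambda>x. u n x - w x) +
     2 * L2_inner m (\<lambda>x. u n x - v x) (\<lambda>x. u n x - v x)" for n
    using L.quad_diff_le[OF L.diff_mem[OF assms(1,3)] L.diff_mem[OF assms(1,2)], of n n] by simp
  moreover have "(\<lambda>n. 2 * L2_inner m (\<lambda>x. u n x - w x) (\<lambda>x. u n x - w x) +
     2 * L2_inner m (\<lambda>x. u n x - v x) (\<lambda>x. u n x - v x)) \<longlonglongrightarrow> 2 * 0 + 2 * 0"
    by (intro tendsto_intros assms)
  ultimately have "L2_inner m (\<lambda>x. v x - w x) (\<lambda>x. v x - w x) \<le> 0"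
    by (intro LIMSEQ_le_const) auto
  then have "L2_inner m (\<lambda>x. v x - w x) (\<lambda>x. v x - w x) = 0"
    using L.nonneg[OF L.diff_mem[OF assms(2,3)]] by simp
  from L2_inner_eq_0[OF L.diff_mem[OF assms(2,3)] this] show ?thesis by simp
qed

text \<open>
  This replaces the passage from weak to strong limits by convex combinations (Mazur). The sets
  \<open>Kn n\<close> of elements of \<open>K\<close> that are close to \<open>c\<close> in \<open>L\<^sup>2\<close> are convex and decrease. The infimum
  \<open>d n\<close> of \<open>E1\<close> over \<open>Kn n\<close> increases to a finite limit, and the midpoint of two almost
  minimizers again lies in \<open>Kn n\<close>, so by the parallelogram identity their distance is controlled
  by \<open>l - d n\<close>. Almost minimizers thus form a Cauchy sequence, and their limit can only be \<open>c\<close>.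
\<close>

lemma approx_in_convex_set:
  assumes K: "K \<subseteq> D" and mid: "\<And>a b. a \<in> K \<Longrightarrow> b \<in> K \<Longrightarrow> (\<lambda>x. (a x + b x) / 2) \<in> K"
    and c: "c \<in> L2 m"
    and ex: "\<And>r. r > 0 \<Longrightarrow> \<exists>w\<in>K. L2_inner m (\<lambda>x. w x - c x) (\<lambda>x. w x - c x) \<le> r \<and> E w w \<le> C"
  shows "c \<in> D \<and> (\<exists>w. (\<forall>n::nat. w n \<in> K) \<and>
     (\<lambda>n. E1 m E (\<lambda>x. w n x - c x) (\<lambda>x. w n x - c x)) \<longlonglongrightarrow> 0)"
proof -
  let ?L = "\<lambda>u v. L2_inner m (\<lambda>x. u x - v x) (\<lambda>x. u x - v x)"
  let ?Q = "\<lambda>u v. E1 m E (\<lambda>x. u x - v x) (\<lambda>x. u x - v x)"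
  let ?r = "\<lambda>n. inverse (real (Suc n))"
  define Kn where "Kn = (\<lambda>n::nat. {w\<in>K. ?L w c \<le> ?r n})"
  define d where "d = (\<lambda>n. INF w\<in>Kn n. E1 m E w w)"
  have ne: "\<exists>w\<in>Kn n. E1 m E w w \<le> C + (2 * 1 + 2 * L2_inner m c c)" for n
  proof -
    obtain w where w: "w \<in> K" "?L w c \<le> ?r n" "E w w \<le> C"
      using ex[of "?r n"] by auto
    have wL: "w \<in> L2 m" using w K D_L2 by blast
    have "L2_inner m w w \<le> 2 * ?L w c + 2 * L2_inner m c c"
      using L.quad_add_le[OF L.diff_mem[OF wL c] c] by simp
    moreover have "?r n \<le> 1" by (simp add: field_simps)
    ultimately have "L2_inner m w w \<le> 2 * 1 + 2 * L2_inner m c c" using w(2) by linarith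
    then show ?thesis using w by (intro bexI[of _ w]) (auto simp: Kn_def E1_def)
  qed
  have KD: "w \<in> Kn n \<Longrightarrow> w \<in> D" for w n using K by (auto simp: Kn_def)
  have bdd: "bdd_below ((\<lambda>w. E1 m E w w) ` Kn n)" for n
    using KD Q.nonneg by (intro bdd_belowI[of _ 0]) auto
  have dle: "w \<in> Kn n \<Longrightarrow> d n \<le> E1 m E w w" for w n
    unfolding d_def by (rule cINF_lower[OF bdd])
  have mono: "n \<le> n' \<Longrightarrow> Kn n' \<subseteq> Kn n" for n n'
    by (auto simp: Kn_def intro: order_trans[OF _ le_imp_inverse_le])
  have inc: "incseq d"
    unfolding incseq_def d_def
  proof (intro allI impI cINF_superset_mono)
    fix n n' :: nat assume "n \<le> n'"
    then show "Kn n' \<subseteq> Kn n" by (rule mono)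
    show "Kn n' \<noteq> {}" using ne[of n'] by auto
    show "bdd_below ((\<lambda>w. E1 m E w w) ` Kn n)" by (rule bdd)
  qed auto
  have dub: "d n \<le> C + (2 * 1 + 2 * L2_inner m c c)" for n
    using ne[of n] dle[of _ n] by (meson order_trans)
  obtain l where l: "d \<longlonglongrightarrow> l" using incseq_convergent[OF inc] dub by blast
  have dl: "d n \<le> l" for n using incseq_le[OF inc l] .
  have "\<exists>w\<in>Kn n. E1 m E w w < d n + ?r n" for n
  proof -
    have "Kn n \<noteq> {}" using ne[of n] by auto
    then show ?thesis
      using cINF_less_iff[OF _ bdd, of n "d n + ?r n"] by (auto simp: d_def)
  qed
  then obtain w where w: "\<And>n. w n \<in> Kn n" "\<And>n. E1 m E (w n) (w n) < d n + ?r n" by metis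
  have wK: "w n \<in> K" for n using w(1)[of n] by (auto simp: Kn_def)
  have wD: "w n \<in> D" for n using w(1) KD by blast
  have midn: "(\<lambda>x. (a x + b x) / 2) \<in> Kn n" if "a \<in> Kn n" "b \<in> Kn n" for a b n
  proof -
    have aL: "a \<in> L2 m" "b \<in> L2 m" using that KD D_L2 by blast+
    have "?L (\<lambda>x. (a x + b x) / 2) c \<le> (?L a c + ?L b c) / 2"
      using L.quad_midpoint_le[OF L.diff_mem[OF aL(1) c] L.diff_mem[OF aL(2) c]]
      by (simp add: field_simps)
    then show ?thesis using that mid by (auto simp: Kn_def)
  qed
  have est: "?Q (w i) (w j) \<le> 4 * (l - d n) + 4 * ?r n" if "n \<le> i" "n \<le> j" for n i j
  proof -
    have "w i \<in> Kn n" "w j \<in> Kn n" using w(1) mono that by blast+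
    then have "d n \<le> E1 m E (\<lambda>x. (w i x + w j x) / 2) (\<lambda>x. (w i x + w j x) / 2)"
      by (intro dle midn)
    moreover have "?Q (w i) (w j) = 2 * E1 m E (w i) (w i) + 2 * E1 m E (w j) (w j)
       - 4 * E1 m E (\<lambda>x. (w i x + w j x) / 2) (\<lambda>x. (w i x + w j x) / 2)"
      by (rule Q.parallelogram[OF wD wD])
    moreover have bound: "E1 m E (w i) (w i) \<le> l + ?r n" if "n \<le> i" for i
    proof -
      have "?r i \<le> ?r n" using that by (simp add: field_simps)
      then show ?thesis using w(2)[of i] dl[of i] by linarith
    qed
    ultimately show ?thesis using bound[OF that(1)] bound[OF that(2)]
      by (simp only: algebra_simps)
  qed
  have e0: "(\<lambda>n. 4 * (l - d n) + 4 * ?r n) \<longlonglongrightarrow> 4 * (l - l) + 4 * 0"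
    by (intro tendsto_intros l LIMSEQ_inverse_real_of_nat)
  have "\<exists>N. \<forall>i\<ge>N. \<forall>j\<ge>N. ?Q (w i) (w j) < \<epsilon>" if eps: "\<epsilon> > 0" for \<epsilon>
  proof -
    obtain N where "4 * (l - d N) + 4 * ?r N < \<epsilon>"
      using order_tendstoD(2)[OF e0, of \<epsilon>] eps by (auto simp: eventually_sequentially)
    then have "?Q (w i) (w j) < \<epsilon>" if "N \<le> i" "N \<le> j" for i j
      using est[OF that] by linarith
    then show ?thesis by blast
  qed
  then obtain v where v: "v \<in> D" "(\<lambda>n. ?Q (w n) v) \<longlonglongrightarrow> 0"
    using closedD[of w, OF wD] by blast
  have "(\<lambda>n. ?L (w n) c) \<longlonglongrightarrow> 0"
  proof (rule tendsto_sandwich[OF _ _ tendsto_const LIMSEQ_inverse_real_of_nat])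
    show "\<forall>\<^sub>F n in sequentially. 0 \<le> ?L (w n) c"
      using L.nonneg L.diff_mem[OF D_L2[OF wD] c] by (intro always_eventually) blast
    show "\<forall>\<^sub>F n in sequentially. ?L (w n) c \<le> ?r n"
      using w(1) by (intro always_eventually) (auto simp: Kn_def)
  qed
  then have ae: "AE x in m. v x = c x"
    using L2_limit_unique[of w, OF D_L2[OF wD] D_L2[OF v(1)] c] E_tendsto(2)[of w, OF wD v] by blast
  have "c \<in> borel_measurable m" using c by (simp add: L2_def)
  from D_cong_AE[OF v(1) this ae] have cD: "c \<in> D" .
  have "?Q (w n) c = ?Q (w n) v" for n
  proof -
    have wv: "(\<lambda>x. w n x - v x) \<in> D" "(\<lambda>x. w n x - c x) \<in> D" using wD v cD by (auto intro: E.diff_mem)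
    have ae': "AE x in m. w n x - v x = w n x - c x" using ae by auto
    have "E (\<lambda>x. w n x - v x) (\<lambda>x. w n x - v x) = E (\<lambda>x. w n x - c x) (\<lambda>x. w n x - c x)"
      using E_cong_AE[OF wv wv(1) ae'] E_cong_AE[OF wv wv(2) ae'] E.sym[OF wv] by simp
    moreover have "?L (w n) v = ?L (w n) c"
      unfolding L2_inner_def
    proof (rule integral_cong_AE)
      show "AE x in m. (w n x - v x) * (w n x - v x) = (w n x - c x) * (w n x - c x)"
        using ae by eventually_elim simp
    qed (use D_measurable[OF wv(1)] D_measurable[OF wv(2)] in simp_all)
    ultimately show ?thesis by (simp add: E1_def)
  qed
  then have "(\<lambda>n. ?Q (w n) c) \<longlonglongrightarrow> 0" using v(2) by simp
  then show ?thesis using cD wK by blast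
qed

text \<open>
  The sublevel set of a quadratic form \<open>B\<close> is convex. If \<open>B\<close> is continuous for \<open>E1\<close>, then \<open>c\<close>,
  being a strong limit of elements of the sublevel set, satisfies the same bound. The case
  \<open>B = E\<close> is the lower semicontinuity of the form itself. The case of \<open>\<mu>\<close> evaluated on one
  Borel set is the one that lets energy measures pass to limits that are merely bounded in energy.
\<close>

lemma quad_lower_semicontinuous:
  assumes B: "psd_form D B" and BQ: "\<And>u. u \<in> D \<Longrightarrow> B u u \<le> C' * E1 m E u u"
    and c: "c \<in> L2 m"
    and f: "\<And>n::nat. f n \<in> D" "\<And>n. E (f n) (f n) \<le> C" "\<And>n. B (f n) (f n) \<le> s"
    and lim: "(\<lambda>n. L2_inner m (\<lambda>x. f n x - c x) (\<lambda>x. f n x - c x)) \<longlonglongrightarrow> 0"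
  shows "c \<in> D" "B c c \<le> s"
proof -
  interpret B: psd_form D B by (rule B)
  define K where "K = {w\<in>D. B w w \<le> s}"
  have "c \<in> D \<and> (\<exists>w. (\<forall>n::nat. w n \<in> K) \<and>
     (\<lambda>n. E1 m E (\<lambda>x. w n x - c x) (\<lambda>x. w n x - c x)) \<longlonglongrightarrow> 0)"
  proof (rule approx_in_convex_set[OF _ _ c])
    show "K \<subseteq> D" by (auto simp: K_def)
    show "(\<lambda>x. (a x + b x) / 2) \<in> K" if "a \<in> K" "b \<in> K" for a b
      using that B.quad_midpoint_le[of a b] E.midpoint_mem[of a b] by (auto simp: K_def)
    fix r :: real assume "r > 0"
    from order_tendstoD(2)[OF lim this] obtain n
      where "L2_inner m (\<lambda>x. f n x - c x) (\<lambda>x. f n x - c x) < r"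
      by (auto simp: eventually_sequentially)
    then show "\<exists>w\<in>K. L2_inner m (\<lambda>x. w x - c x) (\<lambda>x. w x - c x) \<le> r \<and> E w w \<le> C"
      using f by (intro bexI[of _ "f n"]) (auto simp: K_def)
  qed
  then obtain w where cD: "c \<in> D" and w: "\<And>n::nat. w n \<in> K"
    and l: "(\<lambda>n. E1 m E (\<lambda>x. w n x - c x) (\<lambda>x. w n x - c x)) \<longlonglongrightarrow> 0" by blast
  show "c \<in> D" by fact
  have wD: "w n \<in> D" for n using w by (auto simp: K_def)
  have "(\<lambda>n. B (\<lambda>x. w n x - c x) (\<lambda>x. w n x - c x)) \<longlonglongrightarrow> 0"
  proof (rule tendsto_sandwich[OF _ _ tendsto_const])
    show "(\<lambda>n. C' * E1 m E (\<lambda>x. w n x - c x) (\<lambda>x. w n x - c x)) \<longlonglongrightarrow> 0"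
      using tendsto_mult_left[OF l, of C'] by simp
  qed (auto intro!: always_eventually B.nonneg BQ E.diff_mem wD cD)
  from B.tendsto_quad[of w, OF wD cD this] show "B c c \<le> s"
    using w by (intro LIMSEQ_le_const2) (auto simp: K_def)
qed

end

section \<open>Capacity and quasi-continuous functions\<close>

lemma open_cover_compact_closure:
  assumes "locally compact (UNIV :: 'a::{metric_space,second_countable_topology} set)"
  shows "\<exists>B :: nat \<Rightarrow> 'a set. (\<forall>n. open (B n) \<and> compact (closure (B n))) \<and> (\<Union>n. B n) = UNIV"
proof -
  let ?F = "{U :: 'a set. open U \<and> compact (closure U)}"
  have ex: "\<exists>U\<in>?F. x \<in> U" for x
  proof -
    obtain U V where "open U" "compact V" "x \<in> U" "U \<subseteq> V"
      using locallyE[OF assms, of UNIV x] by auto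
    moreover from this have "compact (closure U)"
      by (metis closure_minimal compact_imp_closed closed_closure compact_Int_closed inf.absorb_iff2)
    ultimately show ?thesis by blast
  qed
  obtain F where F: "F \<subseteq> ?F" "countable F" "\<Union>F = \<Union>?F"
    using Lindelof[of ?F] by blast
  have un: "\<Union>F = UNIV" using F(3) ex by auto
  then have "F \<noteq> {}" by auto
  then show ?thesis
    using F un range_from_nat_into[of F] F(2) from_nat_into[of F]
    by (intro exI[of _ "from_nat_into F"]) auto
qed

lemma compact_subset_open_compact_closure:
  assumes "locally compact (UNIV :: 'a::{metric_space,second_countable_topology} set)"
    and "compact (S :: 'a set)"
  shows "\<exists>G. open G \<and> compact (closure G) \<and> S \<subseteq> G"
proof -
  obtain B :: "nat \<Rightarrow> 'a set" where B: "\<And>n. open (B n)" "\<And>n. compact (closure (B n))" "(\<Union>n. B n) = UNIV"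
    using open_cover_compact_closure[OF assms(1)] by blast
  have "S \<subseteq> (\<Union>n\<in>UNIV. B n)" using B by auto
  then obtain I where I: "finite I" "S \<subseteq> (\<Union>n\<in>I. B n)"
    using compactE_image[OF assms(2), of UNIV B] B(1) by auto
  have "compact (closure (\<Union>n\<in>I. B n))"
    using I(1) by (induction rule: finite_induct) (auto simp: B(2) compact_Un)
  then show ?thesis using I B(1) by blast
qed

lemma ennreal_zero_if_small:
  assumes "\<And>e. e > 0 \<Longrightarrow> x \<le> ennreal e"
  shows "x = 0"
  by (rule ccontr) (metis assms dense ennreal_less_zero_iff leD not_gr_zero ennreal_enn2real
      enn2real_positive_iff ennreal_less_top less_top order.strict_trans order_less_trans top.not_eq_extremum)

context regular_dirichlet_space
begin

lemma abs_mem: "u \<in> D \<Longrightarrow> (\<lambda>x. \<bar>u x\<bar>) \<in> D"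
  and E_abs: "u \<in> D \<Longrightarrow> E (\<lambda>x. \<bar>u x\<bar>) (\<lambda>x. \<bar>u x\<bar>) \<le> E u u"
  using contraction[of abs u] abs_triangle_ineq3 by (auto simp: normal_contraction_def comp_def)

lemma trunc_mem: "0 \<le> a \<Longrightarrow> u \<in> D \<Longrightarrow> (\<lambda>x. max 0 (u x - a)) \<in> D"
  and E_trunc: "0 \<le> a \<Longrightarrow> u \<in> D \<Longrightarrow> E (\<lambda>x. max 0 (u x - a)) (\<lambda>x. max 0 (u x - a)) \<le> E u u"
  using contraction[of "\<lambda>t. max 0 (t - a)" u] by (auto simp: normal_contraction_def comp_def max_def)

lemma pos_part_mem: "u \<in> D \<Longrightarrow> (\<lambda>x. max 0 (u x)) \<in> D"
  and E_pos_part: "u \<in> D \<Longrightarrow> E (\<lambda>x. max 0 (u x)) (\<lambda>x. max 0 (u x)) \<le> E u u"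
  using trunc_mem[of 0 u] E_trunc[of 0 u] by auto

lemma E1_abs: "u \<in> D \<Longrightarrow> E1 m E (\<lambda>x. \<bar>u x\<bar>) (\<lambda>x. \<bar>u x\<bar>) \<le> E1 m E u u"
  using E_abs[of u] by (simp add: E1_def L2_inner_def)

lemma cap_open_le: "v \<in> D \<Longrightarrow> AE x in m. indicator U x \<le> v x \<Longrightarrow> cap_open m D E U \<le> ennreal (E1 m E v v)"
  unfolding cap_open_def by (intro INF_lower) auto

lemma cap_open_lessD:
  assumes "cap_open m D E U < ennreal e"
  shows "\<exists>v\<in>D. (AE x in m. indicator U x \<le> v x) \<and> E1 m E v v < e"
  using assms unfolding cap_open_def INF_less_iff by (auto simp: ennreal_less_iff Q.nonneg)

lemma cap_open_mono:
  assumes "AE x in m. x \<in> U \<longrightarrow> x \<in> V"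
  shows "cap_open m D E U \<le> cap_open m D E V"
  unfolding cap_open_def
proof (rule INF_superset_mono)
  show "{v \<in> D. AE x in m. indicator V x \<le> v x} \<subseteq> {v \<in> D. AE x in m. indicator U x \<le> v x}"
    using assms by (auto simp: indicator_def elim!: AE_mp split: if_splits)
qed auto

lemma cap_le_cap_open: "open U \<Longrightarrow> A \<subseteq> U \<Longrightarrow> cap m D E A \<le> cap_open m D E U"
  unfolding cap_def by (intro INF_lower) auto

lemma cap_eq_cap_open:
  assumes "open U"
  shows "cap m D E U = cap_open m D E U"
proof (rule antisym)
  show "cap_open m D E U \<le> cap m D E U"
    unfolding cap_def by (intro INF_greatest cap_open_mono) auto
qed (simp add: cap_le_cap_open assms)

lemma emeasure_le_cap_open:
  assumes "open U"
  shows "emeasure m U \<le> cap_open m D E U"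
  unfolding cap_open_def
proof (rule INF_greatest)
  fix v assume "v \<in> {v \<in> D. AE x in m. indicator U x \<le> v x}"
  then have v: "v \<in> D" "AE x in m. indicator U x \<le> v x" by auto
  have "emeasure m U = (\<integral>\<^sup>+x. indicator U x \<partial>m)" using assms by simp
  also have "\<dots> \<le> (\<integral>\<^sup>+x. ennreal (v x * v x) \<partial>m)"
  proof (rule nn_integral_mono_AE)
    show "AE x in m. indicator U x \<le> ennreal (v x * v x)"
      using v(2)
    proof eventually_elim
      fix x assume "indicator U x \<le> v x"
      then have "1 \<le> v x * v x" if "x \<in> U" using that mult_mono[of 1 "v x" 1 "v x"] by simp
      then show "indicator U x \<le> ennreal (v x * v x)" by (auto simp: indicator_def simp flip: ennreal_1)
    qed
  qed
  also have "\<dots> = ennreal (L2_inner m v v)"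
    using L2_integrable_mult[OF D_L2 D_L2, OF v(1) v(1)] unfolding L2_inner_def
    by (intro nn_integral_eq_integral) auto
  also have "\<dots> \<le> ennreal (E1 m E v v)" using L_le_E1[OF v(1)] by (rule ennreal_leI)
  finally show "emeasure m U \<le> ennreal (E1 m E v v)" .
qed

text \<open>
  If the capacities decay like powers of \<open>1/4\<close>, then the \<open>E1\<close>-norms of the potentials decay like
  powers of \<open>1/2\<close>. So the sum of the potentials converges in \<open>E1\<close>, by the triangle inequality its
  norm is at most \<open>sqrt e\<close>, and it dominates the indicator of the union.
\<close>

lemma cap_open_Union_less:
  fixes U :: "nat \<Rightarrow> 'a set"
  assumes e: "e > 0" and U: "\<And>n. cap_open m D E (U n) < ennreal (e * (1/4) ^ Suc n)"
  shows "cap_open m D E (\<Union>n. U n) \<le> ennreal e"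
proof -
  let ?q = "\<lambda>u. sqrt (E1 m E u u)"
  have "\<forall>n. \<exists>v\<in>D. (AE x in m. indicator (U n) x \<le> v x) \<and> E1 m E v v < e * (1/4) ^ Suc n"
    using cap_open_lessD[OF U] by blast
  then obtain v' where v': "\<And>n. v' n \<in> D" "\<And>n. AE x in m. indicator (U n) x \<le> v' n x"
    "\<And>n. E1 m E (v' n) (v' n) < e * (1/4) ^ Suc n" by metis
  define v where "v = (\<lambda>n x. \<bar>v' n x\<bar>)"
  have v: "v n \<in> D" "v n x \<ge> 0" for n x by (auto simp: v_def abs_mem v')
  have vq: "?q (v n) \<le> sqrt e * (1/2) ^ Suc n" for n
  proof -
    have "E1 m E (v n) (v n) \<le> e * (1/4) ^ Suc n"
      using E1_abs[OF v'(1)[of n]] v'(3)[of n] by (simp add: v_def)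
    also have "\<dots> = (sqrt e * (1/2) ^ Suc n)\<^sup>2"
    proof -
      have "(1/4 :: real) ^ Suc n = ((1/2) ^ Suc n)\<^sup>2"
        by (simp only: power2_eq_square flip: power_mult_distrib) simp
      then show ?thesis using e by (simp only: power_mult_distrib real_sqrt_pow2 less_imp_le)
    qed
    finally show ?thesis using e by (intro real_le_lsqrt) auto
  qed
  define s where "s = (\<lambda>N x. \<Sum>n<N. v n x)"
  have s0: "s 0 = (\<lambda>x. 0)" and sS: "s (Suc N) = (\<lambda>x. s N x + v N x)" for N by (auto simp: s_def)
  have sD: "s N \<in> D" for N by (induction N) (auto simp: s0 sS zero_mem E.add_mem v)
  have E1z: "E1 m E (\<lambda>x. 0) (\<lambda>x. 0) = 0" using Q.quad_scale[OF zero_mem, of 0] by simp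
  have inc: "?q (\<lambda>x. s (M + k) x - s M x) \<le> sqrt e * ((1/2) ^ M - (1/2) ^ (M + k))" for M k
  proof (induction k)
    case 0 then show ?case by (simp add: E1z)
  next
    case (Suc k)
    have "?q (\<lambda>x. (s (M + k) x - s M x) + v (M + k) x) \<le> ?q (\<lambda>x. s (M + k) x - s M x) + ?q (v (M + k))"
      by (intro Q.sqrt_triangle E.diff_mem sD v)
    moreover have "(\<lambda>x. (s (M + k) x - s M x) + v (M + k) x) = (\<lambda>x. s (M + Suc k) x - s M x)"
      by (simp add: sS fun_eq_iff)
    moreover have "sqrt e * ((1/2) ^ M - (1/2) ^ (M + k)) + sqrt e * (1/2) ^ Suc (M + k) =
        sqrt e * ((1/2) ^ M - (1/2) ^ (M + Suc k))" by (simp add: algebra_simps)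
    ultimately show ?case using Suc vq[of "M + k"] by simp
  qed
  have inc2: "?q (\<lambda>x. s N x - s M x) \<le> sqrt e * (1/2) ^ M" if "M \<le> N" for M N
  proof -
    have "?q (\<lambda>x. s N x - s M x) \<le> sqrt e * ((1/2) ^ M - (1/2) ^ N)" using inc[of M "N - M"] that by simp
    also have "\<dots> \<le> sqrt e * (1/2) ^ M" using e by (intro mult_left_mono) auto
    finally show ?thesis .
  qed
  have "\<exists>N. \<forall>i\<ge>N. \<forall>j\<ge>N. E1 m E (\<lambda>x. s i x - s j x) (\<lambda>x. s i x - s j x) < d" if d: "d > 0" for d
  proof -
    have "(\<lambda>n. sqrt e * (1/2) ^ n) \<longlonglongrightarrow> sqrt e * 0"
      by (intro tendsto_intros LIMSEQ_realpow_zero) auto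
    then obtain N where N: "\<And>n. n \<ge> N \<Longrightarrow> sqrt e * (1/2) ^ n < sqrt d"
      using d order_tendstoD(2)[of _ "sqrt e * 0" sequentially "sqrt d"] by (auto simp: eventually_sequentially)
    have "E1 m E (\<lambda>x. s i x - s j x) (\<lambda>x. s i x - s j x) < d" if "i \<ge> N" "j \<ge> N" for i j
    proof (cases "j \<le> i")
      case True
      then have "?q (\<lambda>x. s i x - s j x) < sqrt d" using inc2[OF True] N[OF that(2)] by linarith
      then show ?thesis by simp
    next
      case False
      then have "?q (\<lambda>x. s j x - s i x) < sqrt d" using inc2[of i j] N[OF that(1)] by linarith
      then show ?thesis by (simp add: Q.quad_diff_commute[OF sD sD, of i j])
    qed
    then show ?thesis by blast
  qed
  then obtain w where w: "w \<in> D" "(\<lambda>n. E1 m E (\<lambda>x. s n x - w x) (\<lambda>x. s n x - w x)) \<longlonglongrightarrow> 0"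
    using closedD[of s, OF sD] by blast
  have "E1 m E (s N) (s N) \<le> e" for N
    using inc2[of 0 N] by (simp add: s0 real_sqrt_le_iff)
  then have we: "E1 m E w w \<le> e"
    using Q.tendsto_quad[OF sD w] by (intro LIMSEQ_le_const2) auto
  have "AE x in m. v n x \<le> w x" for n
  proof -
    let ?p = "\<lambda>x. max 0 (v n x - w x)"
    have p: "?p \<in> D" using E.diff_mem[OF v(1) w(1)] pos_part_mem by blast
    have le: "L2_inner m ?p ?p \<le> L2_inner m (\<lambda>x. s N x - w x) (\<lambda>x. s N x - w x)" if "N > n" for N
    proof (rule L2_inner_mono)
      show "(\<lambda>x. s N x - w x) \<in> L2 m" by (intro D_L2 E.diff_mem sD w)
      have "v n x \<le> s N x" for x
        unfolding s_def using v(2) that by (intro member_le_sum) auto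
      then show "AE x in m. \<bar>?p x\<bar> \<le> \<bar>s N x - w x\<bar>" by (intro AE_I2) (smt (verit))
    qed
    have "L2_inner m ?p ?p \<le> 0"
      by (rule LIMSEQ_le_const[OF E_tendsto(2)[OF sD w]]) (use le in \<open>auto intro!: exI[of _ "Suc n"]\<close>)
    then have "L2_inner m ?p ?p = 0" using L.nonneg[OF D_L2[OF p]] by simp
    from L2_inner_eq_0[OF D_L2[OF p] this] show ?thesis by eventually_elim (auto simp: max_def split: if_splits)
  qed
  then have "AE x in m. \<forall>n. v n x \<le> w x \<and> indicator (U n) x \<le> v' n x"
    using v'(2) by (simp add: AE_all_countable)
  then have "AE x in m. indicator (\<Union>n. U n) x \<le> w x"
  proof eventually_elim
    case (elim x)
    have "0 \<le> w x" using elim[rule_format, of 0] v(2)[of 0 x] by linarith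
    moreover have "1 \<le> w x" if "x \<in> U n" for n
      using elim[rule_format, of n] that by (auto simp: v_def)
    ultimately show ?case by (auto simp: indicator_def)
  qed
  from cap_open_le[OF w(1) this] show ?thesis using we by (meson ennreal_leI order_trans)
qed

lemma quasi_continuousD:
  assumes "quasi_continuous m D E f" "e > 0"
  shows "\<exists>U. open U \<and> cap_open m D E U < ennreal e \<and> continuous_on (- U) f"
  using assms unfolding quasi_continuous_def by (metis cap_eq_cap_open)

lemma quasi_continuous_family:
  fixes f :: "nat \<Rightarrow> 'a \<Rightarrow> real"
  assumes "\<And>n. quasi_continuous m D E (f n)" "e > 0"
  shows "\<exists>U. open U \<and> cap_open m D E U < ennreal e \<and> (\<forall>n. continuous_on (- U) (f n))"
proof -
  have "\<forall>n. \<exists>U. open U \<and> cap_open m D E U < ennreal (e / 2 * (1/4) ^ Suc n) \<and> continuous_on (- U) (f n)"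
    using assms by (intro allI quasi_continuousD) auto
  then obtain U where U: "\<And>n. open (U n)" "\<And>n. cap_open m D E (U n) < ennreal (e / 2 * (1/4) ^ Suc n)"
    "\<And>n. continuous_on (- U n) (f n)" by metis
  have "cap_open m D E (\<Union>n. U n) \<le> ennreal (e / 2)"
    using assms(2) U(2) by (intro cap_open_Union_less) auto
  also have "\<dots> < ennreal e" using assms(2) by (simp add: ennreal_less_iff)
  finally show ?thesis using U
    by (intro exI[of _ "\<Union>n. U n"]) (auto intro: continuous_on_subset)
qed

lemma quasi_continuous_compose:
  fixes H :: "real \<times> real \<Rightarrow> real"
  assumes "quasi_continuous m D E f" "quasi_continuous m D E g" "continuous_on UNIV H"
  shows "quasi_continuous m D E (\<lambda>x. H (f x, g x))"
  unfolding quasi_continuous_def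
proof (intro allI impI)
  fix e :: real assume "e > 0"
  then obtain U where U: "open U" "cap_open m D E U < ennreal e"
    "\<And>n::nat. continuous_on (- U) (if n = 0 then f else g)"
    using quasi_continuous_family[of "\<lambda>n. if n = 0 then f else g" e] assms(1,2) by force
  have "continuous_on (- U) (\<lambda>x. H (f x, g x))"
    using U(3)[of 0] U(3)[of 1]
    by (intro continuous_on_compose2[OF assms(3)] continuous_on_Pair) auto
  then show "\<exists>U. open U \<and> cap m D E U < ennreal e \<and> continuous_on (- U) (\<lambda>x. H (f x, g x))"
    using U(1,2) by (auto simp: cap_eq_cap_open)
qed

text \<open>
  Off an open set \<open>U\<close> of small capacity \<open>f\<close> is continuous, so adding the points of \<open>G\<close> with
  \<open>f < 0\<close> to \<open>U\<close> keeps it open. As \<open>m\<close> does not see the added points and the capacity of an open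
  set only depends on its class modulo \<open>m\<close>, the capacity of the enlarged set is still small.
\<close>

lemma quasi_continuous_cap_neg:
  assumes f: "quasi_continuous m D E f" and G: "open G" and ae: "AE x in m. x \<in> G \<longrightarrow> 0 \<le> f x"
  shows "cap m D E {x\<in>G. f x < 0} = 0"
proof (rule ennreal_zero_if_small)
  fix e :: real assume "e > 0"
  then obtain U where U: "open U" "cap_open m D E U < ennreal e" "continuous_on (- U) f"
    using quasi_continuousD[OF f] by blast
  obtain W where W: "open W" "W \<inter> - U = f -` {..<0} \<inter> - U"
    using U(3) unfolding continuous_on_open_invariant by (metis open_lessThan)
  have "cap m D E {x\<in>G. f x < 0} \<le> cap_open m D E (U \<union> (W \<inter> G))"
    using U W G by (intro cap_le_cap_open) auto
  also have "\<dots> \<le> cap_open m D E U"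
  proof (rule cap_open_mono)
    show "AE x in m. x \<in> U \<union> (W \<inter> G) \<longrightarrow> x \<in> U"
    using ae
    proof eventually_elim
      case (elim x)
      have "x \<in> U" if "x \<in> W" "0 \<le> f x"
      proof (rule ccontr)
        assume "x \<notin> U"
        then have "x \<in> f -` {..<0}" using W(2) that(1) by blast
        then show False using that(2) by simp
      qed
      with elim show ?case by blast
    qed
  qed
  finally show "cap m D E {x\<in>G. f x < 0} \<le> ennreal e" using U(2) by auto
qed

lemma AE_if_M0:
  assumes "\<nu> \<in> M0 m D E" "quasi_continuous m D E f" "f \<in> borel_measurable borel" "AE x in m. 0 \<le> f x"
  shows "AE x in \<nu>. 0 \<le> f x"
proof (rule AE_I')
  have s: "{x. f x < 0} \<in> sets borel" using assms(3) by simp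
  moreover have "cap m D E {x\<in>UNIV. f x < 0} = 0"
    using assms by (intro quasi_continuous_cap_neg) auto
  ultimately show "{x. f x < 0} \<in> null_sets \<nu>"
    using assms(1) by (auto simp: M0_def null_sets_def)
qed auto

text \<open>
  This is the tool that transfers relations between \<open>u\<close>, \<open>\<phi>\<close> and the test function from \<open>m\<close> to
  \<open>J\<close>, \<open>k\<close>, \<open>\<nu>p\<close> and \<open>\<nu>m\<close>. It also contains the uniqueness of quasi-continuous versions.
\<close>

lemma qc_version_le:
  assumes "\<nu> \<in> M0 m D E" "qc_version m D E u f" "qc_version m D E v g" "AE x in m. u x \<le> v x"
  shows "AE x in \<nu>. f x \<le> g x"
proof -
  have c: "continuous_on UNIV (\<lambda>p :: real \<times> real. snd p - fst p)" by (intro continuous_intros)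
  have "AE x in \<nu>. 0 \<le> snd (f x, g x) - fst (f x, g x)"
  proof (rule AE_if_M0[OF assms(1)])
    show "quasi_continuous m D E (\<lambda>x. snd (f x, g x) - fst (f x, g x))"
      using quasi_continuous_compose[OF _ _ c, of f g] assms(2,3) by (auto simp: qc_version_def)
    have "AE x in m. f x = u x" "AE x in m. g x = v x" using assms(2,3) by (auto simp: qc_version_def)
    then show "AE x in m. 0 \<le> snd (f x, g x) - fst (f x, g x)" using assms(4) by eventually_elim simp
    show "(\<lambda>x. snd (f x, g x) - fst (f x, g x)) \<in> borel_measurable borel"
      using assms(2,3) by (auto simp: qc_version_def)
  qed
  then show ?thesis by simp
qed

lemma qc_version_cong:
  assumes "\<nu> \<in> M0 m D E" "qc_version m D E u f" "qc_version m D E v g" "AE x in m. u x = v x"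
  shows "AE x in \<nu>. f x = g x"
proof -
  have "AE x in m. u x \<le> v x" "AE x in m. v x \<le> u x" using assms(4) by auto
  from qc_version_le[OF assms(1-3) this(1)] qc_version_le[OF assms(1,3,2) this(2)]
  show ?thesis by eventually_elim simp
qed

lemma qc_version_compose:
  fixes H :: "real \<times> real \<Rightarrow> real"
  assumes "qc_version m D E u f" "qc_version m D E v g" and H: "continuous_on UNIV H"
  shows "qc_version m D E (\<lambda>x. H (u x, v x)) (\<lambda>x. H (f x, g x))"
proof -
  have fg: "f \<in> borel_measurable borel" "g \<in> borel_measurable borel"
    "AE x in m. f x = u x" "AE x in m. g x = v x"
    using assms by (auto simp: qc_version_def)
  have "H \<in> borel_measurable borel" using H by (rule borel_measurable_continuous_onI)
  then have "(\<lambda>x. H (f x, g x)) \<in> borel_measurable borel"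
    using borel_measurable_Pair[OF fg(1,2)] by (rule measurable_compose[rotated])
  moreover have "AE x in m. H (f x, g x) = H (u x, v x)" using fg(3,4) by eventually_elim simp
  ultimately show ?thesis
    using assms quasi_continuous_compose[OF _ _ H] by (auto simp: qc_version_def)
qed

lemma qc_version_continuous:
  assumes "continuous_on UNIV f"
  shows "qc_version m D E f f"
proof -
  have z: "E1 m E (\<lambda>x. 0) (\<lambda>x. 0) = 0" using Q.quad_scale[OF zero_mem, of 0] by simp
  have "cap_open m D E {} \<le> 0" using cap_open_le[OF zero_mem, of "{}"] z by simp
  then have "cap m D E {} < ennreal e" if "e > 0" for e
    using that by (simp add: cap_eq_cap_open)
  then have "quasi_continuous m D E f" unfolding quasi_continuous_def using assms by (metis Compl_empty_eq open_empty)
  then show ?thesis using assms by (simp add: qc_version_def borel_measurable_continuous_onI)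
qed

lemma m_in_M0: "m \<in> M0 m D E"
proof -
  have "emeasure m A = 0" if "A \<in> sets borel" "cap m D E A = 0" for A
  proof (rule ennreal_zero_if_small)
    fix e :: real assume "e > 0"
    then have "cap m D E A < ennreal e" using that by simp
    then obtain U where "open U" "A \<subseteq> U" "cap_open m D E U < ennreal e"
      unfolding cap_def INF_less_iff by auto
    then show "emeasure m A \<le> ennreal e"
      using emeasure_le_cap_open[of U] emeasure_mono[of A U m] by (auto intro: order_trans)
  qed
  then show ?thesis by (simp add: M0_def)
qed

end

context regular_dirichlet_space
begin

section \<open>Existence of quasi-continuous versions\<close>

lemma Cc_approx:
  assumes u: "u \<in> D" and d: "\<And>n::nat. d n > (0::real)" "decseq d"
  shows "\<exists>w :: nat \<Rightarrow> 'a \<Rightarrow> real. (\<forall>n. w n \<in> D \<inter> Cc) \<and>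
    (\<forall>n. E1 m E (\<lambda>x. u x - w n x) (\<lambda>x. u x - w n x) < d n) \<and> (AE x in m. (\<lambda>n. w n x) \<longlonglongrightarrow> u x)"
proof -
  \<comment> \<open>The second bound makes the errors tend to zero, which yields a subsequence
    converging almost everywhere.\<close>
  define d' where "d' = (\<lambda>n. min (d n) (inverse (real (Suc n))))"
  have d': "d' n > 0" for n using d(1) by (simp add: d'_def)
  have "\<exists>w\<in>D \<inter> Cc. E1 m E (\<lambda>x. u x - w x) (\<lambda>x. u x - w x) < d' n" for n
    using regular u d'[of n] unfolding regular_dirichlet_form_def by blast
  then obtain w where w: "\<And>n. w n \<in> D" "\<And>n. w n \<in> Cc"
    "\<And>n. E1 m E (\<lambda>x. u x - w n x) (\<lambda>x. u x - w n x) < d' n" by (metis IntE)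
  have uw: "(\<lambda>x. u x - w n x) \<in> D" for n using u w(1) by (rule E.diff_mem)
  have int: "integrable m (\<lambda>x. (u x - w n x)\<^sup>2)" for n using D_L2[OF uw[of n]] by (simp add: L2_def)
  have "(\<lambda>n. \<integral>x. norm ((u x - w n x)\<^sup>2) \<partial>m) \<longlonglongrightarrow> 0"
  proof (rule tendsto_sandwich[OF _ _ tendsto_const LIMSEQ_inverse_real_of_nat])
    show "\<forall>\<^sub>F n in sequentially. (\<integral>x. norm ((u x - w n x)\<^sup>2) \<partial>m) \<le> inverse (real (Suc n))"
    proof (intro always_eventually allI)
      fix n
      have "(\<integral>x. norm ((u x - w n x)\<^sup>2) \<partial>m) = L2_inner m (\<lambda>x. u x - w n x) (\<lambda>x. u x - w n x)"
        by (simp add: L2_inner_def power2_eq_square)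
      also have "\<dots> \<le> inverse (real (Suc n))"
        using L_le_E1[OF uw[of n]] w(3)[of n] by (simp add: d'_def)
      finally show "(\<integral>x. norm ((u x - w n x)\<^sup>2) \<partial>m) \<le> inverse (real (Suc n))" .
    qed
  qed auto
  from tendsto_L1_AE_subseq[OF int this] obtain r where r: "strict_mono r"
    "AE x in m. (\<lambda>n. (u x - w (r n) x)\<^sup>2) \<longlonglongrightarrow> 0" by blast
  have "AE x in m. (\<lambda>n. w (r n) x) \<longlonglongrightarrow> u x"
    using r(2)
  proof eventually_elim
    case (elim x)
    have "(\<lambda>n. u x - w (r n) x) \<longlonglongrightarrow> 0"
      using tendsto_real_sqrt[OF elim] by (simp add: tendsto_rabs_zero_iff)
    from tendsto_diff[OF tendsto_const[of "u x"] this] show ?case by simp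
  qed
  moreover have "E1 m E (\<lambda>x. u x - w (r n) x) (\<lambda>x. u x - w (r n) x) < d n" for n
  proof -
    have "d' (r n) \<le> d (r n)" by (simp add: d'_def)
    also have "\<dots> \<le> d n" using d(2) strict_mono_imp_increasing[OF r(1)] by (simp add: decseq_def)
    finally show ?thesis using w(3)[of "r n"] by simp
  qed
  ultimately show ?thesis using w by (intro exI[of _ "\<lambda>n. w (r n)"]) auto
qed

text \<open>
  Chebyshev's inequality for the capacity: \<open>\<bar>w\<bar> / a\<close> is an admissible potential.
\<close>

lemma cap_open_levelset:
  assumes "w \<in> D" "a > 0"
  shows "cap_open m D E {x. \<bar>w x\<bar> > a} \<le> ennreal (inverse a ^ 2 * E1 m E w w)"
proof -
  let ?v = "\<lambda>x. inverse a * \<bar>w x\<bar>"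
  have v: "?v \<in> D" using abs_mem[OF assms(1)] by (rule E.scale_mem)
  have "cap_open m D E {x. \<bar>w x\<bar> > a} \<le> ennreal (E1 m E ?v ?v)"
    using assms(2) by (intro cap_open_le[OF v] AE_I2) (auto simp: indicator_def field_simps)
  also have "E1 m E ?v ?v \<le> inverse a ^ 2 * E1 m E w w"
    unfolding Q.quad_scale[OF abs_mem[OF assms(1)]]
    by (intro mult_left_mono E1_abs assms) simp
  finally show ?thesis by (simp add: ennreal_leI)
qed

text \<open>
  Continuous functions \<open>w n\<close> that converge fast to \<open>u\<close> in \<open>E1\<close> converge uniformly off the sets
  where consecutive ones differ by more than \<open>(1/2)^n\<close>, and by Chebyshev's inequality these
  sets have summable capacities. The rate \<open>(1/64)^n\<close> leaves capacities of order \<open>(1/16)^n\<close>, which is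
  still fast enough for the union.
\<close>

lemma qc_version_exists:
  assumes u: "u \<in> D"
  shows "\<exists>w. qc_version m D E u w"
proof -
  have dec: "decseq (\<lambda>n. (1/64 :: real) ^ Suc n)"
    by (intro decseq_SucI) simp
  obtain w :: "nat \<Rightarrow> 'a \<Rightarrow> real" where wDC: "\<And>n. w n \<in> D \<inter> Cc"
    and wE: "\<And>n. E1 m E (\<lambda>x. u x - w n x) (\<lambda>x. u x - w n x) < (1/64) ^ Suc n"
    and wae: "AE x in m. (\<lambda>n. w n x) \<longlonglongrightarrow> u x"
    using Cc_approx[OF u _ dec] by auto
  have wD: "w n \<in> D" and wc: "continuous_on UNIV (w n)" for n using wDC[of n] by (auto simp: Cc_def)
  have wm: "w n \<in> borel_measurable borel" for n using wc by (rule borel_measurable_continuous_onI)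
  define U where "U = (\<lambda>n. {x. \<bar>w (Suc n) x - w n x\<bar> > (1/2) ^ n})"
  have Uo: "open (U n)" for n
    unfolding U_def using wc by (intro open_Collect_less continuous_intros)
  have dD: "(\<lambda>x. w (Suc n) x - w n x) \<in> D" for n using wD wD by (rule E.diff_mem)
  have dE: "E1 m E (\<lambda>x. w (Suc n) x - w n x) (\<lambda>x. w (Suc n) x - w n x) < 4 * (1/64) ^ Suc n" for n
  proof -
    have "E1 m E (\<lambda>x. (u x - w n x) - (u x - w (Suc n) x)) (\<lambda>x. (u x - w n x) - (u x - w (Suc n) x))
      \<le> 2 * E1 m E (\<lambda>x. u x - w n x) (\<lambda>x. u x - w n x)
        + 2 * E1 m E (\<lambda>x. u x - w (Suc n) x) (\<lambda>x. u x - w (Suc n) x)"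
      by (intro Q.quad_diff_le E.diff_mem u wD)
    moreover have "(1/64 :: real) ^ Suc (Suc n) \<le> (1/64) ^ Suc n" by simp
    moreover note wE[of n] wE[of "Suc n"]
    moreover have "(\<lambda>x. (u x - w n x) - (u x - w (Suc n) x)) = (\<lambda>x. w (Suc n) x - w n x)" by auto
    ultimately show ?thesis by (simp only:)
  qed
  have Ucap: "cap_open m D E (U n) < ennreal ((1/16) ^ n)" for n
  proof -
    have "inverse ((1/2 :: real) ^ n) ^ 2 = 4 ^ n"
      by (simp add: power_inverse[symmetric] power_divide power2_eq_square flip: power_mult_distrib)
    then have "cap_open m D E (U n)
        \<le> ennreal (4 ^ n * E1 m E (\<lambda>x. w (Suc n) x - w n x) (\<lambda>x. w (Suc n) x - w n x))"
      using cap_open_levelset[OF dD[of n], of "(1/2) ^ n"] by (simp add: U_def)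
    also have "\<dots> < ennreal (4 ^ n * (4 * (1/64) ^ Suc n))"
      using dE[of n] Q.nonneg[OF dD[of n]] by (intro ennreal_lessI) auto
    also have "4 ^ n * (4 * (1/64) ^ Suc n) = (1/16 :: real) ^ n * (1/16)"
    proof -
      have "(4 :: real) ^ n * (1/64) ^ n = (1/16) ^ n" by (simp flip: power_mult_distrib)
      then show ?thesis by simp
    qed
    also have "ennreal ((1/16) ^ n * (1/16)) \<le> ennreal ((1/16) ^ n)" by (intro ennreal_leI) simp
    finally show ?thesis .
  qed
  define v where "v = (\<lambda>x. lim (\<lambda>n. w n x))"
  have vm: "v \<in> borel_measurable borel" unfolding v_def using wm by (intro borel_measurable_lim_metric)
  have vu: "AE x in m. v x = u x" using wae by eventually_elim (simp add: v_def limI)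
  have cont: "continuous_on (- (\<Union>n. U (k + n))) v" for k
  proof (rule uniform_limit_theorem)
    let ?S = "- (\<Union>n. U (k + n))"
    have step: "\<bar>w (Suc n) x - w n x\<bar> \<le> (1/2) ^ n" if "x \<in> ?S" "n \<ge> k" for x n
    proof -
      have "x \<notin> U (k + (n - k))" using that(1) by blast
      then show ?thesis using that(2) by (simp add: U_def not_less)
    qed
    have tail: "\<bar>w (n + j) x - w n x\<bar> \<le> 2 * (1/2) ^ n - 2 * (1/2) ^ (n + j)"
      if "x \<in> ?S" "n \<ge> k" for x n j
    proof (induction j)
      case (Suc j)
      have "\<bar>w (Suc (n + j)) x - w (n + j) x\<bar> \<le> (1/2) ^ (n + j)" using that by (intro step) auto
      then show ?case using Suc by simp
    qed simp
    have tail': "\<bar>w (n + j) x - w n x\<bar> \<le> 2 * (1/2) ^ n" if "x \<in> ?S" "n \<ge> k" for x n j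
      using tail[OF that, of j] zero_le_power[of "1/2 :: real" "n + j"] by linarith
    have p0: "(\<lambda>n. 2 * (1/2 :: real) ^ n) \<longlonglongrightarrow> 2 * 0" by (intro tendsto_intros LIMSEQ_realpow_zero) auto
    have lim: "(\<lambda>n. w n x) \<longlonglongrightarrow> v x" if x: "x \<in> ?S" for x
    proof -
      have "Cauchy (\<lambda>n. w n x)"
        unfolding Cauchy_altdef2
      proof (intro allI impI)
        fix e :: real assume "e > 0"
        then obtain N where N: "\<And>n. n \<ge> N \<Longrightarrow> 2 * (1/2 :: real) ^ n < e"
          using order_tendstoD(2)[OF p0, of e] by (auto simp: eventually_sequentially)
        have "dist (w n x) (w (max N k) x) < e" if "n \<ge> max N k" for n
          using tail'[OF x, of "max N k" "n - max N k"] N[of "max N k"] that by (simp add: dist_real_def)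
        then show "\<exists>N. \<forall>n\<ge>N. dist (w n x) (w N x) < e" by blast
      qed
      then show ?thesis unfolding v_def by (simp add: Cauchy_convergent_iff convergent_LIMSEQ_iff)
    qed
    have close: "\<bar>v x - w n x\<bar> \<le> 2 * (1/2) ^ n" if "x \<in> ?S" "n \<ge> k" for x n
    proof (rule LIMSEQ_le_const2)
      show "(\<lambda>j. \<bar>w (n + j) x - w n x\<bar>) \<longlonglongrightarrow> \<bar>v x - w n x\<bar>"
        using LIMSEQ_ignore_initial_segment[OF lim[OF that(1)], of n]
        by (intro tendsto_intros) (simp add: add.commute)
    qed (use tail'[OF that] in auto)
    show "uniform_limit ?S w v sequentially"
    proof (rule uniform_limitI)
      fix e :: real assume "e > 0"
      from order_tendstoD(2)[OF p0, of e] this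
      have "\<forall>\<^sub>F n in sequentially. 2 * (1/2 :: real) ^ n < e" by simp
      with eventually_ge_at_top[of k]
      show "\<forall>\<^sub>F n in sequentially. \<forall>x\<in>?S. dist (w n x) (v x) < e"
      proof eventually_elim
        case (elim n)
        show ?case
        proof
          fix x assume "x \<in> ?S"
          from close[OF this elim(1)] elim(2) show "dist (w n x) (v x) < e"
            by (simp add: dist_real_def abs_minus_commute)
        qed
      qed
    qed
    show "\<forall>\<^sub>F n in sequentially. continuous_on ?S (w n)"
      using wc continuous_on_subset by (intro always_eventually) blast
  qed simp
  have "quasi_continuous m D E v"
    unfolding quasi_continuous_def
  proof (intro allI impI)
    fix e :: real assume e: "e > 0"
    have "(\<lambda>n. (1/16 :: real) ^ n) \<longlonglongrightarrow> 0" by (intro LIMSEQ_realpow_zero) auto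
    then obtain k where k: "(1/16 :: real) ^ k < e / 8"
      using order_tendstoD(2)[of _ 0 sequentially "e / 8"] e by (auto simp: eventually_sequentially)
    have "cap_open m D E (U (k + n)) < ennreal (e / 2 * (1/4) ^ Suc n)" for n
    proof -
      have "(1/16 :: real) ^ (k + n) \<le> (e / 8) * (1/4) ^ n"
        unfolding power_add using k e by (intro mult_mono power_mono) auto
      also have "\<dots> = e / 2 * (1/4) ^ Suc n" by simp
      finally show ?thesis using Ucap[of "k + n"] by (meson ennreal_leI order_less_le_trans)
    qed
    then have "cap_open m D E (\<Union>n. U (k + n)) \<le> ennreal (e / 2)"
      using e by (intro cap_open_Union_less) auto
    also have "\<dots> < ennreal e" using e by (simp add: ennreal_less_iff)
    finally show "\<exists>U. open U \<and> cap m D E U < ennreal e \<and> continuous_on (- U) v"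
      using Uo cont[of k] by (intro exI[of _ "\<Union>n. U (k + n)"]) (auto simp: cap_eq_cap_open open_UN)
  qed
  then show ?thesis using vm vu by (auto simp: qc_version_def)
qed

text \<open>
  The versions \<open>f n\<close> belong to elements of \<open>D\<close> that agree with \<open>u\<close> on the sets \<open>B n\<close> of an open
  cover. They are glued by taking at each point the first set of the cover that contains it. The
  choice is harmless: two of the versions agree almost everywhere on the overlap, so the points of
  disagreement can be added to the exceptional open set without raising its capacity, as in
  \<open>quasi_continuous_cap_neg\<close>.
\<close>

lemma qc_version_exists_loc:
  assumes lc: "locally compact (UNIV :: 'a set)" and u: "u \<in> D_loc m D"
  shows "\<exists>w. qc_version m D E u w"
proof -
  obtain B :: "nat \<Rightarrow> 'a set" where B: "\<And>n. open (B n)" "\<And>n. compact (closure (B n))" "(\<Union>n. B n) = UNIV"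
    using open_cover_compact_closure[OF lc] by blast
  have "\<exists>v\<in>D. AE x in m. x \<in> B n \<longrightarrow> u x = v x" for n
    using u B(1,2) unfolding D_loc_def by blast
  then obtain v where v: "\<And>n. v n \<in> D" "\<And>n. AE x in m. x \<in> B n \<longrightarrow> u x = v n x" by metis
  obtain f where f: "\<And>n. qc_version m D E (v n) (f n)" using qc_version_exists[OF v(1)] by metis
  have fm: "f n \<in> borel_measurable borel" and fq: "quasi_continuous m D E (f n)"
    and fae: "AE x in m. f n x = v n x" for n
    using f[of n] by (auto simp: qc_version_def)
  have ae: "AE x in m. \<forall>n. x \<in> B n \<longrightarrow> f n x = u x"
    unfolding AE_all_countable
  proof
    fix n show "AE x in m. x \<in> B n \<longrightarrow> f n x = u x"
      using v(2)[of n] fae[of n] by eventually_elim auto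
  qed
  define i where "i = (\<lambda>x. LEAST n. x \<in> B n)"
  have iB: "x \<in> B (i x)" for x
  proof -
    have "x \<in> (\<Union>n. B n)" using B(3) by simp
    then have "\<exists>n. x \<in> B n" by blast
    then show ?thesis unfolding i_def by (rule LeastI_ex)
  qed
  define w where "w = (\<lambda>x. f (i x) x)"
  have "w \<in> borel_measurable borel"
    unfolding w_def
  proof (rule measurable_compose_countable[of _ _ _ i])
    have [measurable]: "B n \<in> sets borel" for n using B(1) by auto
    show "i \<in> borel \<rightarrow>\<^sub>M count_space UNIV" unfolding i_def by measurable
  qed (use fm in simp)
  moreover have "AE x in m. w x = u x"
    using ae by eventually_elim (auto simp: w_def iB)
  moreover have "quasi_continuous m D E w"
    unfolding quasi_continuous_def
  proof (intro allI impI)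
    fix e :: real assume "e > 0"
    then obtain U where U: "open U" "cap_open m D E U < ennreal e" "\<And>n. continuous_on (- U) (f n)"
      using quasi_continuous_family[of f e] fq by blast
    have "\<exists>W. open W \<and> W \<inter> - U = (\<lambda>x. f p x - f q x) -` (- {0}) \<inter> - U" for p q
    proof -
      have "continuous_on (- U) (\<lambda>x. f p x - f q x)" using U(3) by (intro continuous_intros)
      moreover have "open (- {0 :: real})" by auto
      ultimately show ?thesis unfolding continuous_on_open_invariant by blast
    qed
    then obtain W where W: "\<And>p q. open (W p q)"
      "\<And>p q. W p q \<inter> - U = (\<lambda>x. f p x - f q x) -` (- {0}) \<inter> - U" by metis
    define V where "V = U \<union> (\<Union>p. \<Union>q. W p q \<inter> B p \<inter> B q)"
    have V: "open V" unfolding V_def using U(1) W(1) B(1) by (intro open_Un open_UN ballI open_Int)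
    have "cap m D E V \<le> cap_open m D E U"
      unfolding cap_eq_cap_open[OF V]
    proof (rule cap_open_mono)
      show "AE x in m. x \<in> V \<longrightarrow> x \<in> U"
        using ae
      proof eventually_elim
        case (elim x)
        have False if "x \<notin> U" "x \<in> W p q" "x \<in> B p" "x \<in> B q" for p q
        proof -
          have "x \<in> (\<lambda>x. f p x - f q x) -` (- {0})" using that W(2)[of p q] by blast
          then show False using elim that by auto
        qed
        then show ?case unfolding V_def by blast
      qed
    qed
    moreover have eq: "w x = f n x" if "x \<notin> V" "x \<in> B n" for x n
    proof (rule ccontr)
      assume "w x \<noteq> f n x"
      then have "x \<in> (\<lambda>x. f (i x) x - f n x) -` (- {0})" by (simp add: w_def)
      moreover have "x \<notin> U" using that by (simp add: V_def)
      ultimately have "x \<in> W (i x) n" using W(2)[of "i x" n] by auto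
      then show False using that iB[of x] by (auto simp: V_def)
    qed
    have "continuous_on (- V) w"
      unfolding continuous_on_open_invariant
    proof (intro allI impI)
      fix T :: "real set" assume "open T"
      then have "\<exists>A. open A \<and> A \<inter> - U = f n -` T \<inter> - U" for n
        using U(3)[of n] unfolding continuous_on_open_invariant by blast
      then obtain A where A: "\<And>n. open (A n)" "\<And>n. A n \<inter> - U = f n -` T \<inter> - U" by metis
      have UV: "U \<subseteq> V" by (auto simp: V_def)
      have "x \<in> A n \<longleftrightarrow> w x \<in> T" if "x \<notin> V" "x \<in> B n" for x n
      proof -
        have "x \<in> - U" using that(1) UV by blast
        then have "x \<in> A n \<longleftrightarrow> f n x \<in> T" using A(2)[of n] by blast
        then show ?thesis using eq[OF that] by simp
      qed
      then have "(\<Union>n. A n \<inter> B n) \<inter> - V = w -` T \<inter> - V"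
        using iB by blast
      then show "\<exists>A. open A \<and> A \<inter> - V = w -` T \<inter> - V"
        using A(1) B(1) by (intro exI[of _ "\<Union>n. A n \<inter> B n"]) (auto intro!: open_UN)
    qed
    ultimately show "\<exists>U. open U \<and> cap m D E U < ennreal e \<and> continuous_on (- U) w"
      using V U(2) by (meson order_le_less_trans)
  qed
  ultimately show ?thesis by (auto simp: qc_version_def)
qed

lemma qc_version_qc:
  assumes "\<exists>w. qc_version m D E u w"
  shows "qc_version m D E u (qc m D E u)"
  using assms unfolding qc_def by (rule someI_ex)

lemma qc_version_D: "u \<in> D \<Longrightarrow> qc_version m D E u (qc m D E u)"
  by (intro qc_version_qc qc_version_exists)

end

section \<open>The Beurling-Deny decomposition\<close>

lemma L2_dominated_convergence:
  fixes f :: "nat \<Rightarrow> 'a \<Rightarrow> real"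
  assumes g: "g \<in> L2 M" and m: "\<And>n. f n \<in> borel_measurable M" "h \<in> borel_measurable M"
    and lim: "AE x in M. (\<lambda>n. f n x) \<longlonglongrightarrow> h x"
    and bd: "\<And>n. AE x in M. \<bar>f n x - h x\<bar> \<le> \<bar>g x\<bar>"
  shows "(\<lambda>n. L2_inner M (\<lambda>x. f n x - h x) (\<lambda>x. f n x - h x)) \<longlonglongrightarrow> 0"
proof -
  have "(\<lambda>n. \<integral>x. (f n x - h x)\<^sup>2 \<partial>M) \<longlonglongrightarrow> (\<integral>x. 0 \<partial>M)"
  proof (rule integral_dominated_convergence[where w = "\<lambda>x. (g x)\<^sup>2"])
    show "AE x in M. (\<lambda>n. (f n x - h x)\<^sup>2) \<longlonglongrightarrow> 0"
      using lim
    proof eventually_elim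
      case (elim x)
      from tendsto_power[OF tendsto_diff[OF elim tendsto_const[of "h x"]], of 2] show ?case by simp
    qed
    show "AE x in M. norm ((f n x - h x)\<^sup>2) \<le> (g x)\<^sup>2" for n
      using bd[of n] by eventually_elim (simp add: abs_le_square_iff)
  qed (use g m in \<open>auto simp: L2_def\<close>)
  then show ?thesis by (simp add: L2_inner_def power2_eq_square)
qed

lemma abs_comb_le_sqrt:
  assumes "a\<^sup>2 + b\<^sup>2 \<le> (1::real)"
  shows "\<bar>a * s + b * t\<bar> \<le> sqrt (s\<^sup>2 + t\<^sup>2)"
proof (rule real_le_rsqrt)
  have "(a * s + b * t)\<^sup>2 + (b * s - a * t)\<^sup>2 = (a\<^sup>2 + b\<^sup>2) * (s\<^sup>2 + t\<^sup>2)"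
    by (simp add: power2_eq_square algebra_simps)
  moreover have "(a\<^sup>2 + b\<^sup>2) * (s\<^sup>2 + t\<^sup>2) \<le> 1 * (s\<^sup>2 + t\<^sup>2)"
    using assms by (intro mult_right_mono) auto
  moreover have "(b * s - a * t)\<^sup>2 \<ge> 0" by simp
  ultimately show "\<bar>a * s + b * t\<bar>\<^sup>2 \<le> s\<^sup>2 + t\<^sup>2" unfolding power2_abs by (simp only: mult_1)
qed

lemma sqrt_sum_squares_diff_le:
  "\<bar>sqrt (a\<^sup>2 + b\<^sup>2) - sqrt (c\<^sup>2 + d\<^sup>2)\<bar> \<le> sqrt ((a - c)\<^sup>2 + (b - d)\<^sup>2)"
  using norm_triangle_ineq3[of "(a, b)" "(c, d)"] by (simp add: norm_Pair)

text \<open>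
  The norm of the plane as a supremum of countably many linear functionals from the unit ball.
\<close>

lemma dense_unit_ball:
  "\<exists>\<alpha> \<beta> :: nat \<Rightarrow> real. (\<forall>n. (\<alpha> n)\<^sup>2 + (\<beta> n)\<^sup>2 \<le> 1) \<and>
     (\<forall>s t e. e > 0 \<longrightarrow> (\<exists>n. sqrt (s\<^sup>2 + t\<^sup>2) - e < \<alpha> n * s + \<beta> n * t))"
proof -
  let ?S = "cball (0 :: real \<times> real) 1"
  obtain T where T: "countable T" "T \<subseteq> ?S" "?S \<subseteq> closure T" by (rule separable)
  have ne: "T \<noteq> {}" using T(3) by auto
  define c where "c = from_nat_into T"
  have cT: "range c = T" unfolding c_def using ne T(1) by (rule range_from_nat_into)
  have "(fst (c n))\<^sup>2 + (snd (c n))\<^sup>2 \<le> 1" for n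
  proof -
    have "c n \<in> ?S" using cT T(2) by blast
    then have "norm (c n) \<le> 1" by simp
    then have "sqrt ((fst (c n))\<^sup>2 + (snd (c n))\<^sup>2) \<le> 1" by (simp add: norm_prod_def)
    then show ?thesis by simp
  qed
  moreover have "\<exists>n. sqrt (s\<^sup>2 + t\<^sup>2) - e < fst (c n) * s + snd (c n) * t" if e: "e > 0" for s t e
  proof -
    define r where "r = sqrt (s\<^sup>2 + t\<^sup>2)"
    \<comment> \<open>For \<open>r = 0\<close> this is the origin, since division by zero gives
      zero.\<close>
    define p where "p = (s / r, t / r)"
    let ?l = "\<lambda>q :: real \<times> real. fst q * s + snd q * t"
    have r0: "r \<ge> 0" and r2: "r\<^sup>2 = s\<^sup>2 + t\<^sup>2" by (auto simp: r_def)
    have p: "norm p \<le> 1" "?l p = r"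
    proof -
      have "(s / r)\<^sup>2 + (t / r)\<^sup>2 \<le> 1"
      proof (cases "r = 0")
        case False
        have "(s / r)\<^sup>2 + (t / r)\<^sup>2 = r\<^sup>2 / r\<^sup>2"
          by (simp only: power_divide r2 add_divide_distrib)
        then show ?thesis using False by simp
      qed simp
      then show "norm p \<le> 1" unfolding p_def norm_Pair real_norm_def power2_abs by simp
      show "?l p = r"
      proof (cases "r = 0")
        case False
        have "?l p = (s\<^sup>2 + t\<^sup>2) / r" by (simp add: p_def add_divide_distrib power2_eq_square)
        also have "\<dots> = r\<^sup>2 / r" by (simp only: r2)
        finally have "?l p = r\<^sup>2 / r" .
        then show ?thesis using False by (simp add: power2_eq_square)
      qed (simp add: p_def)
    qed
    have "continuous_on UNIV ?l" by (intro continuous_intros)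
    then have o: "open {q. r - e < ?l q}" by (intro open_Collect_less continuous_intros)
    have "p \<in> {q. r - e < ?l q}" using p(2) e by simp
    moreover have "p \<in> closure T" using p(1) T(3) by auto
    ultimately obtain q where "q \<in> T" "r - e < ?l q"
      using open_Int_closure_eq_empty[OF o, of T] by blast
    then show ?thesis using cT unfolding r_def by blast
  qed
  ultimately show ?thesis by (intro exI[of _ "\<lambda>n. fst (c n)"] exI[of _ "\<lambda>n. snd (c n)"]) blast
qed

locale beurling_deny_space = regular_dirichlet_space m D E
  for m :: "'a::{metric_space,second_countable_topology} measure" and D E +
  fixes J :: "('a \<times> 'a) measure" and \<mu> :: "('a \<Rightarrow> real) \<Rightarrow> ('a \<Rightarrow> real) \<Rightarrow> 'a set \<Rightarrow> real" and k :: "'a measure"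
  assumes bd: "beurling_deny m D E J \<mu> k"
begin

lemma mu_strongly_local: "strongly_local_measure_form m D \<mu>"
  and sets_J [measurable_cong, simp]: "sets J = sets borel"
  and J_diag: "emeasure J diag = 0"
  and sets_k [measurable_cong, simp]: "sets k = sets borel"
  using bd by (auto simp: beurling_deny_def jump_measure_def radon_measure_def)

lemma mu_signed: "u \<in> D \<Longrightarrow> v \<in> D \<Longrightarrow> signed_borel_measure (\<mu> u v)"
  by (rule mu_strongly_local[unfolded strongly_local_measure_form_def, THEN conjunct1, rule_format])

lemma mu_local_supp:
  assumes "u \<in> D" "v \<in> D" "AE x in m. x \<in> supp m v \<longrightarrow> u x = c" "A \<in> sets borel"
  shows "\<mu> u v A = 0"
  by (rule mu_strongly_local[unfolded strongly_local_measure_form_def, THEN conjunct2, THEN conjunct2,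
      THEN conjunct2, THEN conjunct2, THEN conjunct2, THEN conjunct1, rule_format]) (use assms in blast)+

lemma mu_local_open:
  assumes "u \<in> D" "v \<in> D" "open G" "AE x in m. x \<in> G \<longrightarrow> u x = c" "A \<in> sets borel" "A \<subseteq> G"
  shows "\<mu> u v A = 0"
  by (rule mu_strongly_local[unfolded strongly_local_measure_form_def, THEN conjunct2, THEN conjunct2,
      THEN conjunct2, THEN conjunct2, THEN conjunct2, THEN conjunct2, rule_format, of _ _ G])
    (use assms in blast)+

lemma beurling_deny_formula:
  assumes "u \<in> D" "qc_version m D E u w"
  shows "ennreal (E u u) = (\<integral>\<^sup>+z. ennreal ((w (fst z) - w (snd z))\<^sup>2) \<partial>J) + ennreal (\<mu> u u UNIV) +
          (\<integral>\<^sup>+x. ennreal ((w x)\<^sup>2) \<partial>k)"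
  using bd assms unfolding beurling_deny_def by blast

lemma mu_psd: "A \<in> sets borel \<Longrightarrow> psd_form D (\<lambda>u v. \<mu> u v A)"
proof
  note mu_strongly_local' = mu_strongly_local[unfolded strongly_local_measure_form_def, THEN conjunct2]
  assume A: "A \<in> sets borel"
  show "\<And>u v. u \<in> D \<Longrightarrow> v \<in> D \<Longrightarrow> \<mu> u v A = \<mu> v u A"
    using A by (intro mu_strongly_local'[THEN conjunct1, rule_format])
  show "\<And>u v w. u \<in> D \<Longrightarrow> v \<in> D \<Longrightarrow> w \<in> D \<Longrightarrow> \<mu> (\<lambda>x. u x + v x) w A = \<mu> u w A + \<mu> v w A"
    using A by (intro mu_strongly_local'[THEN conjunct2, THEN conjunct1, rule_format])
  show "\<And>u w c. u \<in> D \<Longrightarrow> w \<in> D \<Longrightarrow> \<mu> (\<lambda>x. c * u x) w A = c * \<mu> u w A"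
    using A by (intro mu_strongly_local'[THEN conjunct2, THEN conjunct2, THEN conjunct1, rule_format])
  show "\<And>u. u \<in> D \<Longrightarrow> 0 \<le> \<mu> u u A"
    using A by (intro mu_strongly_local'[THEN conjunct2, THEN conjunct2, THEN conjunct2, THEN conjunct1, rule_format])
qed (simp_all add: E.add_mem E.scale_mem)

lemma mu_disjoint_Un:
  assumes uv: "u \<in> D" "v \<in> D" and AB: "A \<in> sets borel" "B \<in> sets borel" "A \<inter> B = {}"
  shows "\<mu> u v (A \<union> B) = \<mu> u v A + \<mu> u v B"
proof -
  have s: "signed_borel_measure (\<mu> u v)"
    using uv by (rule mu_signed)
  let ?F = "\<lambda>n::nat. if n = 0 then A else if n = 1 then B else {}"
  have "(\<lambda>i. \<mu> u v (?F i)) sums \<mu> u v (\<Union>i. ?F i)"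
    using s AB unfolding signed_borel_measure_def
    by (elim conjE allE[of _ ?F]) (auto simp: disjoint_family_on_def split: if_splits)
  moreover have "(\<Union>i. ?F i) = A \<union> B"
  proof
    show "(\<Union>i. ?F i) \<subseteq> A \<union> B" by auto
    have "?F 0 \<subseteq> (\<Union>i. ?F i)" "?F 1 \<subseteq> (\<Union>i. ?F i)" by (rule UN_upper; simp)+
    then show "A \<union> B \<subseteq> (\<Union>i. ?F i)" by simp
  qed
  moreover have "(\<lambda>i. \<mu> u v (?F i)) sums (\<Sum>i<2. \<mu> u v (?F i))"
  proof (rule sums_finite)
    have "\<mu> u v {} = 0" using s by (simp add: signed_borel_measure_def)
    then show "\<mu> u v (?F i) = 0" if "i \<notin> {..<2}" for i using that by simp
  qed simp
  ultimately have "\<mu> u v (A \<union> B) = (\<Sum>i<2. \<mu> u v (?F i))"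
    by (simp only: sums_unique2)
  then show ?thesis by (simp add: numeral_2_eq_2)
qed

lemma mu_split:
  assumes "u \<in> D" "A \<in> sets borel" "P \<in> sets borel"
  shows "\<mu> u u A = \<mu> u u (A \<inter> P) + \<mu> u u (A - P)"
proof -
  have "A = (A \<inter> P) \<union> (A - P)" by auto
  then show ?thesis using mu_disjoint_Un[of u u "A \<inter> P" "A - P"] assms by fastforce
qed

lemma mu_nonneg: "u \<in> D \<Longrightarrow> A \<in> sets borel \<Longrightarrow> 0 \<le> \<mu> u u A"
  by (rule mu_strongly_local[unfolded strongly_local_measure_form_def, THEN conjunct2, THEN conjunct2,
      THEN conjunct2, THEN conjunct2, THEN conjunct1, rule_format])

lemma mu_le_E:
  assumes "u \<in> D" "A \<in> sets borel"
  shows "\<mu> u u A \<le> E u u"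
proof -
  have "\<mu> u u A \<le> \<mu> u u UNIV"
    using mu_split[OF assms(1), of UNIV A] mu_nonneg[OF assms(1), of "UNIV - A"] assms(2) by auto
  moreover have "ennreal (\<mu> u u UNIV) \<le> ennreal (E u u)"
    unfolding beurling_deny_formula[OF assms(1) qc_version_D[OF assms(1)]] by (simp add: add_increasing add_increasing2)
  then have "\<mu> u u UNIV \<le> E u u" using E.nonneg[OF assms(1)] by simp
  ultimately show ?thesis by simp
qed

lemma mu_local:
  assumes uvw: "u \<in> D" "v \<in> D" "w \<in> D" and G: "open G" "AE x in m. x \<in> G \<longrightarrow> u x = v x"
    and A: "A \<in> sets borel" "A \<subseteq> G"
  shows "\<mu> u w A = \<mu> v w A"
proof -
  interpret M: psd_form D "\<lambda>u v. \<mu> u v A" by (rule mu_psd[OF A(1)])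
  have "AE x in m. x \<in> G \<longrightarrow> u x - v x = 0" using G(2) by eventually_elim simp
  then have "\<mu> (\<lambda>x. u x - v x) w A = 0"
    by (rule mu_local_open[OF M.diff_mem[OF uvw(1,2)] uvw(3) G(1) _ A])
  then show ?thesis using M.diff_left[OF uvw] by simp
qed

lemma mu_local_quad:
  assumes uv: "u \<in> D" "v \<in> D" and G: "open G" "AE x in m. x \<in> G \<longrightarrow> u x = v x"
    and A: "A \<in> sets borel" "A \<subseteq> G"
  shows "\<mu> u u A = \<mu> v v A"
proof -
  interpret M: psd_form D "\<lambda>u v. \<mu> u v A" by (rule mu_psd[OF A(1)])
  have "\<mu> u u A = \<mu> v u A" by (rule mu_local[OF uv uv(1) G A])
  also have "\<dots> = \<mu> u v A" by (rule M.sym[OF uv(2,1)])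
  also have "\<dots> = \<mu> v v A" by (rule mu_local[OF uv uv(2) G A])
  finally show ?thesis .
qed

lemma fst_snd_measurable_J [measurable]: "fst \<in> J \<rightarrow>\<^sub>M borel" "snd \<in> J \<rightarrow>\<^sub>M borel"
proof -
  have "fst \<in> (borel :: ('a \<times> 'a) measure) \<rightarrow>\<^sub>M borel" "snd \<in> (borel :: ('a \<times> 'a) measure) \<rightarrow>\<^sub>M borel"
    by (intro borel_measurable_continuous_onI continuous_intros)+
  then show "fst \<in> J \<rightarrow>\<^sub>M borel" "snd \<in> J \<rightarrow>\<^sub>M borel"
    using measurable_cong_sets[OF sets_J refl] by auto
qed

text \<open>
  All three terms are finite because their sum is, so the formula holds between real integrals.
\<close>

lemma beurling_deny_real:
  assumes u: "u \<in> D" and w: "qc_version m D E u w"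
  shows "integrable J (\<lambda>z. (w (fst z) - w (snd z))\<^sup>2)" "integrable k (\<lambda>x. (w x)\<^sup>2)"
    "E u u = (\<integral>z. (w (fst z) - w (snd z))\<^sup>2 \<partial>J) + \<mu> u u UNIV + (\<integral>x. (w x)\<^sup>2 \<partial>k)"
proof -
  have wm: "w \<in> borel_measurable borel" using w by (simp add: qc_version_def)
  have fin: "(\<integral>\<^sup>+z. ennreal ((w (fst z) - w (snd z))\<^sup>2) \<partial>J) < \<infinity>" "(\<integral>\<^sup>+x. ennreal ((w x)\<^sup>2) \<partial>k) < \<infinity>"
    using beurling_deny_formula[OF u w] by (auto simp: less_top[symmetric])
  have [measurable]: "w \<in> borel_measurable k" using wm by simp
  have [measurable]: "(\<lambda>z. w (fst z)) \<in> borel_measurable J" "(\<lambda>z. w (snd z)) \<in> borel_measurable J"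
    using measurable_compose[OF fst_snd_measurable_J(1) wm] measurable_compose[OF fst_snd_measurable_J(2) wm] by auto
  show i: "integrable J (\<lambda>z. (w (fst z) - w (snd z))\<^sup>2)" "integrable k (\<lambda>x. (w x)\<^sup>2)"
    using fin by (auto intro!: integrableI_bounded)
  have "ennreal (E u u) = ennreal ((\<integral>z. (w (fst z) - w (snd z))\<^sup>2 \<partial>J) + \<mu> u u UNIV + (\<integral>x. (w x)\<^sup>2 \<partial>k))"
    using beurling_deny_formula[OF u w] i mu_nonneg[OF u, of UNIV]
    by (simp add: nn_integral_eq_integral)
  then show "E u u = (\<integral>z. (w (fst z) - w (snd z))\<^sup>2 \<partial>J) + \<mu> u u UNIV + (\<integral>x. (w x)\<^sup>2 \<partial>k)"
    using E.nonneg[OF u] mu_nonneg[OF u, of UNIV] by (subst (asm) ennreal_inj) auto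
qed

text \<open>
  The Beurling-Deny formula holds for every choice of the quasi-continuous version. Applied to the
  zero function with the version \<open>indicator N\<close>, it shows that \<open>k\<close> and \<open>J\<close> do not see sets \<open>N\<close> of
  capacity zero.
\<close>

lemma qc_version_polar:
  assumes "N \<in> sets borel" "cap m D E N = 0"
  shows "qc_version m D E (\<lambda>x. 0) (indicator N)"
  unfolding qc_version_def
proof (intro conjI)
  show "quasi_continuous m D E (indicator N)"
    unfolding quasi_continuous_def
  proof (intro allI impI)
    fix e :: real assume "e > 0"
    then have "cap m D E N < ennreal e" using assms by simp
    then obtain U where U: "open U" "N \<subseteq> U" "cap_open m D E U < ennreal e"
      unfolding cap_def INF_less_iff by auto
    have "continuous_on (- U) (indicator N :: 'a \<Rightarrow> real) \<longleftrightarrow> continuous_on (- U) (\<lambda>_. 0 :: real)"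
      using U(2) by (intro continuous_on_cong) (auto simp: indicator_def)
    then show "\<exists>U. open U \<and> cap m D E U < ennreal e \<and> continuous_on (- U) (indicator N :: 'a \<Rightarrow> real)"
      using U by (auto simp: cap_eq_cap_open)
  qed
  have "N \<in> null_sets m" using m_in_M0 assms by (auto simp: M0_def null_sets_def)
  then show "AE x in m. indicator N x = (0 :: real)"
    by (intro AE_I'[of N]) (auto simp: indicator_def)
qed (use assms in simp)

lemma cap_mono: "A \<subseteq> B \<Longrightarrow> cap m D E A \<le> cap m D E B"
  unfolding cap_def by (intro INF_superset_mono) auto

lemma E_zero: "E (\<lambda>x. 0) (\<lambda>x. 0) = 0"
  using E.quad_scale[OF zero_mem, of 0] by simp

lemma k_in_M0: "k \<in> M0 m D E"
proof -
  have "emeasure k N = 0" if N: "N \<in> sets borel" "cap m D E N = 0" for N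
  proof -
    have "emeasure k N = (\<integral>\<^sup>+x. ennreal ((indicator N x)\<^sup>2) \<partial>k)"
    proof -
      have "(\<lambda>x. ennreal ((indicator N x)\<^sup>2)) = indicator N" by (auto simp: indicator_def)
      then show ?thesis using N(1) by simp
    qed
    also have "\<dots> = 0" using beurling_deny_formula[OF zero_mem qc_version_polar[OF N]] E_zero by simp
    finally show ?thesis .
  qed
  then show ?thesis by (simp add: M0_def)
qed

text \<open>
  For the version \<open>indicator (N \<inter> b)\<close> of zero, the formula says that almost no jump leads from
  \<open>N \<inter> b\<close> to its complement or back. If \<open>b\<close> runs through a countable base, then each pair of
  different points with one of them in \<open>N\<close> is separated by some \<open>b\<close>, so that no jump starts or
  ends in \<open>N\<close>.
\<close>

lemma J_polar:
  assumes N: "N \<in> sets borel" "cap m D E N = 0"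
  shows "AE z in J. fst z \<notin> N \<and> snd z \<notin> N"
proof -
  obtain \<B> :: "'a set set" where \<B>: "countable \<B>" "topological_basis \<B>"
    using ex_countable_basis by blast
  have "AE z in J. (fst z \<in> N \<inter> b) = (snd z \<in> N \<inter> b)" if b: "b \<in> \<B>" for b
  proof -
    have Nb: "N \<inter> b \<in> sets borel" using N b topological_basis_open[OF \<B>(2)] by auto
    have "cap m D E (N \<inter> b) = 0" using cap_mono[of "N \<inter> b" N] N(2) by simp
    from beurling_deny_formula[OF zero_mem qc_version_polar[OF Nb this]]
    have "(\<integral>\<^sup>+z. ennreal ((indicator (N \<inter> b) (fst z) - indicator (N \<inter> b) (snd z))\<^sup>2) \<partial>J) = 0"
      using E_zero by simp
    moreover have [measurable]: "N \<inter> b \<in> sets borel" by fact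
    ultimately have "AE z in J. ennreal ((indicator (N \<inter> b) (fst z) - indicator (N \<inter> b) (snd z))\<^sup>2) = 0"
      by (subst (asm) nn_integral_0_iff_AE) measurable
    then show ?thesis by eventually_elim (auto simp: indicator_def split: if_splits)
  qed
  then have "AE z in J. \<forall>b\<in>\<B>. (fst z \<in> N \<inter> b) = (snd z \<in> N \<inter> b)"
    by (simp only: AE_ball_countable[OF \<B>(1)]) blast
  moreover have "AE z in J. z \<notin> diag"
  proof -
    have "diag \<in> sets (borel :: ('a \<times> 'a) measure)"
    proof -
      have "closed (diag :: ('a \<times> 'a) set)"
        using closed_Collect_eq[of "fst :: 'a \<times> 'a \<Rightarrow> 'a" snd] by (simp add: diag_def case_prod_unfold continuous_on_fst continuous_on_snd)
      then show ?thesis by simp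
    qed
    then have "diag \<in> null_sets J" using J_diag by (auto simp: null_sets_def)
    then show ?thesis by (rule AE_not_in)
  qed
  ultimately show ?thesis
  proof eventually_elim
    case (elim z)
    have ne: "fst z \<noteq> snd z" using elim(2) by (auto simp: diag_def case_prod_unfold)
    have sep: "\<exists>b\<in>\<B>. x \<in> b \<and> y \<notin> b" if "x \<noteq> y" for x y
    proof -
      have "open (- {y})" "x \<in> - {y}" using that by auto
      then obtain b where "b \<in> \<B>" "x \<in> b" "b \<subseteq> - {y}" by (rule topological_basisE[OF \<B>(2)])
      then show ?thesis by blast
    qed
    show ?case using elim(1) sep[OF ne] sep[OF ne[symmetric]] by blast
  qed
qed

text \<open>
  The marginals need not be locally finite, but they charge no set of capacity zero. Hence
  \<open>qc_version_le\<close> applies to both coordinates of a jump.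
\<close>

lemma J_marginals_in_M0: "distr J borel fst \<in> M0 m D E" "distr J borel snd \<in> M0 m D E"
proof -
  have "emeasure J (fst -` N \<inter> space J) = 0 \<and> emeasure J (snd -` N \<inter> space J) = 0"
    if N: "N \<in> sets borel" "cap m D E N = 0" for N
  proof -
    have "fst -` N \<inter> space J \<in> sets J" "snd -` N \<inter> space J \<in> sets J"
      using N(1) by (auto intro: measurable_sets)
    moreover have "AE z in J. z \<notin> fst -` N \<inter> space J" "AE z in J. z \<notin> snd -` N \<inter> space J"
      using J_polar[OF N] by auto
    ultimately have "fst -` N \<inter> space J \<in> null_sets J" "snd -` N \<inter> space J \<in> null_sets J"
      by (simp_all only: AE_iff_null_sets)
    then show ?thesis by (simp add: null_sets_def)
  qed
  then show "distr J borel fst \<in> M0 m D E" "distr J borel snd \<in> M0 m D E"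
    by (auto simp: M0_def emeasure_distr)
qed

lemma AE_J_if_M0:
  assumes "\<And>\<nu>. \<nu> \<in> M0 m D E \<Longrightarrow> AE x in \<nu>. P x" "{x. P x} \<in> sets borel"
  shows "AE z in J. P (fst z) \<and> P (snd z)"
  using assms(1)[OF J_marginals_in_M0(1)] assms(1)[OF J_marginals_in_M0(2)] assms(2)
  by (simp add: AE_distr_iff)

end

context regular_dirichlet_space
begin

section \<open>Energy measures of lattice operations\<close>

lemma max_mem: "a \<in> D \<Longrightarrow> b \<in> D \<Longrightarrow> (\<lambda>x. max (a x) (b x)) \<in> D"
proof -
  assume ab: "a \<in> D" "b \<in> D"
  have "(\<lambda>x. b x + max 0 (a x - b x)) \<in> D"
    by (intro E.add_mem ab pos_part_mem E.diff_mem)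
  moreover have "(\<lambda>x. b x + max 0 (a x - b x)) = (\<lambda>x. max (a x) (b x))"
    by (auto simp: max_def)
  ultimately show ?thesis by simp
qed

end

context beurling_deny_space
begin

lemma mu_quad_le_E1: "A \<in> sets borel \<Longrightarrow> u \<in> D \<Longrightarrow> \<mu> u u A \<le> 1 * E1 m E u u"
  using mu_le_E[of u A] E_le_E1[of u] by simp

text \<open>
  On the open set \<open>P\<close> where \<open>b < a\<close> the maximum is \<open>a\<close>. On the complement locality is not directly
  available, since the set where \<open>a = b\<close> need not be open. There the maximum is approximated by
  \<open>b + max 0 (a - b - 1/n)\<close>, which equals \<open>b\<close> on an open neighbourhood of the complement, and
  the bound survives the limit by lower semicontinuity of \<open>\<lambda>c. \<mu> c c (A - P)\<close>.
\<close>

lemma mu_max_le: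
  assumes a: "a \<in> D" "continuous_on UNIV a" and b: "b \<in> D" "continuous_on UNIV b"
    and A: "A \<in> sets borel"
    and le: "\<And>P. P \<in> sets borel \<Longrightarrow> \<mu> a a P \<le> M P" "\<And>P. P \<in> sets borel \<Longrightarrow> \<mu> b b P \<le> M P"
    and M: "\<And>P. P \<in> sets borel \<Longrightarrow> M A = M (A \<inter> P) + M (A - P)"
  shows "\<mu> (\<lambda>x. max (a x) (b x)) (\<lambda>x. max (a x) (b x)) A \<le> M A"
proof -
  let ?c = "\<lambda>x. max (a x) (b x)"
  define P where "P = {x. b x < a x}"
  have Po: "open P" unfolding P_def using a(2) b(2) by (intro open_Collect_less)
  have P: "P \<in> sets borel" using Po by simp
  have c: "?c \<in> D" using a(1) b(1) by (rule max_mem)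
  have "\<mu> ?c ?c (A \<inter> P) = \<mu> a a (A \<inter> P)"
    by (rule mu_local_quad[OF c a(1) Po]) (use A P in \<open>auto simp: P_def max_def\<close>)
  also have "\<dots> \<le> M (A \<inter> P)" using A P by (intro le) auto
  finally have 1: "\<mu> ?c ?c (A \<inter> P) \<le> M (A \<inter> P)" .
  have AP: "A - P \<in> sets borel" using A P by auto
  let ?t = "\<lambda>n x. max 0 ((a x - b x) - inverse (real (Suc n)))"
  let ?f = "\<lambda>n x. b x + ?t n x"
  have ab: "(\<lambda>x. a x - b x) \<in> D" using a(1) b(1) by (rule E.diff_mem)
  have t: "?t n \<in> D" for n by (rule trunc_mem[OF _ ab]) simp
  have f: "?f n \<in> D" for n by (rule E.add_mem[OF b(1) t])
  have "\<mu> ?c ?c (A - P) \<le> M (A - P)"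
  proof (rule quad_lower_semicontinuous(2)[OF mu_psd[OF AP] mu_quad_le_E1[OF AP] D_L2[OF c] f])
    show "E (?f n) (?f n) \<le> 2 * E b b + 2 * E (\<lambda>x. a x - b x) (\<lambda>x. a x - b x)" for n
      using E.quad_add_le[OF b(1) t[of n]] E_trunc[OF _ ab, of "inverse (real (Suc n))"] by simp
    show "\<mu> (?f n) (?f n) (A - P) \<le> M (A - P)" for n
    proof -
      let ?G = "{x. a x < b x + inverse (real (Suc n))}"
      have G: "open ?G" using a(2) b(2) by (intro open_Collect_less continuous_intros)
      have "\<mu> (?f n) (?f n) (A - P) = \<mu> b b (A - P)"
      proof (rule mu_local_quad[OF f b(1) G _ AP])
        show "A - P \<subseteq> ?G"
        proof
          fix x assume "x \<in> A - P"
          then have "a x \<le> b x" by (simp add: P_def)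
          moreover have "inverse (real (Suc n)) > 0" by simp
          ultimately show "x \<in> ?G" unfolding mem_Collect_eq by linarith
        qed
      qed (auto simp: max_def)
      then show ?thesis using le(2)[OF AP] by simp
    qed
    show "(\<lambda>n. L2_inner m (\<lambda>x. ?f n x - ?c x) (\<lambda>x. ?f n x - ?c x)) \<longlonglongrightarrow> 0"
    proof (rule L2_dominated_convergence[OF D_L2[OF ab]])
      show "?f n \<in> borel_measurable m" for n by (rule D_measurable[OF f])
      show "?c \<in> borel_measurable m" by (rule D_measurable[OF c])
      show "AE x in m. (\<lambda>n. ?f n x) \<longlonglongrightarrow> ?c x"
      proof (rule AE_I2)
        fix x
        have "(\<lambda>n. ?f n x) \<longlonglongrightarrow> b x + max 0 ((a x - b x) - 0)"
          by (intro tendsto_intros LIMSEQ_inverse_real_of_nat)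
        then show "(\<lambda>n. ?f n x) \<longlonglongrightarrow> ?c x" by (simp add: max_def split: if_splits)
      qed
      show "AE x in m. \<bar>?f n x - ?c x\<bar> \<le> \<bar>a x - b x\<bar>" for n
      proof (rule AE_I2)
        fix x
        have "inverse (real (Suc n)) > 0" by simp
        then show "\<bar>?f n x - ?c x\<bar> \<le> \<bar>a x - b x\<bar>" by (smt (verit))
      qed
    qed
  qed
  then show ?thesis using 1 M[OF P] mu_split[OF c A P] by simp
qed

text \<open>
  The jump part and the killing part are compared pointwise, which is possible without exceptional
  sets for functions that are their own quasi-continuous versions. The estimate supplies the bounded
  energy that lower semicontinuity asks for.
\<close>

lemma E_le_sum_if_contraction:
  assumes f: "f \<in> D" "qc_version m D E f f" and g: "g \<in> D" "qc_version m D E g g"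
    and r: "r \<in> D" "qc_version m D E r r"
    and le: "\<And>x y. (r x - r y)\<^sup>2 \<le> (f x - f y)\<^sup>2 + (g x - g y)\<^sup>2" "\<And>x. (r x)\<^sup>2 \<le> (f x)\<^sup>2 + (g x)\<^sup>2"
    and mu: "\<mu> r r UNIV \<le> \<mu> f f UNIV + \<mu> g g UNIV"
  shows "E r r \<le> E f f + E g g"
proof -
  note i = beurling_deny_real[OF f] beurling_deny_real[OF g] beurling_deny_real[OF r]
  have "(\<integral>z. (r (fst z) - r (snd z))\<^sup>2 \<partial>J) \<le>
      (\<integral>z. (f (fst z) - f (snd z))\<^sup>2 + (g (fst z) - g (snd z))\<^sup>2 \<partial>J)"
    using i le(1) by (intro integral_mono) auto
  moreover have "(\<integral>x. (r x)\<^sup>2 \<partial>k) \<le> (\<integral>x. (f x)\<^sup>2 + (g x)\<^sup>2 \<partial>k)"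
    using i le(2) by (intro integral_mono) auto
  ultimately show ?thesis using i mu by simp
qed

text \<open>
  The maxima \<open>r n\<close> of finitely many functions \<open>\<alpha> f + \<beta> g\<close> with \<open>\<alpha>\<^sup>2 + \<beta>\<^sup>2 \<le> 1\<close> increase to
  \<open>sqrt (f\<^sup>2 + g\<^sup>2)\<close>. Each of the functions has energy measure at most \<open>M = \<mu> f f + \<mu> g g\<close>
  because the rotated function \<open>\<beta> f - \<alpha> g\<close> takes the rest, and \<open>mu_max_le\<close> carries the bound
  by \<open>M\<close> to the maxima and, through lower semicontinuity, to their limit. The induction has to be on the bound for all Borel sets, since
  \<open>mu_max_le\<close> cuts the set into pieces.
\<close>

lemma mu_sqrt_sum_le_Cc:
  assumes f: "f \<in> D \<inter> Cc" and g: "g \<in> D \<inter> Cc"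
  defines "R \<equiv> \<lambda>x. sqrt ((f x)\<^sup>2 + (g x)\<^sup>2)"
  shows "R \<in> D" "E R R \<le> E f f + E g g" "\<mu> R R UNIV \<le> \<mu> f f UNIV + \<mu> g g UNIV"
proof -
  have fD: "f \<in> D" and gD: "g \<in> D" and fc: "continuous_on UNIV f" and gc: "continuous_on UNIV g"
    using f g by (auto simp: Cc_def)
  obtain \<alpha> \<beta> :: "nat \<Rightarrow> real" where ball: "\<And>n. (\<alpha> n)\<^sup>2 + (\<beta> n)\<^sup>2 \<le> 1"
    and dense: "\<And>s t e. e > 0 \<Longrightarrow> \<exists>n. sqrt (s\<^sup>2 + t\<^sup>2) - e < \<alpha> n * s + \<beta> n * t"
    using dense_unit_ball by metis
  define l where "l = (\<lambda>n x. \<alpha> n * f x + \<beta> n * g x)"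
  define r where "r = rec_nat (\<lambda>x. 0) (\<lambda>n p x. max (p x) (l n x))"
  have r0: "r 0 = (\<lambda>x. 0)" and rS: "r (Suc n) = (\<lambda>x. max (r n x) (l n x))" for n
    by (auto simp: r_def)
  have lD: "l n \<in> D" for n unfolding l_def using fD gD by (rule E.comb_mem)
  have lc: "continuous_on UNIV (l n)" for n unfolding l_def by (intro continuous_intros fc gc)
  have rD: "r n \<in> D" and rc: "continuous_on UNIV (r n)" for n
    by (induction n) (auto simp: r0 rS zero_mem lD max_mem intro!: continuous_intros lc)
  define M where "M = (\<lambda>A. \<mu> f f A + \<mu> g g A)"
  have Ms: "A \<in> sets borel \<Longrightarrow> P \<in> sets borel \<Longrightarrow> M A = M (A \<inter> P) + M (A - P)" for A P
    using mu_split[OF fD, of A P] mu_split[OF gD, of A P] by (simp add: M_def)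
  have M0: "0 \<le> M A" if "A \<in> sets borel" for A using that by (simp add: M_def mu_nonneg fD gD)
  have lM: "\<mu> (l n) (l n) A \<le> M A" if A: "A \<in> sets borel" for n A
  proof -
    interpret MA: psd_form D "\<lambda>u v. \<mu> u v A" by (rule mu_psd[OF A])
    have "\<mu> (l n) (l n) A + \<mu> (\<lambda>x. \<beta> n * f x + - \<alpha> n * g x) (\<lambda>x. \<beta> n * f x + - \<alpha> n * g x) A
      = ((\<alpha> n)\<^sup>2 + (\<beta> n)\<^sup>2) * M A"
      unfolding l_def MA.quad_comb[OF fD gD] by (simp add: M_def algebra_simps)
    moreover have "\<mu> (\<lambda>x. \<beta> n * f x + - \<alpha> n * g x) (\<lambda>x. \<beta> n * f x + - \<alpha> n * g x) A \<ge> 0"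
      by (intro MA.nonneg MA.comb_mem fD gD)
    moreover have "((\<alpha> n)\<^sup>2 + (\<beta> n)\<^sup>2) * M A \<le> 1 * M A"
      using ball M0[OF A] by (intro mult_right_mono)
    ultimately show ?thesis by linarith
  qed
  have rM: "\<mu> (r n) (r n) A \<le> M A" if "A \<in> sets borel" for n A
    using that
  proof (induction n arbitrary: A)
    case 0
    interpret MA: psd_form D "\<lambda>u v. \<mu> u v A" by (rule mu_psd[OF 0])
    show ?case using MA.quad_scale[OF zero_mem, of 0] M0[OF 0] by (simp add: r0)
  next
    case (Suc n)
    show ?case
      unfolding rS by (rule mu_max_le[OF rD rc lD lc Suc.prems Suc.IH lM Ms[OF Suc.prems]])
  qed
  have l_diff: "\<bar>l n x - l n y\<bar> \<le> sqrt ((f x - f y)\<^sup>2 + (g x - g y)\<^sup>2)" for n x y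
    using abs_comb_le_sqrt[OF ball, of n "f x - f y" "g x - g y"] by (simp add: l_def algebra_simps)
  have l_le: "\<bar>l n x\<bar> \<le> R x" for n x
    unfolding l_def R_def by (rule abs_comb_le_sqrt[OF ball])
  have R0: "R x \<ge> 0" for x by (simp add: R_def)
  have r_diff: "\<bar>r n x - r n y\<bar> \<le> sqrt ((f x - f y)\<^sup>2 + (g x - g y)\<^sup>2)" for n x y
  proof (induction n)
    case (Suc n)
    then show ?case using l_diff[of n x y] unfolding rS by linarith
  qed (simp add: r0)
  have r_nn: "0 \<le> r n x" and r_le: "r n x \<le> R x" for n x
    by (induction n) (use R0 l_le in \<open>auto simp: r0 rS abs_le_iff le_max_iff_disj\<close>)
  have r_E: "E (r n) (r n) \<le> E f f + E g g" for n
  proof (rule E_le_sum_if_contraction[OF fD _ gD _ rD])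
    show "(r n x - r n y)\<^sup>2 \<le> (f x - f y)\<^sup>2 + (g x - g y)\<^sup>2" for x y
      using power_mono[OF r_diff[of n x y], of 2] by simp
    show "(r n x)\<^sup>2 \<le> (f x)\<^sup>2 + (g x)\<^sup>2" for x
      using power_mono[OF r_le[of n x] r_nn, of 2] by (simp add: R_def)
    show "\<mu> (r n) (r n) UNIV \<le> \<mu> f f UNIV + \<mu> g g UNIV"
      using rM[of UNIV n] by (simp add: M_def)
  qed (intro qc_version_continuous fc gc rc)+
  have r_lim: "(\<lambda>n. r n x) \<longlonglongrightarrow> R x" for x
  proof (rule increasing_LIMSEQ)
    show "r n x \<le> r (Suc n) x" for n by (simp add: rS)
    show "r n x \<le> R x" for n by (rule r_le)
    fix e :: real assume "e > 0"
    then obtain n where "R x - e < l n x" using dense[of e "f x" "g x"] by (auto simp: R_def l_def)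
    then show "\<exists>n. R x \<le> r n x + e" by (intro exI[of _ "Suc n"]) (simp add: rS)
  qed
  have RL: "R \<in> L2 m"
  proof (rule L2_dominated)
    show "(\<lambda>x. \<bar>f x\<bar> + \<bar>g x\<bar>) \<in> L2 m" by (intro D_L2 E.add_mem abs_mem fD gD)
    show "R \<in> borel_measurable m"
      unfolding R_def using D_measurable[OF fD] D_measurable[OF gD] by simp
    show "AE x in m. \<bar>R x\<bar> \<le> \<bar>\<bar>f x\<bar> + \<bar>g x\<bar>\<bar>"
      using sqrt_sum_squares_le_sum_abs by (simp add: R_def)
  qed
  have L: "(\<lambda>n. L2_inner m (\<lambda>x. r n x - R x) (\<lambda>x. r n x - R x)) \<longlonglongrightarrow> 0"
  proof (rule L2_dominated_convergence[OF RL])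
    show "AE x in m. \<bar>r n x - R x\<bar> \<le> \<bar>R x\<bar>" for n
    proof (rule AE_I2)
      fix x show "\<bar>r n x - R x\<bar> \<le> \<bar>R x\<bar>" using r_nn[of n x] r_le[of n x] by linarith
    qed
  qed (use r_lim D_measurable[OF rD] RL in \<open>auto simp: L2_def\<close>)
  show "R \<in> D"
    by (rule quad_lower_semicontinuous(1)[OF E.psd_form_axioms _ RL rD r_E r_E L, of 1]) (simp add: E_le_E1)
  show "E R R \<le> E f f + E g g"
    by (rule quad_lower_semicontinuous(2)[OF E.psd_form_axioms _ RL rD r_E r_E L, of 1]) (simp add: E_le_E1)
  have u: "UNIV \<in> sets (borel :: 'a measure)" by simp
  have "\<mu> (r n) (r n) UNIV \<le> \<mu> f f UNIV + \<mu> g g UNIV" for n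
    using rM[OF u, of n] by (simp add: M_def)
  from quad_lower_semicontinuous(2)[OF mu_psd[OF u] mu_quad_le_E1[OF u] RL rD r_E this L]
  show "\<mu> R R UNIV \<le> \<mu> f f UNIV + \<mu> g g UNIV" .
qed

text \<open>
  The reduction to continuous functions: \<open>sqrt (f\<^sup>2 + g\<^sup>2)\<close> depends continuously in \<open>L\<^sup>2\<close> on
  \<open>f\<close> and \<open>g\<close>, and the energies of the approximants are bounded, so lower semicontinuity applies.
\<close>

lemma mu_sqrt_sum_le:
  assumes f: "f \<in> D" and g: "g \<in> D"
  defines "R \<equiv> \<lambda>x. sqrt ((f x)\<^sup>2 + (g x)\<^sup>2)"
  shows "R \<in> D" "\<mu> R R UNIV \<le> \<mu> f f UNIV + \<mu> g g UNIV"
proof -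
  have dec: "decseq (\<lambda>n. inverse (real (Suc n)))" by (intro decseq_SucI) (simp add: field_simps)
  have approx: "\<exists>w :: nat \<Rightarrow> 'a \<Rightarrow> real. (\<forall>n. w n \<in> D \<inter> Cc) \<and>
      (\<lambda>n. E1 m E (\<lambda>x. w n x - u x) (\<lambda>x. w n x - u x)) \<longlonglongrightarrow> 0" if u: "u \<in> D" for u
  proof -
    obtain w :: "nat \<Rightarrow> 'a \<Rightarrow> real" where w: "\<And>n. w n \<in> D \<inter> Cc"
      "\<And>n. E1 m E (\<lambda>x. u x - w n x) (\<lambda>x. u x - w n x) < inverse (real (Suc n))"
      using Cc_approx[OF u _ dec] by auto
    have wD: "w n \<in> D" for n using w(1) by blast
    have "(\<lambda>n. E1 m E (\<lambda>x. w n x - u x) (\<lambda>x. w n x - u x)) \<longlonglongrightarrow> 0"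
    proof (rule tendsto_sandwich[OF _ _ tendsto_const LIMSEQ_inverse_real_of_nat])
      show "\<forall>\<^sub>F n in sequentially. 0 \<le> E1 m E (\<lambda>x. w n x - u x) (\<lambda>x. w n x - u x)"
        by (intro always_eventually allI Q.nonneg E.diff_mem wD u)
      show "\<forall>\<^sub>F n in sequentially. E1 m E (\<lambda>x. w n x - u x) (\<lambda>x. w n x - u x) \<le> inverse (real (Suc n))"
        using w(2) by (intro always_eventually allI) (simp only: Q.quad_diff_commute[OF wD u] less_imp_le)
    qed
    then show ?thesis using w(1) by blast
  qed
  obtain a :: "nat \<Rightarrow> 'a \<Rightarrow> real" where a: "\<And>n. a n \<in> D \<inter> Cc"
    "(\<lambda>n. E1 m E (\<lambda>x. a n x - f x) (\<lambda>x. a n x - f x)) \<longlonglongrightarrow> 0" using approx[OF f] by blast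
  obtain b :: "nat \<Rightarrow> 'a \<Rightarrow> real" where b: "\<And>n. b n \<in> D \<inter> Cc"
    "(\<lambda>n. E1 m E (\<lambda>x. b n x - g x) (\<lambda>x. b n x - g x)) \<longlonglongrightarrow> 0" using approx[OF g] by blast
  have aD: "a n \<in> D" and bD: "b n \<in> D" for n using a(1) b(1) by auto
  note la = E_tendsto[of a, OF aD f a(2)] and lb = E_tendsto[of b, OF bD g b(2)]
  define r where "r = (\<lambda>n x. sqrt ((a n x)\<^sup>2 + (b n x)\<^sup>2))"
  have r': "r n \<in> D" "E (r n) (r n) \<le> E (a n) (a n) + E (b n) (b n)"
    "\<mu> (r n) (r n) UNIV \<le> \<mu> (a n) (a n) UNIV + \<mu> (b n) (b n) UNIV" for n
    using mu_sqrt_sum_le_Cc[OF a(1)[of n] b(1)[of n]] by (simp_all add: r_def)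
  have RL: "R \<in> L2 m"
  proof (rule L2_dominated)
    show "(\<lambda>x. \<bar>f x\<bar> + \<bar>g x\<bar>) \<in> L2 m" by (intro D_L2 E.add_mem abs_mem f g)
    show "R \<in> borel_measurable m"
      unfolding R_def using D_measurable[OF f] D_measurable[OF g] by simp
    show "AE x in m. \<bar>R x\<bar> \<le> \<bar>\<bar>f x\<bar> + \<bar>g x\<bar>\<bar>"
      using sqrt_sum_squares_le_sum_abs by (simp add: R_def)
  qed
  have L: "(\<lambda>n. L2_inner m (\<lambda>x. r n x - R x) (\<lambda>x. r n x - R x)) \<longlonglongrightarrow> 0"
  proof (rule tendsto_sandwich[OF _ _ tendsto_const])
    let ?p = "\<lambda>n x. \<bar>a n x - f x\<bar>" and ?q = "\<lambda>n x. \<bar>b n x - g x\<bar>"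
    have pD: "?p n \<in> D" and qD: "?q n \<in> D" for n by (intro abs_mem E.diff_mem aD bD f g)+
    have "L2_inner m (\<lambda>x. r n x - R x) (\<lambda>x. r n x - R x) \<le>
       2 * L2_inner m (\<lambda>x. a n x - f x) (\<lambda>x. a n x - f x) + 2 * L2_inner m (\<lambda>x. b n x - g x) (\<lambda>x. b n x - g x)" for n
    proof -
      have "L2_inner m (\<lambda>x. r n x - R x) (\<lambda>x. r n x - R x) \<le>
          L2_inner m (\<lambda>x. ?p n x + ?q n x) (\<lambda>x. ?p n x + ?q n x)"
      proof (rule L2_inner_mono[OF D_L2[OF E.add_mem[OF pD qD]]], rule AE_I2)
        fix x
        have "\<bar>r n x - R x\<bar> \<le> sqrt ((a n x - f x)\<^sup>2 + (b n x - g x)\<^sup>2)"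
          unfolding r_def R_def by (rule sqrt_sum_squares_diff_le)
        also have "\<dots> \<le> ?p n x + ?q n x" by (rule sqrt_sum_squares_le_sum_abs)
        finally show "\<bar>r n x - R x\<bar> \<le> \<bar>?p n x + ?q n x\<bar>" by simp
      qed
      also have "\<dots> \<le> 2 * L2_inner m (?p n) (?p n) + 2 * L2_inner m (?q n) (?q n)"
        by (rule L.quad_add_le[OF D_L2[OF pD] D_L2[OF qD]])
      finally show ?thesis by (simp add: L2_inner_def)
    qed
    then show "\<forall>\<^sub>F n in sequentially. L2_inner m (\<lambda>x. r n x - R x) (\<lambda>x. r n x - R x) \<le>
       2 * L2_inner m (\<lambda>x. a n x - f x) (\<lambda>x. a n x - f x) + 2 * L2_inner m (\<lambda>x. b n x - g x) (\<lambda>x. b n x - g x)"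
      by (intro always_eventually allI)
    show "(\<lambda>n. 2 * L2_inner m (\<lambda>x. a n x - f x) (\<lambda>x. a n x - f x) +
        2 * L2_inner m (\<lambda>x. b n x - g x) (\<lambda>x. b n x - g x)) \<longlonglongrightarrow> 0"
      using tendsto_add[OF tendsto_mult_left[OF la(2), of 2] tendsto_mult_left[OF lb(2), of 2]] by simp
    show "\<forall>\<^sub>F n in sequentially. 0 \<le> L2_inner m (\<lambda>x. r n x - R x) (\<lambda>x. r n x - R x)"
      by (intro always_eventually allI L.nonneg L.diff_mem D_L2[OF r'(1)] RL)
  qed
  have u: "UNIV \<in> sets (borel :: 'a measure)" by simp
  interpret MU: psd_form D "\<lambda>u v. \<mu> u v UNIV" by (rule mu_psd[OF u])
  have mlim: "(\<lambda>n. \<mu> (c n) (c n) UNIV) \<longlonglongrightarrow> \<mu> h h UNIV"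
    if c: "\<And>n. c n \<in> D" and h: "h \<in> D" and l: "(\<lambda>n. E (\<lambda>x. c n x - h x) (\<lambda>x. c n x - h x)) \<longlonglongrightarrow> 0"
    for c :: "nat \<Rightarrow> 'a \<Rightarrow> real" and h
  proof (rule MU.tendsto_quad[of c, OF c h])
    show "(\<lambda>n. \<mu> (\<lambda>x. c n x - h x) (\<lambda>x. c n x - h x) UNIV) \<longlonglongrightarrow> 0"
      by (rule tendsto_sandwich[OF _ _ tendsto_const l])
        (auto intro!: always_eventually MU.nonneg mu_le_E E.diff_mem c h)
  qed
  have key: "R \<in> D \<and> \<mu> R R UNIV \<le> s" if s: "s > \<mu> f f UNIV + \<mu> g g UNIV" for s
  proof -
    have "\<forall>\<^sub>F n in sequentially. \<mu> (a n) (a n) UNIV + \<mu> (b n) (b n) UNIV < s"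
      using order_tendstoD(2)[OF tendsto_add[OF mlim[OF aD f la(1)] mlim[OF bD g lb(1)]] s] .
    moreover have "(\<lambda>n. E (a n) (a n) + E (b n) (b n)) \<longlonglongrightarrow> E f f + E g g"
      by (intro tendsto_add E.tendsto_quad[of a, OF aD f la(1)] E.tendsto_quad[of b, OF bD g lb(1)])
    then have "\<forall>\<^sub>F n in sequentially. E (a n) (a n) + E (b n) (b n) < E f f + E g g + 1"
      by (rule order_tendstoD(2)) simp
    ultimately have "\<forall>\<^sub>F n in sequentially. \<mu> (r n) (r n) UNIV \<le> s \<and> E (r n) (r n) \<le> E f f + E g g + 1"
      by eventually_elim (use r' in \<open>smt (verit)\<close>)
    then obtain N where N: "\<And>n. n \<ge> N \<Longrightarrow> \<mu> (r n) (r n) UNIV \<le> s"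
      "\<And>n. n \<ge> N \<Longrightarrow> E (r n) (r n) \<le> E f f + E g g + 1" by (auto simp: eventually_sequentially)
    define t where "t = (\<lambda>n. r (n + N))"
    have t: "t n \<in> D" "E (t n) (t n) \<le> E f f + E g g + 1" "\<mu> (t n) (t n) UNIV \<le> s" for n
      using r'(1)[of "n + N"] N(2)[of "n + N"] N(1)[of "n + N"] by (simp_all add: t_def)
    have L': "(\<lambda>n. L2_inner m (\<lambda>x. t n x - R x) (\<lambda>x. t n x - R x)) \<longlonglongrightarrow> 0"
      unfolding t_def by (rule LIMSEQ_ignore_initial_segment[OF L])
    have "R \<in> D" by (rule quad_lower_semicontinuous(1)[OF mu_psd[OF u] mu_quad_le_E1[OF u] RL t L'])
    moreover have "\<mu> R R UNIV \<le> s"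
      by (rule quad_lower_semicontinuous(2)[OF mu_psd[OF u] mu_quad_le_E1[OF u] RL t L'])
    ultimately show ?thesis ..
  qed
  show "R \<in> D" using key[of "\<mu> f f UNIV + \<mu> g g UNIV + 1"] by simp
  show "\<mu> R R UNIV \<le> \<mu> f f UNIV + \<mu> g g UNIV"
  proof (rule dense_ge)
    fix s assume "\<mu> f f UNIV + \<mu> g g UNIV < s"
    from key[OF this] show "\<mu> R R UNIV \<le> s" ..
  qed
qed

end

section \<open>The Picone inequality\<close>

lemma closed_supp: "closed (supp M u)"
proof -
  have "- supp M u = \<Union>{G. open G \<and> (AE y in M. y \<in> G \<longrightarrow> u y = 0)}"
    by (auto simp: supp_def)
  moreover have "open (\<Union>{G. open G \<and> (AE y in M. y \<in> G \<longrightarrow> u y = 0)})" by (rule open_Union) blast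
  ultimately show ?thesis by (simp add: closed_def)
qed

lemma AE_zero_off_supp:
  fixes M :: "'a::second_countable_topology measure"
  shows "AE x in M. x \<notin> supp M u \<longrightarrow> u x = 0"
proof -
  let ?F = "{G. open G \<and> (AE y in M. y \<in> G \<longrightarrow> u y = 0)}"
  obtain F where F: "F \<subseteq> ?F" "countable F" "\<Union>F = \<Union>?F"
    using Lindelof[of ?F] by blast
  have "AE x in M. \<forall>G\<in>F. x \<in> G \<longrightarrow> u x = 0"
    using F(1) by (simp only: AE_ball_countable[OF F(2)]) blast
  then show ?thesis
  proof eventually_elim
    case (elim x)
    show ?case
    proof
      assume "x \<notin> supp M u"
      then have "x \<in> \<Union>?F" unfolding supp_def by blast
      then have "x \<in> \<Union>F" using F(3) by simp
      then show "u x = 0" using elim by blast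
    qed
  qed
qed

lemma supp_subset:
  assumes "closed C" "AE x in M. x \<notin> C \<longrightarrow> u x = 0"
  shows "supp M u \<subseteq> C"
proof
  fix x assume x: "x \<in> supp M u"
  show "x \<in> C"
  proof (rule ccontr)
    assume "x \<notin> C"
    moreover have "AE y in M. y \<in> - C \<longrightarrow> u y = 0" using assms(2) by simp
    moreover have "open (- C)" using assms(1) by (rule open_Compl)
    ultimately show False using x unfolding supp_def by blast
  qed
qed

lemma compact_supp:
  fixes C :: "'a::t2_space set"
  assumes "compact C" "AE x in M. x \<notin> C \<longrightarrow> u x = 0"
  shows "compact (supp M u)"
proof -
  have "supp M u \<subseteq> C" using assms by (intro supp_subset compact_imp_closed)
  then have "C \<inter> supp M u = supp M u" by blast
  then show ?thesis using compact_Int_closed[OF assms(1) closed_supp[of M u]] by simp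
qed

text \<open>
  With \<open>w = sqrt (a\<^sup>2 + p\<^sup>2) - a\<close> one has \<open>2 a w + w\<^sup>2 = p\<^sup>2\<close>.
\<close>

lemma picone_mult:
  "2 * a * (sqrt (a\<^sup>2 + p\<^sup>2) - a) \<le> (p::real)\<^sup>2"
proof -
  have "0 \<le> (sqrt (a\<^sup>2 + p\<^sup>2) - a)\<^sup>2" by simp
  also have "\<dots> = (sqrt (a\<^sup>2 + p\<^sup>2))\<^sup>2 - 2 * a * sqrt (a\<^sup>2 + p\<^sup>2) + a\<^sup>2"
    by (simp add: power2_diff)
  also have "(sqrt (a\<^sup>2 + p\<^sup>2))\<^sup>2 = a\<^sup>2 + p\<^sup>2" by simp
  finally show ?thesis by (simp add: algebra_simps power2_eq_square)
qed

text \<open>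
  The Euclidean norms of \<open>(a, p)\<close> and \<open>(b, q)\<close> differ by at most the norm of the difference;
  expanding the square of \<open>(a - b) + (w - w')\<close> with \<open>w\<close> as in \<open>picone_mult\<close> leaves the claim.
\<close>

lemma picone_diff:
  fixes a b p q :: real
  shows "2 * ((a - b) * ((sqrt (a\<^sup>2 + p\<^sup>2) - a) - (sqrt (b\<^sup>2 + q\<^sup>2) - b))) \<le> (p - q)\<^sup>2"
proof -
  define s t where "s = sqrt (a\<^sup>2 + p\<^sup>2)" and "t = sqrt (b\<^sup>2 + q\<^sup>2)"
  have "\<bar>s - t\<bar>\<^sup>2 \<le> (sqrt ((a - b)\<^sup>2 + (p - q)\<^sup>2))\<^sup>2"
    unfolding s_def t_def by (intro power_mono sqrt_sum_squares_diff_le) simp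
  then have "(s - t)\<^sup>2 \<le> (a - b)\<^sup>2 + (p - q)\<^sup>2" by simp
  moreover have "(s - t)\<^sup>2 = (a - b)\<^sup>2 + 2 * ((a - b) * ((s - a) - (t - b))) + ((s - a) - (t - b))\<^sup>2"
    by (simp add: power2_eq_square algebra_simps)
  moreover have "0 \<le> ((s - a) - (t - b))\<^sup>2" by simp
  ultimately show ?thesis unfolding s_def[symmetric] t_def[symmetric] by linarith
qed

text \<open>
  Where \<open>a > 0\<close>, the product \<open>2 a (sqrt (a\<^sup>2 + s\<^sup>2 p\<^sup>2) - a)\<close> equals
  \<open>2 a s\<^sup>2 p\<^sup>2 / (sqrt (a\<^sup>2 + s\<^sup>2 p\<^sup>2) + a)\<close>, so after division by \<open>s\<^sup>2\<close> it tends to \<open>p\<^sup>2\<close>. By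
  \<open>picone_mult\<close> it is then also dominated by \<open>p\<^sup>2\<close>. The lemma is used for \<open>m\<close> with \<open>u\<close> itself and
  for \<open>\<nu>m\<close> with the quasi-continuous version of \<open>u\<close>.
\<close>

lemma ground_state_limit:
  fixes s :: "nat \<Rightarrow> real"
  assumes a: "a \<in> borel_measurable M" "AE x in M. 0 < a x" and p: "p \<in> L2 M"
    and s: "s \<longlonglongrightarrow> 0" "\<And>n. s n > 0"
  shows "(\<lambda>n. 2 * (\<integral>x. a x * (sqrt ((a x)\<^sup>2 + (s n * p x)\<^sup>2) - a x) \<partial>M) / (s n)\<^sup>2)
    \<longlonglongrightarrow> (\<integral>x. (p x)\<^sup>2 \<partial>M)"
proof -
  let ?g = "\<lambda>n x. 2 * (a x * (sqrt ((a x)\<^sup>2 + (s n * p x)\<^sup>2) - a x)) / (s n)\<^sup>2"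
  have pm: "p \<in> borel_measurable M" "integrable M (\<lambda>x. (p x)\<^sup>2)" using p by (auto simp: L2_def)
  have "(\<lambda>n. \<integral>x. ?g n x \<partial>M) \<longlonglongrightarrow> (\<integral>x. (p x)\<^sup>2 \<partial>M)"
  proof (rule integral_dominated_convergence[where w = "\<lambda>x. (p x)\<^sup>2"])
    show "AE x in M. (\<lambda>n. ?g n x) \<longlonglongrightarrow> (p x)\<^sup>2"
      using a(2)
    proof eventually_elim
      case (elim x)
      have eq: "?g n x = 2 * a x * (p x)\<^sup>2 / (sqrt ((a x)\<^sup>2 + (s n * p x)\<^sup>2) + a x)" for n
      proof -
        define r where "r = sqrt ((a x)\<^sup>2 + (s n * p x)\<^sup>2)"
        have "r \<ge> 0" "r\<^sup>2 = (a x)\<^sup>2 + (s n * p x)\<^sup>2" by (simp_all add: r_def)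
        then have "(r - a x) * (r + a x) = (s n)\<^sup>2 * (p x)\<^sup>2"
          by (simp add: power2_eq_square algebra_simps)
        moreover have "r + a x > 0" using \<open>r \<ge> 0\<close> elim by simp
        ultimately have "r - a x = (s n)\<^sup>2 * (p x)\<^sup>2 / (r + a x)" by (simp add: field_simps)
        then show ?thesis using s(2)[of n] unfolding r_def[symmetric] by simp
      qed
      have "(\<lambda>n. 2 * a x * (p x)\<^sup>2 / (sqrt ((a x)\<^sup>2 + (s n * p x)\<^sup>2) + a x))
        \<longlonglongrightarrow> 2 * a x * (p x)\<^sup>2 / (sqrt ((a x)\<^sup>2 + (0 * p x)\<^sup>2) + a x)"
        using elim by (intro tendsto_intros s(1)) auto
      then show ?case unfolding eq using elim by simp
    qed
    show "AE x in M. norm (?g n x) \<le> (p x)\<^sup>2" for n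
      using a(2)
    proof eventually_elim
      case (elim x)
      have "sqrt ((a x)\<^sup>2) \<le> sqrt ((a x)\<^sup>2 + (s n * p x)\<^sup>2)" by simp
      then have "0 \<le> ?g n x" using elim by simp
      moreover have "2 * (a x * (sqrt ((a x)\<^sup>2 + (s n * p x)\<^sup>2) - a x)) \<le> (s n)\<^sup>2 * (p x)\<^sup>2"
        using picone_mult[of "a x" "s n * p x"] by (simp add: power_mult_distrib mult.assoc)
      then have "?g n x \<le> (p x)\<^sup>2" using s(2)[of n] by (simp add: field_simps)
      ultimately show ?case by simp
    qed
  qed (use pm a(1) in auto)
  then show ?thesis by (simp add: mult.assoc)
qed

context beurling_deny_space
begin

lemma meas_form_psd:
  assumes \<nu>: "\<nu> \<in> M0 m D E" and L2: "\<And>u. u \<in> D \<Longrightarrow> qc m D E u \<in> L2 \<nu>"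
  shows "psd_form D (meas_form m D E \<nu>)"
proof -
  interpret N: psd_form "L2 \<nu>" "L2_inner \<nu>" by (rule L2_psd_form)
  have mf: "meas_form m D E \<nu> u v = L2_inner \<nu> (qc m D E u) (qc m D E v)" for u v
    by (simp add: meas_form_def L2_inner_def)
  have comb: "AE x in \<nu>. qc m D E (\<lambda>x. a * u x + b * v x) x = a * qc m D E u x + b * qc m D E v x"
    if "u \<in> D" "v \<in> D" for a b u v
  proof -
    have c: "continuous_on UNIV (\<lambda>p :: real \<times> real. a * fst p + b * snd p)" by (intro continuous_intros)
    have "qc_version m D E (\<lambda>x. a * u x + b * v x) (\<lambda>x. a * qc m D E u x + b * qc m D E v x)"
      using qc_version_compose[OF qc_version_D[OF that(1)] qc_version_D[OF that(2)] c] by simp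
    from qc_version_cong[OF \<nu> qc_version_D[OF E.comb_mem[OF that]] this] show ?thesis by simp
  qed
  have comb': "meas_form m D E \<nu> (\<lambda>x. a * u x + b * v x) w =
      a * meas_form m D E \<nu> u w + b * meas_form m D E \<nu> v w"
    if "u \<in> D" "v \<in> D" "w \<in> D" for a b u v w
  proof -
    have "meas_form m D E \<nu> (\<lambda>x. a * u x + b * v x) w =
        L2_inner \<nu> (\<lambda>x. a * qc m D E u x + b * qc m D E v x) (qc m D E w)"
      unfolding mf L2_inner_def
    proof (rule integral_cong_AE)
      show "AE x in \<nu>. qc m D E (\<lambda>x. a * u x + b * v x) x * qc m D E w x =
          (a * qc m D E u x + b * qc m D E v x) * qc m D E w x"
        using comb[OF that(1,2), of a b] by eventually_elim simp
      have [measurable]: "qc m D E u \<in> borel_measurable \<nu>" if "u \<in> D" for u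
        using L2[OF that] by (simp add: L2_def)
      show "(\<lambda>x. qc m D E (\<lambda>x. a * u x + b * v x) x * qc m D E w x) \<in> borel_measurable \<nu>"
        "(\<lambda>x. (a * qc m D E u x + b * qc m D E v x) * qc m D E w x) \<in> borel_measurable \<nu>"
        using that E.comb_mem[OF that(1,2)] by measurable
    qed
    also have "\<dots> = a * meas_form m D E \<nu> u w + b * meas_form m D E \<nu> v w"
      unfolding mf by (rule N.comb_left) (intro L2 that)+
    finally show ?thesis .
  qed
  show ?thesis
  proof
    show "\<And>u v. u \<in> D \<Longrightarrow> v \<in> D \<Longrightarrow> meas_form m D E \<nu> u v = meas_form m D E \<nu> v u"
      unfolding mf by (intro N.sym L2)
    show "\<And>u v w. u \<in> D \<Longrightarrow> v \<in> D \<Longrightarrow> w \<in> D \<Longrightarrow>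
      meas_form m D E \<nu> (\<lambda>x. u x + v x) w = meas_form m D E \<nu> u w + meas_form m D E \<nu> v w"
      using comb'[of _ _ _ 1 1] by simp
    show "\<And>u w c. u \<in> D \<Longrightarrow> w \<in> D \<Longrightarrow>
      meas_form m D E \<nu> (\<lambda>x. c * u x) w = c * meas_form m D E \<nu> u w"
      using comb'[of u u w c 0 for u w c] by simp
    show "\<And>u. u \<in> D \<Longrightarrow> 0 \<le> meas_form m D E \<nu> u u" unfolding mf by (intro N.nonneg L2)
  qed (simp_all add: E.add_mem E.scale_mem)
qed

lemma qc_abs_le:
  assumes \<nu>: "\<nu> \<in> M0 m D E" and w: "w \<in> D" and f: "f \<in> D" and le: "AE x in m. \<bar>w x\<bar> \<le> \<bar>f x\<bar>"
  shows "AE x in \<nu>. \<bar>qc m D E w x\<bar> \<le> \<bar>qc m D E f x\<bar>"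
proof -
  have c: "continuous_on UNIV (\<lambda>p :: real \<times> real. \<bar>fst p\<bar>)" by (intro continuous_intros)
  have "qc_version m D E (\<lambda>x. \<bar>u x\<bar>) (\<lambda>x. \<bar>qc m D E u x\<bar>)" if "u \<in> D" for u
    using qc_version_compose[OF qc_version_D[OF that] qc_version_D[OF that] c] by simp
  from qc_version_le[OF \<nu> this[OF w] this[OF f] le] show ?thesis .
qed

text \<open>
  The functions that the proof constructs from an element \<open>f\<close> of the domain of \<open>h\<close> (test functions
  and cut-offs) are all bounded by \<open>\<bar>f\<bar>\<close>; this is what keeps them in the domain of \<open>\<nu>p\<close>.
\<close>

lemma dom_meas_dominated:
  assumes \<nu>: "\<nu> \<in> M0 m D E" and w: "w \<in> D" and f: "f \<in> dom_meas m D E \<nu>"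
    and le: "AE x in m. \<bar>w x\<bar> \<le> \<bar>f x\<bar>"
  shows "w \<in> dom_meas m D E \<nu>" "meas_form m D E \<nu> w w \<le> meas_form m D E \<nu> f f"
proof -
  have f': "f \<in> D" "qc m D E f \<in> L2 \<nu>" using f by (auto simp: dom_meas_def)
  note ae = qc_abs_le[OF \<nu> w f'(1) le]
  have "qc m D E w \<in> borel_measurable \<nu>"
    using qc_version_D[OF w] \<nu> by (simp add: qc_version_def M0_def cong: measurable_cong_sets)
  then have "qc m D E w \<in> L2 \<nu>" using L2_dominated[OF f'(2) _ ae] by blast
  then show "w \<in> dom_meas m D E \<nu>" using w by (simp add: dom_meas_def)
  show "meas_form m D E \<nu> w w \<le> meas_form m D E \<nu> f f"
    using L2_inner_mono[OF f'(2) ae] by (simp add: meas_form_def L2_inner_def)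
qed

text \<open>
  Near the support of \<open>f\<close>, \<open>u\<close> agrees with some \<open>U\<close> in \<open>D\<close>, and \<open>U\<close> may be taken nonnegative.
  Then \<open>W\<close> agrees with \<open>sqrt (U\<^sup>2 + f\<^sup>2) - U\<close> almost everywhere, as both vanish where \<open>f\<close> does; this is
  where \<open>u \<ge> 0\<close> is used. For the local part \<open>u\<close> can be replaced by \<open>U\<close> and \<open>mu_sqrt_sum_le\<close>
  gives the inequality. The jump part sees \<open>u\<close> far away from the support of \<open>f\<close>, but there
  the inequality is pointwise and uses \<open>u\<close> itself.
\<close>

lemma picone_test_function:
  assumes lc: "locally compact (UNIV :: 'a set)"
    and u: "u \<in> D_loc m D" and u0: "AE x in m. 0 \<le> u x"
    and f: "f \<in> D" and fs: "compact (supp m f)"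
  defines "W \<equiv> \<lambda>x. sqrt ((u x)\<^sup>2 + (f x)\<^sup>2) - u x"
  shows "W \<in> D" "compact (supp m W)"
    "qc_version m D E W (\<lambda>x. sqrt ((qc m D E u x)\<^sup>2 + (qc m D E f x)\<^sup>2) - qc m D E u x)"
    "2 * E_ext m D E J \<mu> k u W \<le> E f f"
proof -
  let ?u = "qc m D E u" and ?f = "qc m D E f" and ?W = "qc m D E W"
  note qu = qc_version_qc[OF qc_version_exists_loc[OF lc u]] and qf = qc_version_D[OF f]
  have f_off: "AE x in m. x \<notin> supp m f \<longrightarrow> f x = 0" by (rule AE_zero_off_supp)
  have um: "u \<in> borel_measurable m" using u by (simp add: D_loc_def L2_loc_def)
  obtain G where G: "open G" "compact (closure G)" "supp m f \<subseteq> G"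
    using compact_subset_open_compact_closure[OF lc fs] by blast
  obtain U0 where U0: "U0 \<in> D" "AE x in m. x \<in> G \<longrightarrow> u x = U0 x"
    using u G(1,2) unfolding D_loc_def by blast
  define U where "U = (\<lambda>x. \<bar>U0 x\<bar>)"
  have U: "U \<in> D" unfolding U_def by (rule abs_mem[OF U0(1)])
  have uU: "AE x in m. x \<in> G \<longrightarrow> u x = U x"
    using U0(2) u0 by eventually_elim (auto simp: U_def)
  define R where "R = (\<lambda>x. sqrt ((U x)\<^sup>2 + (f x)\<^sup>2))"
  have R: "R \<in> D" and muR: "\<mu> R R UNIV \<le> \<mu> U U UNIV + \<mu> f f UNIV"
    unfolding R_def using mu_sqrt_sum_le[OF U f] by auto
  have WR: "AE x in m. R x - U x = W x"
    using uU f_off u0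
  proof eventually_elim
    case (elim x)
    show ?case
    proof (cases "x \<in> G")
      case True
      then show ?thesis using elim(1) by (simp add: R_def W_def)
    next
      case False
      then have "f x = 0" using elim(2) G(3) by blast
      then show ?thesis using elim(3) by (simp add: R_def W_def U_def)
    qed
  qed
  have Wm: "W \<in> borel_measurable m" unfolding W_def using um D_measurable[OF f] by simp
  show W: "W \<in> D" by (rule D_cong_AE[OF E.diff_mem[OF R U] Wm WR])
  have W_off: "AE x in m. x \<notin> supp m f \<longrightarrow> W x = 0"
    using f_off u0 by eventually_elim (simp add: W_def)
  show "compact (supp m W)" by (rule compact_supp[OF fs W_off])
  have Wf: "supp m W \<subseteq> supp m f" by (rule supp_subset[OF closed_supp W_off])
  have H: "continuous_on UNIV (\<lambda>p :: real \<times> real. sqrt ((fst p)\<^sup>2 + (snd p)\<^sup>2) - fst p)"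
    by (intro continuous_intros)
  show qW: "qc_version m D E W (\<lambda>x. sqrt ((?u x)\<^sup>2 + (?f x)\<^sup>2) - ?u x)"
    using qc_version_compose[OF qu qf H] by (simp add: W_def)
  let ?P = "\<lambda>x. ?W x = sqrt ((?u x)\<^sup>2 + (?f x)\<^sup>2) - ?u x"
  have P: "AE x in \<nu>. ?P x" if "\<nu> \<in> M0 m D E" for \<nu>
    by (rule qc_version_cong[OF that qc_version_D[OF W] qW]) simp
  have [measurable]: "?u \<in> borel_measurable borel" "?f \<in> borel_measurable borel" "?W \<in> borel_measurable borel"
    using qu qf qc_version_D[OF W] by (auto simp: qc_version_def)
  have Pm: "{x. ?P x} \<in> sets borel" by measurable
  have PJ: "AE z in J. ?P (fst z) \<and> ?P (snd z)"
    by (rule AE_J_if_M0[OF _ Pm]) (rule P)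
  note bdf = beurling_deny_real[OF f qf]
  have jump: "2 * mu_b m D E J u W UNIV \<le> (\<integral>z. (?f (fst z) - ?f (snd z))\<^sup>2 \<partial>J)"
  proof -
    have "2 * mu_b m D E J u W UNIV =
        (\<integral>z. 2 * ((?u (fst z) - ?u (snd z)) * (?W (fst z) - ?W (snd z))) \<partial>J)"
      by (simp add: mu_b_def set_lebesgue_integral_def)
    also have "\<dots> \<le> (\<integral>z. (?f (fst z) - ?f (snd z))\<^sup>2 \<partial>J)"
    \<comment> \<open>The integrand on the left may fail to be integrable, but then its integral is
      \<open>0\<close> and the estimate remains true.\<close>
    proof (rule integral_mono_AE'[OF bdf(1)])
      show "AE z in J. 2 * ((?u (fst z) - ?u (snd z)) * (?W (fst z) - ?W (snd z))) \<le> (?f (fst z) - ?f (snd z))\<^sup>2"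
        using PJ by eventually_elim (simp add: picone_diff)
    qed simp
    finally show ?thesis .
  qed
  have kill: "2 * meas_form m D E k u W \<le> (\<integral>x. (?f x)\<^sup>2 \<partial>k)"
  proof -
    have "2 * meas_form m D E k u W = (\<integral>x. 2 * (?u x * ?W x) \<partial>k)" by (simp add: meas_form_def)
    also have "\<dots> \<le> (\<integral>x. (?f x)\<^sup>2 \<partial>k)"
    proof (rule integral_mono_AE'[OF bdf(2)])
      show "AE x in k. 2 * (?u x * ?W x) \<le> (?f x)\<^sup>2"
        using P[OF k_in_M0] by eventually_elim (use picone_mult in \<open>simp add: mult.assoc\<close>)
    qed simp
    finally show ?thesis .
  qed
  have loc: "2 * mu_c_ext m D \<mu> u W UNIV \<le> \<mu> f f UNIV"
  proof -
    have B: "UNIV \<in> sets (borel :: 'a measure)" by simp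
    interpret MU: psd_form D "\<lambda>u v. \<mu> u v UNIV" by (rule mu_psd[OF B])
    \<comment> \<open>The definition of the extension chooses some \<open>v\<close>; by locality it may
      be replaced by \<open>U\<close>.\<close>
    let ?Q = "\<lambda>v. v \<in> D \<and> (\<exists>G. open G \<and> compact (closure G) \<and> supp m W \<subseteq> G \<and>
            (AE x in m. x \<in> G \<longrightarrow> u x = v x))"
    define v where "v = (SOME v. ?Q v)"
    have "?Q U0" using U0 G Wf by blast
    then have "?Q v" unfolding v_def by (rule someI[of ?Q U0])
    then obtain G' where v: "v \<in> D" and G': "supp m W \<subseteq> G'" "AE x in m. x \<in> G' \<longrightarrow> u x = v x" by blast
    have "AE x in m. x \<in> supp m W \<longrightarrow> v x - U x = 0"
      using G'(2) uU
    proof eventually_elim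
      case (elim x)
      show ?case
      proof
        assume "x \<in> supp m W"
        then have "x \<in> G'" "x \<in> G" using G'(1) Wf G(3) by blast+
        then show "v x - U x = 0" using elim by simp
      qed
    qed
    from mu_local_supp[OF MU.diff_mem[OF v U] W this B]
    have "\<mu> v W UNIV = \<mu> U W UNIV" using MU.diff_left[OF v U W] by simp
    then have ext: "mu_c_ext m D \<mu> u W UNIV = \<mu> U W UNIV" by (simp add: mu_c_ext_def v_def)
    have UW: "(\<lambda>x. U x + W x) \<in> D" using U W by (rule E.add_mem)
    have "\<mu> (\<lambda>x. U x + W x) (\<lambda>x. U x + W x) UNIV = \<mu> R R UNIV"
    proof (rule mu_local_quad[OF UW R open_UNIV _ B])
      show "AE x in m. x \<in> UNIV \<longrightarrow> U x + W x = R x" using WR by eventually_elim simp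
    qed simp
    then have "\<mu> U U UNIV + 2 * \<mu> U W UNIV + \<mu> W W UNIV \<le> \<mu> U U UNIV + \<mu> f f UNIV"
      using muR MU.quad_add[OF U W] by simp
    then show ?thesis using ext MU.nonneg[OF W] by simp
  qed
  show "2 * E_ext m D E J \<mu> k u W \<le> E f f"
    using jump kill loc bdf(3) by (simp add: E_ext_def mu_d_def)
qed

section \<open>The lower bound for the form\<close>

text \<open>
  The eigenvalue equation is tested with \<open>W n\<close>, the test function for \<open>s n * f\<close>. The terms from \<open>E\<close>
  and \<open>\<nu>p\<close> are bounded by the Picone inequality, while the terms from \<open>\<nu>m\<close> and \<open>lam\<close>, whose sign is
  unfavourable or unknown, are kept and converge after division by \<open>(s n)\<^sup>2\<close>.
\<close>

lemma form_bound_compact_supp: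
  assumes lc: "locally compact (UNIV :: 'a set)"
    and \<nu>p: "\<nu>p \<in> M0 m D E" and \<nu>m: "\<nu>m \<in> M1 m D E"
    and u: "generalized_eigenfunction m D E J \<mu> k \<nu>p \<nu>m lam u"
    and u0: "AE x in m. 0 \<le> u x" "AE x in m. u x \<noteq> 0"
    and inv: "(\<lambda>x. inverse (u x)) \<in> D_loc m D"
    and f: "f \<in> h_dom m D E \<nu>p" "compact (supp m f)"
  shows "lam * L2_inner m f f \<le> h_form m D E \<nu>p \<nu>m f f"
proof -
  let ?u = "qc m D E u" and ?f = "qc m D E f"
  have uloc: "u \<in> D_loc m D" using u unfolding generalized_eigenfunction_def D_loc_star_def D_loc_def h_dom_def by blast
  have eig: "h_ext m D E J \<mu> k \<nu>p \<nu>m u w = lam * L2_inner m u w"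
    if "w \<in> h_dom m D E \<nu>p" "compact (supp m w)" for w
    using u that unfolding generalized_eigenfunction_def by blast
  have fD: "f \<in> D" and f\<nu>p: "f \<in> dom_meas m D E \<nu>p" using f(1) by (auto simp: h_dom_def)
  have \<nu>m0: "\<nu>m \<in> M0 m D E" using \<nu>m by (simp add: M1_def)
  have f\<nu>m: "f \<in> dom_meas m D E \<nu>m" using \<nu>m fD unfolding M1_def by blast
  note qu = qc_version_qc[OF qc_version_exists_loc[OF lc uloc]] and qf = qc_version_D[OF fD]
  note qi = qc_version_qc[OF qc_version_exists_loc[OF lc inv]]
  have q0: "qc_version m D E (\<lambda>x. 0) (\<lambda>x. 0)" and q1: "qc_version m D E (\<lambda>x. 1) (\<lambda>x. 1)"
    by (intro qc_version_continuous continuous_intros)+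
  have upos: "AE x in \<nu>m. 0 < ?u x"
  proof -
    have c: "continuous_on UNIV (\<lambda>p :: real \<times> real. fst p * snd p)" by (intro continuous_intros)
    have "qc_version m D E (\<lambda>x. u x * inverse (u x)) (\<lambda>x. ?u x * qc m D E (\<lambda>x. inverse (u x)) x)"
      using qc_version_compose[OF qu qi c] by simp
    moreover have "AE x in m. u x * inverse (u x) = 1" using u0(2) by eventually_elim simp
    ultimately have "AE x in \<nu>m. ?u x * qc m D E (\<lambda>x. inverse (u x)) x = 1"
      using qc_version_cong[OF \<nu>m0 _ q1] by blast
    moreover have "AE x in \<nu>m. 0 \<le> ?u x" by (rule qc_version_le[OF \<nu>m0 q0 qu u0(1)])
    ultimately show ?thesis by eventually_elim (auto simp: less_le)
  qed
  have upos': "AE x in m. 0 < u x" using u0 by eventually_elim simp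
  define s where "s = (\<lambda>n. inverse (real (Suc n)))"
  have s: "s n > 0" "s n \<le> 1" for n by (auto simp: s_def field_simps)
  have s0: "s \<longlonglongrightarrow> 0" unfolding s_def by (rule LIMSEQ_inverse_real_of_nat)
  define W where "W = (\<lambda>n x. sqrt ((u x)\<^sup>2 + (s n * f x)\<^sup>2) - u x)"
  define Lm where "Lm = (\<lambda>n. 2 * (\<integral>x. u x * (sqrt ((u x)\<^sup>2 + (s n * f x)\<^sup>2) - u x) \<partial>m) / (s n)\<^sup>2)"
  define N where "N = (\<lambda>n. 2 * (\<integral>x. ?u x * (sqrt ((?u x)\<^sup>2 + (s n * ?f x)\<^sup>2) - ?u x) \<partial>\<nu>m) / (s n)\<^sup>2)"
  \<comment> \<open>The tested equation divided by \<open>(s n)\<^sup>2\<close>; its two sides converge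
    separately.\<close>
  have main: "lam * Lm n \<le> E f f + meas_form m D E \<nu>p f f - N n" for n
  proof -
    let ?g = "\<lambda>x. s n * f x"
    have g: "?g \<in> D" using fD by (rule E.scale_mem)
    have gle: "AE x in m. \<bar>?g x\<bar> \<le> \<bar>f x\<bar>"
      using s[of n] by (intro AE_I2) (simp add: abs_mult mult_left_le_one_le)
    have gs: "compact (supp m ?g)"
    proof (rule compact_supp[OF f(2)])
      show "AE x in m. x \<notin> supp m f \<longrightarrow> s n * f x = 0"
        using AE_zero_off_supp[of m f] by eventually_elim simp
    qed
    have c: "continuous_on UNIV (\<lambda>p :: real \<times> real. s n * fst p)" by (intro continuous_intros)
    have qg: "qc_version m D E ?g (\<lambda>x. s n * ?f x)" using qc_version_compose[OF qf qf c] by simp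
    have qgf: "AE x in \<nu>. qc m D E ?g x = s n * ?f x" if "\<nu> \<in> M0 m D E" for \<nu>
      by (rule qc_version_cong[OF that qc_version_D[OF g] qg]) simp
    have W: "W n \<in> D" "compact (supp m (W n))"
      "qc_version m D E (W n) (\<lambda>x. sqrt ((?u x)\<^sup>2 + (qc m D E ?g x)\<^sup>2) - ?u x)"
      "2 * E_ext m D E J \<mu> k u (W n) \<le> E ?g ?g"
      using picone_test_function[OF lc uloc u0(1) g gs] by (simp_all add: W_def)
    have qW: "AE x in \<nu>. qc m D E (W n) x = sqrt ((?u x)\<^sup>2 + (s n * ?f x)\<^sup>2) - ?u x"
      if "\<nu> \<in> M0 m D E" for \<nu>
    proof -
      have "AE x in \<nu>. qc m D E (W n) x = sqrt ((?u x)\<^sup>2 + (qc m D E ?g x)\<^sup>2) - ?u x"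
        by (rule qc_version_cong[OF that qc_version_D[OF W(1)] W(3)]) simp
      then show ?thesis using qgf[OF that] by eventually_elim simp
    qed
    have Wle: "AE x in m. \<bar>W n x\<bar> \<le> \<bar>f x\<bar>"
      using gle u0(1)
    proof eventually_elim
      case (elim x)
      have "sqrt ((u x)\<^sup>2 + (?g x)\<^sup>2) \<le> \<bar>u x\<bar> + \<bar>?g x\<bar>" by (rule sqrt_sum_squares_le_sum_abs)
      moreover have "sqrt ((u x)\<^sup>2) \<le> sqrt ((u x)\<^sup>2 + (?g x)\<^sup>2)" by (intro real_sqrt_le_mono) simp
      then have "\<bar>u x\<bar> \<le> sqrt ((u x)\<^sup>2 + (?g x)\<^sup>2)" by simp
      ultimately show ?case using elim unfolding W_def by linarith
    qed
    have Wh: "W n \<in> h_dom m D E \<nu>p"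
      using dom_meas_dominated(1)[OF \<nu>p W(1) f\<nu>p Wle] W(1) by (simp add: h_dom_def)
    have Ebound: "2 * E_ext m D E J \<mu> k u (W n) \<le> (s n)\<^sup>2 * E f f"
      using W(4) by (simp only: E.quad_scale[OF fD])
    have plus: "2 * meas_form m D E \<nu>p u (W n) \<le> (s n)\<^sup>2 * meas_form m D E \<nu>p f f"
    proof -
      have i: "integrable \<nu>p (\<lambda>x. (s n)\<^sup>2 * (?f x)\<^sup>2)" using f\<nu>p by (simp add: dom_meas_def L2_def)
      have "2 * meas_form m D E \<nu>p u (W n) = (\<integral>x. 2 * (?u x * qc m D E (W n) x) \<partial>\<nu>p)"
        by (simp add: meas_form_def)
      also have "\<dots> \<le> (\<integral>x. (s n)\<^sup>2 * (?f x)\<^sup>2 \<partial>\<nu>p)"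
      proof (rule integral_mono_AE'[OF i])
        show "AE x in \<nu>p. 2 * (?u x * qc m D E (W n) x) \<le> (s n)\<^sup>2 * (?f x)\<^sup>2"
          using qW[OF \<nu>p]
        proof eventually_elim
          case (elim x)
          then show ?case using picone_mult[of "?u x" "s n * ?f x"]
            by (simp add: power_mult_distrib mult.assoc)
        qed
      qed simp
      finally show ?thesis by (simp add: meas_form_def power2_eq_square)
    qed
    have minus: "2 * meas_form m D E \<nu>m u (W n) = (s n)\<^sup>2 * N n"
    proof -
      have [measurable]: "?u \<in> borel_measurable \<nu>m" "?f \<in> borel_measurable \<nu>m" "qc m D E (W n) \<in> borel_measurable \<nu>m"
        using qu qf qc_version_D[OF W(1)] \<nu>m0 by (auto simp: qc_version_def M0_def cong: measurable_cong_sets)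
      have "meas_form m D E \<nu>m u (W n) = (\<integral>x. ?u x * (sqrt ((?u x)\<^sup>2 + (s n * ?f x)\<^sup>2) - ?u x) \<partial>\<nu>m)"
        unfolding meas_form_def
      proof (rule integral_cong_AE)
        show "AE x in \<nu>m. ?u x * qc m D E (W n) x = ?u x * (sqrt ((?u x)\<^sup>2 + (s n * ?f x)\<^sup>2) - ?u x)"
          using qW[OF \<nu>m0] by eventually_elim simp
      qed measurable
      then show ?thesis using s(1)[of n] by (simp add: N_def)
    qed
    have "2 * (lam * L2_inner m u (W n)) = 2 * h_ext m D E J \<mu> k \<nu>p \<nu>m u (W n)"
      using eig[OF Wh W(2)] by simp
    also have "\<dots> \<le> (s n)\<^sup>2 * E f f + (s n)\<^sup>2 * meas_form m D E \<nu>p f f - (s n)\<^sup>2 * N n"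
      using Ebound plus minus by (simp add: h_ext_def)
    finally have "lam * ((s n)\<^sup>2 * Lm n) \<le> (s n)\<^sup>2 * (E f f + meas_form m D E \<nu>p f f - N n)"
      using s(1)[of n] by (simp add: Lm_def L2_inner_def W_def algebra_simps)
    then have "(s n)\<^sup>2 * (lam * Lm n) \<le> (s n)\<^sup>2 * (E f f + meas_form m D E \<nu>p f f - N n)"
      by (simp only: mult.left_commute)
    then show ?thesis using s(1)[of n] by (simp add: mult_le_cancel_left_pos)
  qed
  have um: "u \<in> borel_measurable m" using uloc by (simp add: D_loc_def L2_loc_def)
  have "Lm \<longlonglongrightarrow> (\<integral>x. (f x)\<^sup>2 \<partial>m)"
    unfolding Lm_def by (rule ground_state_limit[OF um upos' D_L2[OF fD] s0 s(1)])
  then have 1: "(\<lambda>n. lam * Lm n) \<longlonglongrightarrow> lam * L2_inner m f f"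
    by (intro tendsto_mult_left) (simp add: L2_inner_def power2_eq_square)
  have "?u \<in> borel_measurable \<nu>m"
    using qu \<nu>m0 by (simp add: qc_version_def M0_def cong: measurable_cong_sets)
  moreover have "?f \<in> L2 \<nu>m" using f\<nu>m by (simp add: dom_meas_def)
  ultimately have "N \<longlonglongrightarrow> (\<integral>x. (?f x)\<^sup>2 \<partial>\<nu>m)"
    unfolding N_def by (intro ground_state_limit upos s0 s(1))
  then have 2: "(\<lambda>n. E f f + meas_form m D E \<nu>p f f - N n) \<longlonglongrightarrow>
      E f f + meas_form m D E \<nu>p f f - meas_form m D E \<nu>m f f"
    by (intro tendsto_diff tendsto_const) (simp add: meas_form_def power2_eq_square)
  show ?thesis unfolding h_form_def using LIMSEQ_le[OF 1 2] main by blast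
qed

text \<open>
  Cutting \<open>f\<close> off at the levels \<open>\<bar>w\<bar>\<close> and \<open>- \<bar>w\<bar>\<close>, where \<open>w\<close> has compact support and is close to \<open>f\<close>,
  gives functions with compact support below \<open>\<bar>f\<bar>\<close> that are close to \<open>f\<close> in \<open>L\<^sup>2\<close> and bounded in
  energy. Both properties are stable under midpoints, hence \<open>approx_in_convex_set\<close> improves them to
  an approximation in \<open>E1\<close>.
\<close>

lemma compact_supp_approx:
  assumes f: "f \<in> D"
  shows "\<exists>w. (\<forall>n::nat. w n \<in> D \<and> compact (supp m (w n)) \<and> (AE x in m. \<bar>w n x\<bar> \<le> \<bar>f x\<bar>)) \<and>
    (\<lambda>n. E1 m E (\<lambda>x. w n x - f x) (\<lambda>x. w n x - f x)) \<longlonglongrightarrow> 0"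
proof -
  define K where "K = {w\<in>D. (\<exists>C. compact C \<and> (AE x in m. x \<notin> C \<longrightarrow> w x = 0)) \<and> (AE x in m. \<bar>w x\<bar> \<le> \<bar>f x\<bar>)}"
  \<comment> \<open>The constant comes from applying \<open>E (u \<plusminus> v) \<le> 2 E u + 2 E
    v\<close> to each sum below.\<close>
  define C where "C = 40 * E f f + 24"
  have "\<exists>w. (\<forall>n::nat. w n \<in> K) \<and> (\<lambda>n. E1 m E (\<lambda>x. w n x - f x) (\<lambda>x. w n x - f x)) \<longlonglongrightarrow> 0"
  proof (rule approx_in_convex_set[THEN conjunct2])
    show "K \<subseteq> D" by (auto simp: K_def)
    show "f \<in> L2 m" by (rule D_L2[OF f])
    show "(\<lambda>x. (a x + b x) / 2) \<in> K" if ab: "a \<in> K" "b \<in> K" for a b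
    proof -
      obtain A B where A: "compact A" "AE x in m. x \<notin> A \<longrightarrow> a x = 0"
        and B: "compact B" "AE x in m. x \<notin> B \<longrightarrow> b x = 0" using ab by (auto simp: K_def)
      have "AE x in m. x \<notin> A \<union> B \<longrightarrow> (a x + b x) / 2 = 0" using A(2) B(2) by eventually_elim simp
      moreover have "AE x in m. \<bar>a x\<bar> \<le> \<bar>f x\<bar>" "AE x in m. \<bar>b x\<bar> \<le> \<bar>f x\<bar>" using ab by (auto simp: K_def)
      then have "AE x in m. \<bar>(a x + b x) / 2\<bar> \<le> \<bar>f x\<bar>"
      proof eventually_elim
        case (elim x)
        then show ?case using abs_triangle_ineq[of "a x" "b x"] by (simp add: abs_divide)
      qed
      moreover have "(\<lambda>x. (a x + b x) / 2) \<in> D" using ab by (intro E.midpoint_mem) (auto simp: K_def)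
      ultimately show ?thesis using compact_Un[OF A(1) B(1)] unfolding K_def by blast
    qed
    \<comment> \<open>The function \<open>?c\<close> is \<open>f\<close> truncated to the range between
      \<open>- \<bar>w\<bar>\<close> and \<open>\<bar>w\<bar>\<close>, written with positive parts so
      that it visibly lies in \<open>D\<close>.\<close>
    fix r :: real assume r: "r > 0"
    obtain w where w: "w \<in> D \<inter> Cc" "E1 m E (\<lambda>x. f x - w x) (\<lambda>x. f x - w x) < min r 1"
      using regular f r unfolding regular_dirichlet_form_def by (metis min_less_iff_conj zero_less_one)
    have wD: "w \<in> D" using w by simp
    have fw: "(\<lambda>x. f x - w x) \<in> D" using f wD by (rule E.diff_mem)
    let ?v = "\<lambda>x. \<bar>w x\<bar>" and ?g = "\<lambda>x. - 1 * f x"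
    let ?p = "\<lambda>x. max 0 (f x - \<bar>w x\<bar>)" and ?q = "\<lambda>x. max 0 (- 1 * f x - \<bar>w x\<bar>)"
    let ?c = "\<lambda>x. (f x - ?p x) + ?q x"
    have g: "?g \<in> D" "E ?g ?g = E f f" using E.scale_mem[OF f, of "-1"] E.quad_scale[OF f, of "-1"] by simp_all
    have v: "?v \<in> D" "E ?v ?v \<le> 2 * E f f + 2"
    proof -
      show "?v \<in> D" by (rule abs_mem[OF wD])
      have "E w w \<le> 2 * E f f + 2 * E (\<lambda>x. f x - w x) (\<lambda>x. f x - w x)"
        using E.quad_diff_le[OF f fw] by simp
      then show "E ?v ?v \<le> 2 * E f f + 2" using E_abs[OF wD] E_le_E1[OF fw] w(2) by simp
    qed
    have p: "?p \<in> D" "E ?p ?p \<le> 6 * E f f + 4"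
      using pos_part_mem[OF E.diff_mem[OF f v(1)]] E_pos_part[OF E.diff_mem[OF f v(1)]]
        E.quad_diff_le[OF f v(1)] v(2) by auto
    have q: "?q \<in> D" "E ?q ?q \<le> 6 * E f f + 4"
      using pos_part_mem[OF E.diff_mem[OF g(1) v(1)]] E_pos_part[OF E.diff_mem[OF g(1) v(1)]]
        E.quad_diff_le[OF g(1) v(1)] v(2) g(2) by auto
    have cD: "?c \<in> D" by (rule E.add_mem[OF E.diff_mem[OF f p(1)] q(1)])
    have cE: "E ?c ?c \<le> C"
      using E.quad_add_le[OF E.diff_mem[OF f p(1)] q(1)] E.quad_diff_le[OF f p(1)] p(2) q(2)
      unfolding C_def by linarith
    have "L2_inner m (\<lambda>x. ?c x - f x) (\<lambda>x. ?c x - f x) \<le> L2_inner m (\<lambda>x. f x - w x) (\<lambda>x. f x - w x)"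
      by (rule L2_inner_mono[OF D_L2[OF fw]], rule AE_I2) (auto simp: max_def)
    then have cL: "L2_inner m (\<lambda>x. ?c x - f x) (\<lambda>x. ?c x - f x) \<le> r"
      using L_le_E1[OF fw] w(2) by simp
    have "compact (closure {x. w x \<noteq> 0})" using w(1) by (auto simp: Cc_def)
    moreover have "?c x = 0" if "x \<notin> closure {x. w x \<noteq> 0}" for x
    proof -
      have "w x = 0" using that closure_subset[of "{x. w x \<noteq> 0}"] by blast
      then show ?thesis by (simp add: max_def)
    qed
    moreover have "\<bar>?c x\<bar> \<le> \<bar>f x\<bar>" for x by (auto simp: max_def)
    ultimately have "?c \<in> K" using cD unfolding K_def by blast
    then show "\<exists>w\<in>K. L2_inner m (\<lambda>x. w x - f x) (\<lambda>x. w x - f x) \<le> r \<and> E w w \<le> C"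
      using cL cE by (intro bexI[of _ ?c] conjI)
  qed
  then obtain w where w: "\<And>n::nat. w n \<in> K"
    "(\<lambda>n. E1 m E (\<lambda>x. w n x - f x) (\<lambda>x. w n x - f x)) \<longlonglongrightarrow> 0" by blast
  have "w n \<in> D \<and> compact (supp m (w n)) \<and> (AE x in m. \<bar>w n x\<bar> \<le> \<bar>f x\<bar>)" for n
    using w(1)[of n] compact_supp unfolding K_def by blast
  then show ?thesis using w(2) by blast
qed

text \<open>
  Convergence in \<open>E1\<close> controls \<open>E\<close>, the norm and, by the form bound, \<open>\<nu>m\<close>. It does not control
  \<open>\<nu>p\<close>; there the domination by \<open>\<bar>f\<bar>\<close> is enough, as only an upper bound is needed.
\<close>

lemma form_bound_from_compact_supp:
  assumes \<nu>p: "\<nu>p \<in> M0 m D E" and \<nu>m: "\<nu>m \<in> M1 m D E"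
    and le: "\<And>f. f \<in> h_dom m D E \<nu>p \<Longrightarrow> compact (supp m f) \<Longrightarrow>
      lam * L2_inner m f f \<le> h_form m D E \<nu>p \<nu>m f f"
    and f: "f \<in> h_dom m D E \<nu>p"
  shows "lam * L2_inner m f f \<le> h_form m D E \<nu>p \<nu>m f f"
proof -
  have fD: "f \<in> D" and f\<nu>p: "f \<in> dom_meas m D E \<nu>p" using f by (auto simp: h_dom_def)
  obtain w where w: "\<And>n::nat. w n \<in> D" "\<And>n. compact (supp m (w n))"
    "\<And>n. AE x in m. \<bar>w n x\<bar> \<le> \<bar>f x\<bar>"
    and lim: "(\<lambda>n. E1 m E (\<lambda>x. w n x - f x) (\<lambda>x. w n x - f x)) \<longlonglongrightarrow> 0"
    using compact_supp_approx[OF fD] by blast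
  note l = E_tendsto[of w, OF w(1) fD lim]
  have \<nu>m0: "\<nu>m \<in> M0 m D E" using \<nu>m by (simp add: M1_def)
  obtain q C where qC: "\<And>u. u \<in> D \<Longrightarrow> u \<in> dom_meas m D E \<nu>m"
    "\<And>u. u \<in> D \<Longrightarrow> meas_form m D E \<nu>m u u \<le> q * E u u + C * L2_inner m u u"
    using \<nu>m unfolding M1_def by blast
  interpret N: psd_form D "meas_form m D E \<nu>m"
    by (rule meas_form_psd[OF \<nu>m0]) (use qC(1) in \<open>simp add: dom_meas_def\<close>)
  have nlim: "(\<lambda>n. meas_form m D E \<nu>m (\<lambda>x. w n x - f x) (\<lambda>x. w n x - f x)) \<longlonglongrightarrow> 0"
  proof (rule tendsto_sandwich[OF _ _ tendsto_const])
    show "(\<lambda>n. q * E (\<lambda>x. w n x - f x) (\<lambda>x. w n x - f x) + C * L2_inner m (\<lambda>x. w n x - f x) (\<lambda>x. w n x - f x)) \<longlonglongrightarrow> 0"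
      using tendsto_add[OF tendsto_mult_left[OF l(1), of q] tendsto_mult_left[OF l(2), of C]] by simp
    show "\<forall>\<^sub>F n in sequentially. 0 \<le> meas_form m D E \<nu>m (\<lambda>x. w n x - f x) (\<lambda>x. w n x - f x)"
      by (intro always_eventually allI N.nonneg E.diff_mem w fD)
    show "\<forall>\<^sub>F n in sequentially. meas_form m D E \<nu>m (\<lambda>x. w n x - f x) (\<lambda>x. w n x - f x) \<le>
      q * E (\<lambda>x. w n x - f x) (\<lambda>x. w n x - f x) + C * L2_inner m (\<lambda>x. w n x - f x) (\<lambda>x. w n x - f x)"
      by (intro always_eventually allI qC(2) E.diff_mem w fD)
  qed
  have "lam * L2_inner m (w n) (w n) \<le>
      E (w n) (w n) + meas_form m D E \<nu>p f f - meas_form m D E \<nu>m (w n) (w n)" for n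
  proof -
    note d = dom_meas_dominated[OF \<nu>p w(1)[of n] f\<nu>p w(3)[of n]]
    have "w n \<in> h_dom m D E \<nu>p" using d(1) w(1) by (simp add: h_dom_def)
    from le[OF this w(2)] show ?thesis using d(2) by (simp add: h_form_def)
  qed
  moreover have "(\<lambda>n. lam * L2_inner m (w n) (w n)) \<longlonglongrightarrow> lam * L2_inner m f f"
    by (intro tendsto_mult_left L.tendsto_quad[of w, OF D_L2[OF w(1)] D_L2[OF fD] l(2)])
  moreover have "(\<lambda>n. E (w n) (w n) + meas_form m D E \<nu>p f f - meas_form m D E \<nu>m (w n) (w n))
      \<longlonglongrightarrow> E f f + meas_form m D E \<nu>p f f - meas_form m D E \<nu>m f f"
    by (intro tendsto_intros E.tendsto_quad[of w, OF w(1) fD l(1)] N.tendsto_quad[of w, OF w(1) fD nlim])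
  ultimately show ?thesis unfolding h_form_def using LIMSEQ_le by blast
qed

end

theorem corollary10p4:
  fixes m k \<nu>p \<nu>m :: "'a::{metric_space,second_countable_topology} measure"
    and D :: "('a \<Rightarrow> real) set"
    and E :: "('a \<Rightarrow> real) \<Rightarrow> ('a \<Rightarrow> real) \<Rightarrow> real"
    and J :: "('a \<times> 'a) measure"
    and \<mu>c :: "('a \<Rightarrow> real) \<Rightarrow> ('a \<Rightarrow> real) \<Rightarrow> 'a set \<Rightarrow> real"
    and u :: "'a \<Rightarrow> real" and lam :: real
  assumes "locally compact (UNIV :: 'a set)"
    and "radon_measure m" and "full_support m"
    and "regular_dirichlet_form m D E"
    and "beurling_deny m D E J \<mu>c k"
    and "\<nu>p \<in> M0 m D E" and "\<nu>m \<in> M1 m D E"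
    and "generalized_eigenfunction m D E J \<mu>c k \<nu>p \<nu>m lam u"
    and "AE x in m. 0 \<le> u x"
    and "AE x in m. u x \<noteq> 0"
    and "(\<lambda>x. inverse (u x)) \<in> D_loc_star m D E J D \<inter> Linf_loc m"
  shows "\<forall>\<phi>\<in>h_dom m D E \<nu>p. h_form m D E \<nu>p \<nu>m \<phi> \<phi> \<ge> lam * L2_inner m \<phi> \<phi>"
proof
  interpret beurling_deny_space m D E J \<mu>c k
    by unfold_locales fact+
  have inv: "(\<lambda>x. inverse (u x)) \<in> D_loc m D" using assms(11) by (simp add: D_loc_star_def)
  fix \<phi> assume "\<phi> \<in> h_dom m D E \<nu>p"
  then show "lam * L2_inner m \<phi> \<phi> \<le> h_form m D E \<nu>p \<nu>m \<phi> \<phi>"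
    using form_bound_from_compact_supp[OF assms(6,7)]
      form_bound_compact_supp[OF assms(1,6,7,8,9,10) inv] by blast
qed

end
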